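(* Let $(M,\theta,g)$ be a contact sub-Riemannian manifold with $\dim M=2m+1\geq7$. If $\boldsymbol\tau\neq0$ and $\nabla\mathrm{d}\theta=0$, where $\boldsymbol\tau$ is the sub-torsion and $\nabla$ the Schouten connection, then, after multiplying $g$ by a constant, $(M,\theta,g)$ is pseudo-Hermitian.
   Context: Convention: $\mathrm{d}\theta(X,Y)=X\theta(Y)-Y\theta(X)-\theta([X,Y])$. A contact sub-Riemannian manifold $(M,\theta,g)$ is a connected smooth manifold $M$ with a contact form $\theta$ and a positive definite metric $g$ on $\mathcal{D}=\ker\theta$. The Reeb vector field $\xi$ is given by $\theta(\xi)=1$, $\iota_\xi\mathrm{d}\theta=0$, and $\pi=\mathrm{Id}-\theta\otimes\xi:TM\to\mathcal{D}$. The sub-torsion is $\boldsymbol\tau=\frac12\mathcal{L}_\xi g$ on $\mathcal{D}$; $\boldsymbol\tau\ne0$ means not identically zero. The Schouten connection $\nabla$ is the unique partial connection $\Gamma(\mathcal D)\to\Gamma(\mathcal D^*\otimes\mathcal D)$ with $\nabla g=0$ and $\nabla_XY-\nabla_YX=\pi[X,Y]$ for $X,Y\in\Gamma(\mathcal D)$; it acts on tensors on $\mathcal{D}$, in particular on $\mathrm{d}\theta|_{\mathcal{D}}$. $(M,\theta,g)$ is pseudo-Hermitian if there is a complex structure $J:\mathcal{D}\to\mathcal{D}$ with $g=\mathrm{d}\theta(\cdot,J\cdot)$, $[X,JY]+[JX,Y]\in\Gamma(\mathcal{D})$ and $[X,Y]-[JX,JY]+J([X,JY]+[JX,Y])=0$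 for all $X,Y\in\Gamma(\mathcal{D})$. "After multiplying $g$ by a constant" means: there is a constant $c>0$ such that $(M,\theta,cg)$ is pseudo-Hermitian. *)

theory Defs
  imports "HOL-Analysis.Analysis" "HOL-Library.Function_Algebras"
begin

text \<open>Functions with values in a real vector space form a real vector space pointwise; the ring
  operations on functions are those of \<^theory>\<open>HOL-Library.Function_Algebras\<close>.\<close>

instantiation "fun" :: (type, real_vector) real_vector
begin

definition scaleR_fun :: "real \<Rightarrow> ('a \<Rightarrow> 'b) \<Rightarrow> 'a \<Rightarrow> 'b" where
  "scaleR_fun c f = (\<lambda>x. c *\<^sub>R f x)"

instance
  by standard (simp_all add: scaleR_fun_def fun_eq_iff algebra_simps)

end

text \<open>Linearity on a linear subspace \<open>V\<close> of the domain type; the values outside \<open>V\<close> are irrelevant.\<close>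

definition linear_over :: "'v::real_vector set \<Rightarrow> ('v \<Rightarrow> 'w::real_vector) \<Rightarrow> bool" where
  "linear_over V F \<longleftrightarrow>
     (\<forall>u\<in>V. \<forall>v\<in>V. \<forall>a b. F (a *\<^sub>R u + b *\<^sub>R v) = a *\<^sub>R F u + b *\<^sub>R F v)"


section \<open>Smooth manifolds\<close>

primrec Ck_on :: "nat \<Rightarrow> 'e::euclidean_space set \<Rightarrow> ('e \<Rightarrow> 'f::real_normed_vector) \<Rightarrow> bool" where
  "Ck_on 0 S f \<longleftrightarrow> continuous_on S f"
| "Ck_on (Suc k) S f \<longleftrightarrow> (\<forall>x\<in>S. f differentiable (at x)) \<and>
     (\<forall>v. Ck_on k S (\<lambda>x. frechet_derivative f (at x) v))"

text \<open>Used for open \<open>S\<close> only.\<close>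

definition smooth_on :: "'e::euclidean_space set \<Rightarrow> ('e \<Rightarrow> 'f::real_normed_vector) \<Rightarrow> bool" where
  "smooth_on S f \<longleftrightarrow> (\<forall>k. Ck_on k S f)"

text \<open>The manifold is the whole type \<open>'a\<close>, of dimension \<open>DIM('e)\<close>. Its smooth structure is given by
  an atlas, not required to be maximal; a chart is a pair of its domain and its coordinate map.\<close>

type_synonym ('a, 'e) atlas = "('a set \<times> ('a \<Rightarrow> 'e)) set"

definition smooth_atlas :: "('a::topological_space, 'e::euclidean_space) atlas \<Rightarrow> bool" where
  "smooth_atlas A \<longleftrightarrow>
     (\<Union>(U, \<phi>)\<in>A. U) = UNIV \<and>
     (\<forall>(U, \<phi>)\<in>A. open U \<and> open (\<phi> ` U) \<and> homeomorphism U (\<phi> ` U) \<phi> (inv_into U \<phi>)) \<and>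
     (\<forall>(U, \<phi>)\<in>A. \<forall>(V, \<psi>)\<in>A. smooth_on (\<phi> ` (U \<inter> V)) (\<psi> \<circ> inv_into U \<phi>))"

definition connected_smooth_manifold ::
    "('a::{t2_space, second_countable_topology}, 'e::euclidean_space) atlas \<Rightarrow> bool" where
  "connected_smooth_manifold A \<longleftrightarrow> smooth_atlas A \<and> connected (UNIV :: 'a set)"

definition C_infty :: "('a::topological_space, 'e::euclidean_space) atlas \<Rightarrow> ('a \<Rightarrow> real) set" where
  "C_infty A = {f. \<forall>(U, \<phi>)\<in>A. smooth_on (\<phi> ` U) (f \<circ> inv_into U \<phi>)}"

text \<open>Tangent vectors at \<open>p\<close> are the derivations at \<open>p\<close> of the algebra of smooth functions. They are
  set to 0 on all other functions, so that equality of tangent vectors is equality in HOL.\<close>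

type_synonym 'a tvec = "('a \<Rightarrow> real) \<Rightarrow> real"
type_synonym 'a vfield = "'a \<Rightarrow> 'a tvec"

definition tangent_space ::
    "('a::topological_space, 'e::euclidean_space) atlas \<Rightarrow> 'a \<Rightarrow> 'a tvec set" where
  "tangent_space A p = {v. linear_over (C_infty A) v \<and>
     (\<forall>f\<in>C_infty A. \<forall>h\<in>C_infty A. v (f * h) = v f * h p + f p * v h) \<and>
     (\<forall>f. f \<notin> C_infty A \<longrightarrow> v f = 0)}"

definition app :: "'a vfield \<Rightarrow> ('a \<Rightarrow> real) \<Rightarrow> 'a \<Rightarrow> real" where
  "app X f = (\<lambda>p. X p f)"

definition vector_fields ::
    "('a::topological_space, 'e::euclidean_space) atlas \<Rightarrow> 'a vfield set" where
  "vector_fields A = {X. (\<forall>p. X p \<in> tangent_space A p) \<and> (\<forall>f\<in>C_infty A. app X f \<in> C_infty A)}"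

definition bracket :: "'a vfield \<Rightarrow> 'a vfield \<Rightarrow> 'a vfield" where
  "bracket X Y = (\<lambda>p f. X p (app Y f) - Y p (app X f))"

type_synonym 'a form1 = "'a \<Rightarrow> 'a tvec \<Rightarrow> real"

definition ev :: "'a form1 \<Rightarrow> 'a vfield \<Rightarrow> 'a \<Rightarrow> real" where
  "ev \<theta> X = (\<lambda>p. \<theta> p (X p))"

definition one_forms :: "('a::topological_space, 'e::euclidean_space) atlas \<Rightarrow> 'a form1 set" where
  "one_forms A = {\<theta>. (\<forall>p. linear_over (tangent_space A p) (\<theta> p)) \<and>
     (\<forall>X\<in>vector_fields A. ev \<theta> X \<in> C_infty A)}"

definition ext_d :: "'a form1 \<Rightarrow> 'a vfield \<Rightarrow> 'a vfield \<Rightarrow> 'a \<Rightarrow> real" where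
  "ext_d \<theta> X Y = app X (ev \<theta> Y) - app Y (ev \<theta> X) - ev \<theta> (bracket X Y)"


section \<open>Contact sub-Riemannian manifolds\<close>

text \<open>The distribution ker \<open>\<theta>\<close> and its space of smooth sections.\<close>

definition dist_at ::
    "('a::topological_space, 'e::euclidean_space) atlas \<Rightarrow> 'a form1 \<Rightarrow> 'a \<Rightarrow> 'a tvec set" where
  "dist_at A \<theta> p = {v \<in> tangent_space A p. \<theta> p v = 0}"

definition sections ::
    "('a::topological_space, 'e::euclidean_space) atlas \<Rightarrow> 'a form1 \<Rightarrow> 'a vfield set" where
  "sections A \<theta> = {X \<in> vector_fields A. \<forall>p. X p \<in> dist_at A \<theta> p}"

text \<open>A contact form is a nowhere vanishing 1-form whose differential is nondegenerate on its kernel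
  at every point (vectors in the kernel at \<open>p\<close> are represented by sections through them).\<close>

definition contact_form ::
    "('a::topological_space, 'e::euclidean_space) atlas \<Rightarrow> 'a form1 \<Rightarrow> bool" where
  "contact_form A \<theta> \<longleftrightarrow> \<theta> \<in> one_forms A \<and>
     (\<forall>p. \<exists>v\<in>tangent_space A p. \<theta> p v \<noteq> 0) \<and>
     (\<forall>p. \<forall>X\<in>sections A \<theta>. (\<forall>Y\<in>sections A \<theta>. ext_d \<theta> X Y p = 0) \<longrightarrow> X p = 0)"

type_synonym 'a form2 = "'a \<Rightarrow> 'a tvec \<Rightarrow> 'a tvec \<Rightarrow> real"

definition ev2 :: "'a form2 \<Rightarrow> 'a vfield \<Rightarrow> 'a vfield \<Rightarrow> 'a \<Rightarrow> real" where
  "ev2 g X Y = (\<lambda>p. g p (X p) (Y p))"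

definition sub_metric ::
    "('a::topological_space, 'e::euclidean_space) atlas \<Rightarrow> 'a form1 \<Rightarrow> 'a form2 \<Rightarrow> bool" where
  "sub_metric A \<theta> g \<longleftrightarrow>
     (\<forall>p. \<forall>u\<in>dist_at A \<theta> p.
        linear_over (dist_at A \<theta> p) (g p u) \<and>
        (\<forall>v\<in>dist_at A \<theta> p. g p u v = g p v u) \<and>
        (u \<noteq> 0 \<longrightarrow> g p u u > 0)) \<and>
     (\<forall>X\<in>sections A \<theta>. \<forall>Y\<in>sections A \<theta>. ev2 g X Y \<in> C_infty A)"

definition contact_sub_Riemannian ::
    "('a::{t2_space, second_countable_topology}, 'e::euclidean_space) atlas \<Rightarrow>
     'a form1 \<Rightarrow> 'a form2 \<Rightarrow> bool" where
  "contact_sub_Riemannian A \<theta> g \<longleftrightarrow>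
     connected_smooth_manifold A \<and> contact_form A \<theta> \<and> sub_metric A \<theta> g"

definition Reeb_field ::
    "('a::topological_space, 'e::euclidean_space) atlas \<Rightarrow> 'a form1 \<Rightarrow> 'a vfield \<Rightarrow> bool" where
  "Reeb_field A \<theta> \<xi> \<longleftrightarrow> \<xi> \<in> vector_fields A \<and> ev \<theta> \<xi> = 1 \<and>
     (\<forall>X\<in>vector_fields A. ext_d \<theta> \<xi> X = 0)"

definition proj_dist :: "'a form1 \<Rightarrow> 'a vfield \<Rightarrow> 'a vfield \<Rightarrow> 'a vfield" where
  "proj_dist \<theta> \<xi> X = (\<lambda>p. X p - \<theta> p (X p) *\<^sub>R \<xi> p)"

definition sub_torsion :: "'a vfield \<Rightarrow> 'a form2 \<Rightarrow> 'a vfield \<Rightarrow> 'a vfield \<Rightarrow> 'a \<Rightarrow> real" where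
  "sub_torsion \<xi> g X Y =
     (1/2) *\<^sub>R (app \<xi> (ev2 g X Y) - ev2 g (bracket \<xi> X) Y - ev2 g X (bracket \<xi> Y))"


section \<open>The Schouten connection\<close>

text \<open>Smooth sections of the endomorphism bundle of ker \<open>\<theta>\<close>, and their action on sections.\<close>

type_synonym 'a endo = "'a \<Rightarrow> 'a tvec \<Rightarrow> 'a tvec"

definition act :: "'a endo \<Rightarrow> 'a vfield \<Rightarrow> 'a vfield" where
  "act B X = (\<lambda>p. B p (X p))"

definition endo_fields ::
    "('a::topological_space, 'e::euclidean_space) atlas \<Rightarrow> 'a form1 \<Rightarrow> 'a endo set" where
  "endo_fields A \<theta> = {B.
     (\<forall>p. linear_over (dist_at A \<theta> p) (B p) \<and> B p ` dist_at A \<theta> p \<subseteq> dist_at A \<theta> p) \<and>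
     (\<forall>X\<in>sections A \<theta>. act B X \<in> sections A \<theta>)}"

text \<open>A partial connection \<open>D\<close> maps a section \<open>Y\<close> of ker \<open>\<theta>\<close> to the endomorphism field \<open>D Y\<close>; the
  covariant derivative of \<open>Y\<close> along \<open>X\<close> is \<open>act (D Y) X\<close>.\<close>

type_synonym 'a partial_conn = "'a vfield \<Rightarrow> 'a endo"

definition partial_connection ::
    "('a::topological_space, 'e::euclidean_space) atlas \<Rightarrow> 'a form1 \<Rightarrow> 'a partial_conn \<Rightarrow> bool" where
  "partial_connection A \<theta> D \<longleftrightarrow>
     (\<forall>Y\<in>sections A \<theta>. D Y \<in> endo_fields A \<theta>) \<and>
     (\<forall>Y\<in>sections A \<theta>. \<forall>Z\<in>sections A \<theta>. \<forall>p. \<forall>v\<in>dist_at A \<theta> p.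
        D (Y + Z) p v = D Y p v + D Z p v) \<and>
     (\<forall>f\<in>C_infty A. \<forall>Y\<in>sections A \<theta>. \<forall>p. \<forall>v\<in>dist_at A \<theta> p.
        D (\<lambda>q. f q *\<^sub>R Y q) p v = v f *\<^sub>R Y p + f p *\<^sub>R D Y p v)"

definition cov :: "'a partial_conn \<Rightarrow> 'a vfield \<Rightarrow> 'a vfield \<Rightarrow> 'a vfield" where
  "cov D X Y = act (D Y) X"

text \<open>Covariant derivative, along \<open>X\<close>, of a covariant 2-tensor \<open>T\<close> on ker \<open>\<theta>\<close> given by its values on
  sections.\<close>

definition cov2 :: "'a partial_conn \<Rightarrow> ('a vfield \<Rightarrow> 'a vfield \<Rightarrow> 'a \<Rightarrow> real) \<Rightarrow>
    'a vfield \<Rightarrow> 'a vfield \<Rightarrow> 'a vfield \<Rightarrow> 'a \<Rightarrow> real" where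
  "cov2 D T X Y Z = app X (T Y Z) - T (cov D X Y) Z - T Y (cov D X Z)"

definition parallel2 :: "('a::topological_space, 'e::euclidean_space) atlas \<Rightarrow> 'a form1 \<Rightarrow>
    'a partial_conn \<Rightarrow> ('a vfield \<Rightarrow> 'a vfield \<Rightarrow> 'a \<Rightarrow> real) \<Rightarrow> bool" where
  "parallel2 A \<theta> D T \<longleftrightarrow>
     (\<forall>X\<in>sections A \<theta>. \<forall>Y\<in>sections A \<theta>. \<forall>Z\<in>sections A \<theta>. cov2 D T X Y Z = 0)"

definition Schouten_connection :: "('a::topological_space, 'e::euclidean_space) atlas \<Rightarrow>
    'a form1 \<Rightarrow> 'a form2 \<Rightarrow> 'a vfield \<Rightarrow> 'a partial_conn \<Rightarrow> bool" where
  "Schouten_connection A \<theta> g \<xi> D \<longleftrightarrow>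
     partial_connection A \<theta> D \<and> parallel2 A \<theta> D (ev2 g) \<and>
     (\<forall>X\<in>sections A \<theta>. \<forall>Y\<in>sections A \<theta>.
        cov D X Y - cov D Y X = proj_dist \<theta> \<xi> (bracket X Y))"


section \<open>Pseudo-Hermitian manifolds\<close>

definition pseudo_Hermitian ::
    "('a::{t2_space, second_countable_topology}, 'e::euclidean_space) atlas \<Rightarrow>
     'a form1 \<Rightarrow> 'a form2 \<Rightarrow> bool" where
  "pseudo_Hermitian A \<theta> g \<longleftrightarrow> contact_sub_Riemannian A \<theta> g \<and>
     (\<exists>J\<in>endo_fields A \<theta>.
        (\<forall>p. \<forall>v\<in>dist_at A \<theta> p. J p (J p v) = - v) \<and>
        (\<forall>X\<in>sections A \<theta>. \<forall>Y\<in>sections A \<theta>.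
           ev2 g X Y = ext_d \<theta> X (act J Y) \<and>
           bracket X (act J Y) + bracket (act J X) Y \<in> sections A \<theta> \<and>
           bracket X Y - bracket (act J X) (act J Y)
             + act J (bracket X (act J Y) + bracket (act J X) Y) = 0))"

end

theory Submission
  imports Defs
begin

text \<open>Write \<open>\<omega>\<close> for \<open>d\<theta>\<close> on the distribution, \<open>\<omega>(X,Y) = g(AX,Y)\<close>, and let \<open>R\<close> be the curvature of the Schouten
  connection, where the missing derivative along \<open>\<xi>\<close> is replaced by the Lie derivative. As \<open>g\<close> and \<open>\<omega>\<close>
  are parallel and \<open>\<xi>\<close> preserves \<open>\<omega>\<close>, every \<open>R(X,Y)\<close> is infinitesimally symplectic, its \<open>g\<close>-symmetric part is
  \<open>-\<omega>(X,Y) \<tau>\<close>, and the Bianchi identity holds. Hence \<open>R = K + \<omega> \<otimes> C\<close> with \<open>K\<close> skew and commuting with \<open>A\<close>.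
  If \<open>A\<^sup>2\<close> were not scalar at a point, split the distribution there into an eigenspace of \<open>A\<^sup>2\<close> and its complement;
  one summand has dimension at least 3, and the Bianchi identity forces the symmetric part of \<open>C\<close>, hence \<open>\<tau>\<close>,
  to vanish there. So \<open>A\<^sup>2 = \<mu>\<close> with \<open>\<mu> < 0\<close> at a point where \<open>\<tau> \<noteq> 0\<close>. The tensor \<open>A\<^sup>2 - \<mu>\<close> is parallel, so its norm
  is constant in horizontal directions and therefore, the distribution being bracket generating, constant.
  Thus \<open>A\<^sup>2 = \<mu>\<close> everywhere, and \<open>J = A / sqrt (- \<mu>)\<close> is parallel, which gives integrability because
  the Schouten connection is torsion-free.\<close>

section \<open>Calculus of smooth maps\<close>

text \<open>The obstacle is that \<nabla> differentiates only along the distribution, while the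
  commutator of two horizontal derivatives contains a derivative along \<xi>. The Lie derivative is
  a usable substitute because it maps sections to sections and respects \<omega>; it fails to
  respect g, and the failure is exactly 2\<tau>. This is how the torsion becomes the symmetric part
  of a curvature. Since that part is \<omega>(X,Y) times one fixed form, it can be peeled off with a
  single sample C of the curvature, taken at a pair of vectors on which \<omega> has the value 1.
  The dimension enters through one fact: in a summand of dimension at least 3, every vector q leaves
  room for a nonzero vector orthogonal to both q and Aq. This kills the blocks of C that mix the two
  summands; the other blocks are killed by any nonzero vector of the opposite summand. Tangent
  vectors are derivations here, so a finite basis, smooth extensions and local orthonormal frames of
  the distribution have to be built before the curvature can be treated by linear algebra.\<close>

lemma Ck_on_cong:
  assumes "open S" "\<And>x. x \<in> S \<Longrightarrow> f x = g x" "Ck_on k S f"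
  shows "Ck_on k S g"
  using assms(2,3)
proof (induction k arbitrary: f g)
  case 0
  then show ?case using continuous_on_cong[OF refl, of S f g] by simp
next
  case (Suc k)
  have der: "(g has_derivative frechet_derivative f (at x)) (at x)" if "x \<in> S" for x
    using Suc.prems that assms(1)
    by (auto simp: frechet_derivative_works intro!: has_derivative_transform_within_open[of f _ x UNIV S g])
  then have "frechet_derivative g (at x) = frechet_derivative f (at x)" if "x \<in> S" for x
    using frechet_derivative_at that by metis
  then show ?case
    using der Suc.prems Suc.IH[of "\<lambda>x. frechet_derivative f (at x) v" "\<lambda>x. frechet_derivative g (at x) v" for v]
    by (auto simp: differentiable_def)
qed

text \<open>Derivatives are unique, so any formula for the derivative may replace
  \<open>frechet_derivative\<close>; the inductions below then work directly with the sum, product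
  and chain rules.\<close>

lemma Ck_on_SucI:
  assumes "open S" "\<And>x. x \<in> S \<Longrightarrow> (f has_derivative f' x) (at x)"
    and "\<And>v. Ck_on k S (\<lambda>x. f' x v)"
  shows "Ck_on (Suc k) S f"
proof -
  have "f' x = frechet_derivative f (at x)" if "x \<in> S" for x
    using frechet_derivative_at assms(2) that by metis
  then show ?thesis
    using assms Ck_on_cong[OF assms(1), of "\<lambda>x. f' x v" "\<lambda>x. frechet_derivative f (at x) v" k for v]
    by (auto simp: differentiable_def)
qed

lemma Ck_on_SucD:
  assumes "Ck_on (Suc k) S f"
  shows "x \<in> S \<Longrightarrow> (f has_derivative frechet_derivative f (at x)) (at x)"
    and "Ck_on k S (\<lambda>x. frechet_derivative f (at x) v)"
  using assms by (auto simp: frechet_derivative_works)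

lemma Ck_on_subset: "Ck_on k S f \<Longrightarrow> T \<subseteq> S \<Longrightarrow> Ck_on k T f"
  by (induction k arbitrary: f) (auto intro: continuous_on_subset)

lemma Ck_on_Suc_imp: "Ck_on (Suc k) S f \<Longrightarrow> Ck_on k S f"
proof (induction k arbitrary: f)
  case 0
  then show ?case
    by (auto intro!: continuous_at_imp_continuous_on differentiable_imp_continuous_within)
next
  case (Suc k)
  then show ?case by (metis Ck_on.simps(2))
qed

lemma Ck_on_local:
  assumes "\<And>x. x \<in> S \<Longrightarrow> \<exists>T. open T \<and> x \<in> T \<and> Ck_on k T f"
  shows "Ck_on k S f"
  using assms
proof (induction k arbitrary: f)
  case 0
  have "isCont f x" if "x \<in> S" for x
    using 0[OF that] by (auto simp: continuous_on_eq_continuous_at)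
  then show ?case by (auto intro!: continuous_at_imp_continuous_on)
next
  case (Suc k)
  show ?case unfolding Ck_on.simps
  proof (intro conjI ballI allI)
    show "f differentiable at x" if "x \<in> S" for x using Suc.prems[OF that] by auto
    show "Ck_on k S (\<lambda>x. frechet_derivative f (at x) v)" for v
    proof (rule Suc.IH)
      show "\<exists>T. open T \<and> x \<in> T \<and> Ck_on k T (\<lambda>x. frechet_derivative f (at x) v)" if "x \<in> S" for x
        using Suc.prems[OF that] by auto
    qed
  qed
qed

lemma Ck_on_const: "open S \<Longrightarrow> Ck_on k S (\<lambda>x. c)"
proof (induction k arbitrary: c)
  case (Suc k)
  then show ?case by (intro Ck_on_SucI[of S _ "\<lambda>x v. 0"]) auto
qed simp

lemma Ck_on_linear:
  assumes "open S" "bounded_linear L" "Ck_on k S f"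
  shows "Ck_on k S (\<lambda>x. L (f x))"
  using assms(3)
proof (induction k arbitrary: f)
  case 0
  then show ?case using assms(2) by (auto intro: bounded_linear.continuous_on)
next
  case (Suc k)
  show ?case
    by (rule Ck_on_SucI[OF assms(1) bounded_linear.has_derivative[OF assms(2) Ck_on_SucD(1)[OF Suc.prems]]
          Suc.IH[OF Ck_on_SucD(2)[OF Suc.prems]]])
qed

lemma Ck_on_ident: "open S \<Longrightarrow> Ck_on k S (\<lambda>x. x)"
proof (cases k)
  case (Suc j)
  assume "open S"
  then show ?thesis unfolding Suc by (intro Ck_on_SucI[of S _ "\<lambda>x v. v"]) (auto intro: Ck_on_const)
qed simp

lemma Ck_on_add:
  assumes "open S" "Ck_on k S f" "Ck_on k S g"
  shows "Ck_on k S (\<lambda>x. f x + g x)"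
  using assms(2,3)
proof (induction k arbitrary: f g)
  case 0
  then show ?case by (auto intro: continuous_intros)
next
  case (Suc k)
  show ?case
    by (rule Ck_on_SucI[OF assms(1) has_derivative_add[OF Ck_on_SucD(1)[OF Suc.prems(1)] Ck_on_SucD(1)[OF Suc.prems(2)]]
        Suc.IH[OF Ck_on_SucD(2)[OF Suc.prems(1)] Ck_on_SucD(2)[OF Suc.prems(2)]]])
qed

lemma Ck_on_sum:
  assumes "open S" "\<And>i. i \<in> I \<Longrightarrow> Ck_on k S (f i)"
  shows "Ck_on k S (\<lambda>x. \<Sum>i\<in>I. f i x)"
  using assms(2)
  by (induction I rule: infinite_finite_induct) (auto intro: Ck_on_const Ck_on_add assms(1))

lemma Ck_on_scaleR:
  assumes "open S" "Ck_on k S f" "Ck_on k S g"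
  shows "Ck_on k S (\<lambda>x. f x *\<^sub>R g x)"
  using assms(2,3)
proof (induction k arbitrary: f g)
  case 0
  then show ?case by (auto intro: continuous_intros)
next
  case (Suc k)
  show ?case
    by (rule Ck_on_SucI[OF assms(1) has_derivative_scaleR[OF Ck_on_SucD(1)[OF Suc.prems(1)] Ck_on_SucD(1)[OF Suc.prems(2)]]
        Ck_on_add[OF assms(1) Suc.IH[OF Ck_on_Suc_imp[OF Suc.prems(1)] Ck_on_SucD(2)[OF Suc.prems(2)]]
         Suc.IH[OF Ck_on_SucD(2)[OF Suc.prems(1)] Ck_on_Suc_imp[OF Suc.prems(2)]]]])
qed

text \<open>In the chain rule a linear map depending on \<open>x\<close> is applied to a vector that
  also depends on \<open>x\<close>. Expanding that vector in the basis gives a finite sum of scalar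
  functions times partial derivatives of \<open>f\<close> composed with \<open>g\<close>, and the
  induction hypothesis applies to those partial derivatives.\<close>

lemma Ck_on_compose:
  fixes f :: "'e::euclidean_space \<Rightarrow> 'f::real_normed_vector"
  assumes "open S" "open T" "g ` S \<subseteq> T" "Ck_on k T f" "Ck_on k S g"
  shows "Ck_on k S (\<lambda>x. f (g x))"
  using assms(4,5)
proof (induction k arbitrary: f)
  case 0
  then show ?case using assms(3) by (auto intro: continuous_on_compose2)
next
  case (Suc k)
  let ?F = "\<lambda>x. frechet_derivative f (at x)" and ?G = "\<lambda>x. frechet_derivative g (at x)"
  have der: "((\<lambda>x. f (g x)) has_derivative (\<lambda>v. \<Sum>b\<in>Basis. (?G x v \<bullet> b) *\<^sub>R ?F (g x) b)) (at x)"
    if "x \<in> S" for x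
  proof -
    have "(f has_derivative ?F (g x)) (at (g x))"
      using that assms(3) by (intro Ck_on_SucD(1)[OF Suc.prems(1)]) auto
    then have 1: "((\<lambda>x. f (g x)) has_derivative (\<lambda>v. ?F (g x) (?G x v))) (at x)" "linear (?F (g x))"
      using has_derivative_compose[OF Ck_on_SucD(1)[OF Suc.prems(2) that], of f "?F (g x)"]
      by (auto simp: has_derivative_linear)
    have "?F (g x) w = (\<Sum>b\<in>Basis. (w \<bullet> b) *\<^sub>R ?F (g x) b)" for w
    proof -
      have "?F (g x) (\<Sum>b\<in>Basis. (w \<bullet> b) *\<^sub>R b) = (\<Sum>b\<in>Basis. (w \<bullet> b) *\<^sub>R ?F (g x) b)"
        unfolding linear_sum[OF 1(2)] linear_scale[OF 1(2)] ..
      then show ?thesis by (simp only: euclidean_representation)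
    qed
    then have "(\<lambda>v. ?F (g x) (?G x v)) = (\<lambda>v. \<Sum>b\<in>Basis. (?G x v \<bullet> b) *\<^sub>R ?F (g x) b)"
      by (rule ext)
    with 1(1) show ?thesis by (simp only:)
  qed
  have "Ck_on k S (\<lambda>x. \<Sum>b\<in>Basis. (?G x v \<bullet> b) *\<^sub>R ?F (g x) b)" for v
    by (intro Ck_on_sum Ck_on_scaleR Suc.IH[OF Ck_on_SucD(2)[OF Suc.prems(1)] Ck_on_Suc_imp[OF Suc.prems(2)]]
        assms(1) Ck_on_linear[OF assms(1) bounded_linear_inner_left Ck_on_SucD(2)[OF Suc.prems(2)]])
  then show ?case using Ck_on_SucI[OF assms(1) der] by blast
qed

lemma smooth_on_cong:
  "open S \<Longrightarrow> (\<And>x. x \<in> S \<Longrightarrow> f x = g x) \<Longrightarrow> smooth_on S f \<Longrightarrow> smooth_on S g"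
  using Ck_on_cong[of S f g] by (auto simp: smooth_on_def)

lemma smooth_on_subset: "smooth_on S f \<Longrightarrow> T \<subseteq> S \<Longrightarrow> smooth_on T f"
  by (auto simp: smooth_on_def intro: Ck_on_subset)

lemma smooth_on_local:
  assumes "\<And>x. x \<in> S \<Longrightarrow> \<exists>T. open T \<and> x \<in> T \<and> smooth_on T f"
  shows "smooth_on S f"
  unfolding smooth_on_def using assms by (intro allI Ck_on_local) (auto simp: smooth_on_def)

lemma smooth_on_const: "open S \<Longrightarrow> smooth_on S (\<lambda>x. c)"
  by (simp add: smooth_on_def Ck_on_const)

lemma smooth_on_linear: "open S \<Longrightarrow> bounded_linear L \<Longrightarrow> smooth_on S f \<Longrightarrow> smooth_on S (\<lambda>x. L (f x))"
  by (simp add: smooth_on_def Ck_on_linear)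

lemma smooth_on_ident: "open S \<Longrightarrow> smooth_on S (\<lambda>x. x)"
  by (simp add: smooth_on_def Ck_on_ident)

lemma smooth_on_add: "open S \<Longrightarrow> smooth_on S f \<Longrightarrow> smooth_on S g \<Longrightarrow> smooth_on S (\<lambda>x. f x + g x)"
  by (simp add: smooth_on_def Ck_on_add)

lemma smooth_on_mult:
  fixes f g :: "'e::euclidean_space \<Rightarrow> real"
  shows "open S \<Longrightarrow> smooth_on S f \<Longrightarrow> smooth_on S g \<Longrightarrow> smooth_on S (\<lambda>x. f x * g x)"
  using Ck_on_scaleR[of S _ f g] by (simp add: smooth_on_def)

lemma smooth_on_compose:
  "open S \<Longrightarrow> open T \<Longrightarrow> g ` S \<subseteq> T \<Longrightarrow> smooth_on T f \<Longrightarrow> smooth_on S g \<Longrightarrow> smooth_on S (\<lambda>x. f (g x))"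
  by (simp add: smooth_on_def Ck_on_compose)

lemma smooth_on_has_derivative:
  "smooth_on S f \<Longrightarrow> x \<in> S \<Longrightarrow> (f has_derivative frechet_derivative f (at x)) (at x)"
  by (meson smooth_on_def Ck_on_SucD(1))

lemma smooth_on_frechet_derivative:
  "smooth_on S f \<Longrightarrow> smooth_on S (\<lambda>x. frechet_derivative f (at x) v)"
  by (auto simp: smooth_on_def intro: Ck_on_SucD(2))

lemma smooth_on_imp_continuous_on: "smooth_on S f \<Longrightarrow> continuous_on S f"
  by (metis smooth_on_def Ck_on.simps(1))

section \<open>Smooth functions of one variable, and bump functions\<close>

lemma Ck_on_SucI_real:
  fixes f :: "real \<Rightarrow> real"
  assumes "open S" "\<And>x. x \<in> S \<Longrightarrow> (f has_real_derivative f' x) (at x)" "Ck_on k S f'"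
  shows "Ck_on (Suc k) S f"
  using assms(2) Ck_on_linear[OF assms(1) bounded_linear_mult_left assms(3)]
  by (intro Ck_on_SucI[OF assms(1), of f "\<lambda>x v. f' x * v"]) (auto simp: has_field_derivative_def)

text \<open>The induction needs all exponents, since differentiation lowers the exponent by one.
  Exponent -1 later replaces division, and exponent -1/2 normalises vector fields.\<close>

lemma smooth_on_powr: "smooth_on {0<..} (\<lambda>t::real. t powr a)"
proof -
  have "Ck_on k {0<..} (\<lambda>t::real. t powr a)" for k
  proof (induction k arbitrary: a)
    case 0
    show ?case by (auto intro!: continuous_intros)
  next
    case (Suc k)
    show ?case
      by (rule Ck_on_SucI_real[OF _ _ Ck_on_linear[OF _ bounded_linear_mult_right[of a] Suc[of "a - 1"]]])
        (auto intro!: has_real_derivative_powr)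
  qed
  then show ?thesis by (simp add: smooth_on_def)
qed

text \<open>The classical t^(-n) exp(-1/t), extended by 0 to t \<le> 0. Differentiation turns a
  member of the family into a combination of members, which is why all \<open>n\<close> are treated
  together.\<close>

definition flat :: "nat \<Rightarrow> real \<Rightarrow> real" where
  "flat n t = (if t > 0 then inverse t ^ n * exp (- inverse t) else 0)"

text \<open>This is the difference quotient at 0, as \<open>flat n 0 = 0\<close>. With 1/t as the
  new variable, the right-hand limit says that the exponential outgrows every power.\<close>

lemma flat_tendsto_0: "((\<lambda>t. flat n t / t) \<longlongrightarrow> 0) (at 0)"
proof -
  have "((\<lambda>t. inverse t ^ Suc n / exp (inverse t)) \<longlongrightarrow> (0::real)) (at_right 0)"
    by (rule filterlim_compose[OF tendsto_power_div_exp_0 filterlim_inverse_at_top_right])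
  then have "((\<lambda>t. flat n t / t) \<longlongrightarrow> 0) (at_right 0)"
    by (rule Lim_transform_eventually)
      (auto simp: eventually_at_filter flat_def exp_minus divide_simps)
  moreover have "((\<lambda>t. flat n t / t) \<longlongrightarrow> 0) (at_left 0)"
    by (rule Lim_transform_eventually[OF tendsto_const])
      (auto simp: eventually_at_filter flat_def)
  ultimately show ?thesis by (simp add: filterlim_split_at)
qed

lemma flat_has_derivative:
  "(flat n has_real_derivative (flat (n + 2) t - real n * flat (n + 1) t)) (at t)"
proof -
  consider "t > 0" | "t < 0" | "t = 0" by linarith
  then show ?thesis
  proof cases
    case 1
    have "((\<lambda>t. inverse t ^ n * exp (- inverse t)) has_real_derivative
       (flat (n + 2) t - real n * flat (n + 1) t)) (at t)"
    proof (cases n)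
      case 0
      with 1 show ?thesis
        by (auto intro!: derivative_eq_intros simp: flat_def field_simps power2_eq_square)
    next
      case (Suc k)
      have "k = 0 \<or> inverse t * inverse t ^ (k - Suc 0) = inverse t ^ k"
        by (cases k) auto
      with 1 Suc show ?thesis
        by (elim disjE) (auto intro!: derivative_eq_intros simp: flat_def algebra_simps)
    qed
    then show ?thesis
      by (rule DERIV_cong_ev[THEN iffD1, rotated -1, OF _ refl _ refl])
        (use 1 in \<open>auto simp: flat_def intro!: eventually_nhds_in_open[of "{0<..}" t, THEN eventually_mono]\<close>)
  next
    case 2
    have "((\<lambda>t. 0) has_real_derivative (flat (n + 2) t - real n * flat (n + 1) t)) (at t)"
      using 2 by (simp add: flat_def)
    then show ?thesis
      by (rule DERIV_cong_ev[THEN iffD1, rotated -1, OF _ refl _ refl])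
        (use 2 in \<open>auto simp: flat_def intro!: eventually_nhds_in_open[of "{..<0}" t, THEN eventually_mono]\<close>)
  next
    case 3
    have "((\<lambda>t. (flat n t - flat n 0) / (t - 0)) \<longlongrightarrow> 0) (at 0)"
      using flat_tendsto_0 by (simp add: flat_def)
    then show ?thesis using 3 by (simp add: has_field_derivative_iff flat_def)
  qed
qed

lemma smooth_on_flat: "smooth_on UNIV (flat n)"
proof -
  have "Ck_on k UNIV (flat n)" for k
  proof (induction k arbitrary: n)
    case 0
    show ?case
      using DERIV_isCont[OF flat_has_derivative] by (auto intro!: continuous_at_imp_continuous_on)
  next
    case (Suc k)
    have "Ck_on k UNIV (\<lambda>t. flat (n + 2) t + (- real n) * flat (n + 1) t)"
      by (intro Ck_on_add Suc open_UNIV Ck_on_linear[OF _ bounded_linear_mult_right])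
    then show ?case
      by (intro Ck_on_SucI_real[OF open_UNIV flat_has_derivative]) simp
  qed
  then show ?thesis by (simp add: smooth_on_def)
qed

lemma smooth_step:
  obtains s :: "real \<Rightarrow> real" where "smooth_on UNIV s" "\<And>t. t \<le> 1 \<Longrightarrow> s t = 1" "\<And>t. t \<ge> 2 \<Longrightarrow> s t = 0"
proof
  let ?a = "\<lambda>t. flat 0 (2 + (-1) * t)" and ?b = "\<lambda>t. flat 0 (-1 + t)"
  \<comment> \<open>The usual quotient a / (a + b), with division written as the power -1. The
    denominator is positive because 2 - t and t - 1 cannot both be nonpositive.\<close>
  let ?s = "\<lambda>t. ?a t * (?a t + ?b t) powr (-1)"
  have a: "smooth_on UNIV ?a"
    by (intro smooth_on_compose[OF _ _ _ smooth_on_flat] smooth_on_add smooth_on_const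
        smooth_on_linear[OF _ bounded_linear_mult_right] smooth_on_ident) auto
  have b: "smooth_on UNIV ?b"
    by (intro smooth_on_compose[OF _ _ _ smooth_on_flat] smooth_on_add smooth_on_const smooth_on_ident) auto
  have "?a t + ?b t > 0" for t
    by (cases "t < 2") (auto simp: flat_def add_pos_nonneg)
  then show "smooth_on UNIV ?s"
    by (intro smooth_on_mult a smooth_on_compose[OF _ _ _ smooth_on_powr] smooth_on_add b) auto
  show "?s t = 1" if "t \<le> 1" for t using that by (auto simp: flat_def powr_minus)
  show "?s t = 0" if "t \<ge> 2" for t using that by (auto simp: flat_def)
qed

text \<open>The squared distance is used because it is a polynomial, whereas the norm is not
  differentiable at \<open>a\<close>. Outside the ball of radius \<open>2 * r\<close> the scaled
  square is at least 4, beyond the point 2 where the step has reached 0.\<close>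

lemma smooth_bump:
  fixes a :: "'e::euclidean_space"
  assumes "r > 0"
  obtains \<beta> :: "'e \<Rightarrow> real" where "smooth_on UNIV \<beta>" "\<And>x. x \<in> ball a r \<Longrightarrow> \<beta> x = 1"
    "\<And>x. x \<notin> cball a (2 * r) \<Longrightarrow> \<beta> x = 0"
proof -
  obtain s :: "real \<Rightarrow> real" where s: "smooth_on UNIV s" "\<And>t. t \<le> 1 \<Longrightarrow> s t = 1" "\<And>t. t \<ge> 2 \<Longrightarrow> s t = 0"
    by (rule smooth_step) blast
  let ?q = "\<lambda>x. (1 / r\<^sup>2) * (\<Sum>b\<in>Basis. ((x + (- a)) \<bullet> b) * ((x + (- a)) \<bullet> b))"
  have q: "?q x = (dist a x / r)\<^sup>2" for x
    unfolding dist_norm norm_minus_commute[of a] power_divide power2_norm_eq_inner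
    by (subst euclidean_inner) simp
  have "smooth_on UNIV (\<lambda>x. ((x + (- a)) \<bullet> b) * ((x + (- a)) \<bullet> b))" for b
    by (intro smooth_on_mult smooth_on_linear[OF _ bounded_linear_inner_left] smooth_on_add smooth_on_ident
        smooth_on_const open_UNIV)
  then have "smooth_on UNIV ?q"
    by (intro smooth_on_linear[OF open_UNIV bounded_linear_mult_right])
      (auto simp: smooth_on_def intro!: Ck_on_sum)
  then have 1: "smooth_on UNIV (\<lambda>x. s (?q x))"
    by (intro smooth_on_compose[OF _ _ _ s(1)]) auto
  have 2: "s (?q x) = 1" if "x \<in> ball a r" for x
    unfolding q using that assms by (intro s(2)) (simp add: abs_square_le_1)
  have 3: "s (?q x) = 0" if "x \<notin> cball a (2 * r)" for x
  proof -
    have "2 \<le> dist a x / r" using that assms by (simp add: field_simps)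
    then have "2\<^sup>2 \<le> (dist a x / r)\<^sup>2" by (intro power_mono) auto
    then show ?thesis unfolding q by (intro s(3)) simp
  qed
  show ?thesis using that[OF 1 2 3] .
qed

section \<open>Hadamard's lemma\<close>

lemma ball_segment:
  fixes a x :: "'e::euclidean_space"
  assumes "x \<in> ball a r" "0 \<le> t" "t \<le> 1"
  shows "a + t *\<^sub>R (x - a) \<in> ball a r"
proof -
  have "norm (t *\<^sub>R (x - a)) \<le> norm (x - a)"
    using assms by (simp add: mult_left_le_one_le)
  then show ?thesis using assms(1) by (simp add: dist_norm norm_minus_commute)
qed

lemma slice_integrable:
  fixes H :: "'e::euclidean_space \<Rightarrow> real \<Rightarrow> 'b::banach"
  assumes "continuous_on (S \<times> cbox 0 1) (\<lambda>(x, t). H x t)" "x \<in> S"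
  shows "H x integrable_on cbox 0 1"
proof -
  have "continuous_on (cbox 0 1) (\<lambda>t::real. (x, t))" by (intro continuous_intros)
  then have "continuous_on (cbox 0 1) (H x)"
    using continuous_on_compose2[OF assms(1), of "cbox 0 1" "\<lambda>t. (x, t)"] assms(2) by auto
  then show ?thesis by (rule integrable_continuous)
qed

lemma continuous_on_segment:
  fixes F :: "'e::euclidean_space \<Rightarrow> real"
  assumes "continuous_on (ball a r) F"
  shows "continuous_on (ball a r \<times> cbox 0 1) (\<lambda>(x, t). t ^ j * F (a + t *\<^sub>R (x - a)))"
proof -
  have "continuous_on (ball a r \<times> cbox 0 1) (\<lambda>z. snd z ^ j * F (a + snd z *\<^sub>R (fst z - a)))"
    by (intro continuous_intros continuous_on_compose2[OF assms]) (use ball_segment in auto)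
  then show ?thesis by (simp add: case_prod_beta)
qed

text \<open>Differentiating under the integral sign brings down a factor \<open>t\<close>, hence the
  weight \<open>t ^ j\<close>: the derivative in a direction is an integral of the same kind for the
  corresponding partial derivative of \<open>F\<close>, with \<open>Suc j\<close> in place of
  \<open>j\<close>.\<close>

lemma Ck_on_segment_integral:
  fixes F :: "'e::euclidean_space \<Rightarrow> real"
  assumes "smooth_on (ball a r) F"
  shows "Ck_on k (ball a r) (\<lambda>x. integral (cbox 0 1) (\<lambda>t. t ^ j * F (a + t *\<^sub>R (x - a))))"
  using assms
proof (induction k arbitrary: F j)
  case (0 F j)
  show ?case
    using integral_continuous_on_param[OF continuous_on_segment[OF smooth_on_imp_continuous_on[OF 0]]]
    by simp
next
  case (Suc k F j)
  let ?F = "\<lambda>x. frechet_derivative F (at x)"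
  let ?H = "\<lambda>x t v. t ^ Suc j * ?F (a + t *\<^sub>R (x - a)) v"
  have seg: "a + t *\<^sub>R (x - a) \<in> ball a r" if "x \<in> ball a r" "t \<in> cbox 0 1" for x t
    using ball_segment that by auto
  have der: "((\<lambda>x. t ^ j * F (a + t *\<^sub>R (x - a))) has_derivative ?H x t) (at x)"
    if "x \<in> ball a r" "t \<in> cbox 0 1" for x t
  proof -
    have 1: "(F has_derivative ?F (a + t *\<^sub>R (x - a))) (at (a + t *\<^sub>R (x - a)))"
      by (rule smooth_on_has_derivative[OF Suc.prems seg[OF that]])
    have "((\<lambda>x. a + t *\<^sub>R (x - a)) has_derivative (\<lambda>v. t *\<^sub>R v)) (at x)"
      by (auto intro!: derivative_eq_intros)
    from has_derivative_compose[OF this 1]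
    have "((\<lambda>x. t ^ j * F (a + t *\<^sub>R (x - a))) has_derivative
        (\<lambda>v. t ^ j * ?F (a + t *\<^sub>R (x - a)) (t *\<^sub>R v))) (at x)"
      by (intro has_derivative_mult_right)
    moreover have "?F (a + t *\<^sub>R (x - a)) (t *\<^sub>R v) = t * ?F (a + t *\<^sub>R (x - a)) v" for v
      using linear_scale[OF has_derivative_linear[OF 1]] by simp
    ultimately show ?thesis by (simp add: algebra_simps)
  qed
  \<comment> \<open>The Leibniz rule asks for a derivative that is continuous as an operator-valued
    function. In finite dimension this can be checked on each vector separately, hence the detour
    through \<open>Blinfun\<close>.\<close>
  define H where "H x t = Blinfun (?H x t)" for x t
  have H: "blinfun_apply (H x t) = ?H x t" if "x \<in> ball a r" "t \<in> cbox 0 1" for x t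
    unfolding H_def using has_derivative_bounded_linear[OF der[OF that]] by (rule bounded_linear_Blinfun_apply)
  have cont_Hv: "continuous_on (ball a r \<times> cbox 0 1) (\<lambda>(x, t). ?H x t v)" for v
    by (rule continuous_on_segment[OF smooth_on_imp_continuous_on[OF smooth_on_frechet_derivative[OF Suc.prems]]])
  have cont_H: "continuous_on (ball a r \<times> cbox 0 1) (\<lambda>(x, t). H x t)"
  proof (rule continuous_on_blinfun_componentwise)
    fix v :: 'e
    show "continuous_on (ball a r \<times> cbox 0 1) (\<lambda>z. (case z of (x, t) \<Rightarrow> H x t) v)"
      by (rule continuous_on_cong[THEN iffD1, OF refl _ cont_Hv[of v]]) (auto simp: H)
  qed
  have "((\<lambda>x. integral (cbox 0 1) (\<lambda>t. t ^ j * F (a + t *\<^sub>R (x - a)))) has_derivative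
      (\<lambda>v. integral (cbox 0 1) (\<lambda>t. ?H x t v))) (at x)" if x: "x \<in> ball a r" for x
  proof -
    have "((\<lambda>x. integral (cbox 0 1) (\<lambda>t. t ^ j * F (a + t *\<^sub>R (x - a)))) has_derivative
      integral (cbox 0 1) (H x)) (at x within ball a r)"
    proof (rule leibniz_rule[OF _ _ cont_H x convex_ball])
      show "((\<lambda>x. t ^ j * F (a + t *\<^sub>R (x - a))) has_derivative H x t) (at x within ball a r)"
        if "x \<in> ball a r" "t \<in> cbox 0 1" for x t
        using der[OF that] H[OF that] by (simp add: has_derivative_at_withinI)
      show "(\<lambda>t. t ^ j * F (a + t *\<^sub>R (x - a))) integrable_on cbox 0 1" if "x \<in> ball a r" for x
        by (rule slice_integrable[OF continuous_on_segment[OF smooth_on_imp_continuous_on[OF Suc.prems]] that])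
    qed
    moreover
    have "blinfun_apply (integral (cbox 0 1) (H x)) v = integral (cbox 0 1) (\<lambda>t. ?H x t v)" for v
    proof -
      have "H x integrable_on cbox 0 1"
        by (rule slice_integrable[OF cont_H x])
      then have "blinfun_apply (integral (cbox 0 1) (H x)) v = integral (cbox 0 1) (\<lambda>t. H x t v)"
        by (rule blinfun_apply_integral)
      also have "\<dots> = integral (cbox 0 1) (\<lambda>t. ?H x t v)"
        by (rule integral_cong) (use H x in auto)
      finally show ?thesis .
    qed
    then have "blinfun_apply (integral (cbox 0 1) (H x)) = (\<lambda>v. integral (cbox 0 1) (\<lambda>t. ?H x t v))"
      by (rule ext)
    ultimately show ?thesis using x by (simp only: at_within_open open_ball)
  qed
  then show ?case
    by (rule Ck_on_SucI[OF open_ball _ Suc.IH[OF smooth_on_frechet_derivative[OF Suc.prems]]])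
qed

text \<open>\<open>h b\<close> averages the partial derivative in direction \<open>b\<close> over
  the segment from \<open>a\<close> to \<open>x\<close>; the expansion is the fundamental theorem of
  calculus along that segment.\<close>

lemma Hadamard:
  fixes f :: "'e::euclidean_space \<Rightarrow> real"
  assumes f: "smooth_on (ball a r) f" and r: "r > 0"
  obtains h where "\<And>b. smooth_on (ball a r) (h b)"
    "\<And>x. x \<in> ball a r \<Longrightarrow> f x = f a + (\<Sum>b\<in>Basis. ((x - a) \<bullet> b) * h b x)"
    "\<And>b. h b a = frechet_derivative f (at a) b"
proof
  let ?f = "\<lambda>x. frechet_derivative f (at x)"
  let ?h = "\<lambda>b x. integral (cbox 0 1) (\<lambda>t. t ^ 0 * ?f (a + t *\<^sub>R (x - a)) b)"
  show "smooth_on (ball a r) (?h b)" for b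
    unfolding smooth_on_def by (intro allI Ck_on_segment_integral smooth_on_frechet_derivative f)
  show "?h b a = ?f a b" for b by simp
  show "f x = f a + (\<Sum>b\<in>Basis. ((x - a) \<bullet> b) * ?h b x)" if x: "x \<in> ball a r" for x
  proof -
    have der: "(f has_derivative ?f (a + t *\<^sub>R (x - a))) (at (a + t *\<^sub>R (x - a)))" if "t \<in> cbox 0 1" for t
      using that by (intro smooth_on_has_derivative[OF f] ball_segment[OF x]) auto
    have exp: "?f (a + t *\<^sub>R (x - a)) (x - a) = (\<Sum>b\<in>Basis. ((x - a) \<bullet> b) * ?f (a + t *\<^sub>R (x - a)) b)"
      if "t \<in> cbox 0 1" for t
    proof -
      note l = has_derivative_linear[OF der[OF that]]
      have "?f (a + t *\<^sub>R (x - a)) (\<Sum>b\<in>Basis. ((x - a) \<bullet> b) *\<^sub>R b)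
          = (\<Sum>b\<in>Basis. ((x - a) \<bullet> b) * ?f (a + t *\<^sub>R (x - a)) b)"
        unfolding linear_sum[OF l] linear_scale[OF l] by simp
      then show ?thesis by (simp only: euclidean_representation)
    qed
    have int: "(\<lambda>t. ?f (a + t *\<^sub>R (x - a)) b) integrable_on cbox 0 1" for b
      using slice_integrable[OF continuous_on_segment[OF smooth_on_imp_continuous_on[OF
            smooth_on_frechet_derivative[OF f]], of 0 b] x] by simp
    have "((\<lambda>t. ?f (a + t *\<^sub>R (x - a)) (x - a)) has_integral f (a + 1 *\<^sub>R (x - a)) - f (a + 0 *\<^sub>R (x - a))) {0..1}"
    proof (rule fundamental_theorem_of_calculus)
      fix t :: real assume t: "t \<in> {0..1}"
      have "((\<lambda>t. a + t *\<^sub>R (x - a)) has_derivative (\<lambda>s. s *\<^sub>R (x - a))) (at t)"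
        by (auto intro!: derivative_eq_intros)
      from has_derivative_compose[OF this der] t
      have "((\<lambda>t. f (a + t *\<^sub>R (x - a))) has_derivative (\<lambda>s. ?f (a + t *\<^sub>R (x - a)) (s *\<^sub>R (x - a)))) (at t)"
        by simp
      then show "((\<lambda>t. f (a + t *\<^sub>R (x - a))) has_vector_derivative ?f (a + t *\<^sub>R (x - a)) (x - a)) (at t within {0..1})"
        using linear_scale[OF has_derivative_linear[OF der]] t
        by (auto simp: has_vector_derivative_def intro!: has_derivative_at_withinI)
    qed simp
    then have "f x - f a = integral (cbox 0 1) (\<lambda>t. ?f (a + t *\<^sub>R (x - a)) (x - a))"
      by (simp add: integral_unique)
    also have "\<dots> = integral (cbox 0 1) (\<lambda>t. \<Sum>b\<in>Basis. ((x - a) \<bullet> b) * ?f (a + t *\<^sub>R (x - a)) b)"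
      by (rule integral_cong) (rule exp)
    also have "\<dots> = (\<Sum>b\<in>Basis. ((x - a) \<bullet> b) * ?h b x)"
      using int by (subst integral_sum) (auto intro!: integrable_on_mult_right)
    finally show ?thesis by simp
  qed
qed

section \<open>Smooth functions, tangent vectors and vector fields\<close>

lemma sum_fun_apply: "(\<Sum>i\<in>I. F i) x = (\<Sum>i\<in>I. F i x)"
  by (induction I rule: infinite_finite_induct) auto

section \<open>Charts and globally defined smooth functions\<close>

locale smooth_mfd =
  fixes A :: "('a::{t2_space, second_countable_topology}, 'e::euclidean_space) atlas"
  assumes atlas: "smooth_atlas A"
begin

lemma chart_at: obtains U \<phi> where "(U, \<phi>) \<in> A" "p \<in> U"
proof -
  have "p \<in> (\<Union>(U, \<phi>)\<in>A. U)" using atlas unfolding smooth_atlas_def by simp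
  then show ?thesis using that by auto
qed

lemma chart:
  assumes "(U, \<phi>) \<in> A"
  shows "open U" "open (\<phi> ` U)" "homeomorphism U (\<phi> ` U) \<phi> (inv_into U \<phi>)"
    and chart_inv: "\<And>p. p \<in> U \<Longrightarrow> inv_into U \<phi> (\<phi> p) = p"
  using assms atlas unfolding smooth_atlas_def by (auto dest: homeomorphism_apply1)

lemma chart_transition:
  "(U, \<phi>) \<in> A \<Longrightarrow> (V, \<psi>) \<in> A \<Longrightarrow> smooth_on (\<phi> ` (U \<inter> V)) (\<psi> \<circ> inv_into U \<phi>)"
  using atlas unfolding smooth_atlas_def by fast

lemma chart_open_image:
  assumes "(U, \<phi>) \<in> A" "open W"
  shows "open (\<phi> ` (U \<inter> W))"
  using homeomorphism_imp_open_map[OF chart(3)[OF assms(1)] openin_open_Int[OF assms(2)]] chart(2)[OF assms(1)]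
  by (simp add: openin_open_eq)

lemma chart_open_preimage:
  assumes "(U, \<phi>) \<in> A" "open T"
  shows "open (U \<inter> \<phi> -` T)"
  using chart(1,3)[OF assms(1)] assms(2) by (auto simp: homeomorphism_def intro: continuous_open_preimage)

lemma C_infty_chart: "f \<in> C_infty A \<Longrightarrow> (U, \<phi>) \<in> A \<Longrightarrow> smooth_on (\<phi> ` U) (\<lambda>x. f (inv_into U \<phi> x))"
  by (auto simp: C_infty_def o_def)

lemma C_inftyI: "(\<And>U \<phi>. (U, \<phi>) \<in> A \<Longrightarrow> smooth_on (\<phi> ` U) (\<lambda>x. f (inv_into U \<phi> x))) \<Longrightarrow> f \<in> C_infty A"
  by (auto simp: C_infty_def o_def)

lemma C_infty_const: "(\<lambda>_. c) \<in> C_infty A"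
  by (intro C_inftyI smooth_on_const chart)

lemma C_infty_0: "0 \<in> C_infty A" and C_infty_1: "1 \<in> C_infty A"
  using C_infty_const[of 0] C_infty_const[of 1] by (simp_all only: zero_fun_def one_fun_def)

lemma C_infty_add: "f \<in> C_infty A \<Longrightarrow> h \<in> C_infty A \<Longrightarrow> f + h \<in> C_infty A"
  by (rule C_inftyI) (simp add: smooth_on_add chart C_infty_chart)

lemma C_infty_mult: "f \<in> C_infty A \<Longrightarrow> h \<in> C_infty A \<Longrightarrow> f * h \<in> C_infty A"
  by (rule C_inftyI) (simp add: smooth_on_mult chart C_infty_chart)

lemma C_infty_scaleR: "f \<in> C_infty A \<Longrightarrow> c *\<^sub>R f \<in> C_infty A"
  using C_infty_mult[OF C_infty_const[of c], of f] by (simp add: scaleR_fun_def func_times)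

lemma C_infty_uminus: "f \<in> C_infty A \<Longrightarrow> - f \<in> C_infty A"
  using C_infty_scaleR[of f "-1"] by simp

lemma C_infty_diff: "f \<in> C_infty A \<Longrightarrow> h \<in> C_infty A \<Longrightarrow> f - h \<in> C_infty A"
  using C_infty_add[of f "- h"] C_infty_uminus[of h] by simp

lemma C_infty_sum: "(\<And>i. i \<in> I \<Longrightarrow> f i \<in> C_infty A) \<Longrightarrow> (\<Sum>i\<in>I. f i) \<in> C_infty A"
  by (induction I rule: infinite_finite_induct) (auto intro: C_infty_0 C_infty_add)

lemma C_infty_continuous:
  assumes "f \<in> C_infty A"
  shows "continuous_on UNIV f"
proof -
  have "isCont f p" for p
  proof -
    obtain U \<phi> where c: "(U, \<phi>) \<in> A" "p \<in> U" by (rule chart_at)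
    have "continuous_on U (\<lambda>q. f (inv_into U \<phi> (\<phi> q)))"
      by (rule continuous_on_compose2[OF smooth_on_imp_continuous_on[OF C_infty_chart[OF assms c(1)]]])
        (use homeomorphism_cont1[OF chart(3)[OF c(1)]] in auto)
    then have "continuous_on U f"
      by (rule continuous_on_cong[THEN iffD1, OF refl, rotated]) (simp add: chart_inv[OF c(1)])
    then show ?thesis using c chart(1) by (simp add: continuous_on_eq_continuous_at)
  qed
  then show ?thesis by (simp add: continuous_on_eq_continuous_at)
qed

lemma C_infty_local:
  assumes "\<And>p. \<exists>W f'. open W \<and> p \<in> W \<and> f' \<in> C_infty A \<and> (\<forall>q\<in>W. f q = f' q)"
  shows "f \<in> C_infty A"
proof (intro C_inftyI smooth_on_local)
  fix U \<phi> x assume c: "(U, \<phi>) \<in> A" and x: "x \<in> \<phi> ` U"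
  obtain W f' where W: "open W" "inv_into U \<phi> x \<in> W" "f' \<in> C_infty A" "\<And>q. q \<in> W \<Longrightarrow> f q = f' q"
    using assms by meson
  have "smooth_on (\<phi> ` (U \<inter> W)) (\<lambda>x. f (inv_into U \<phi> x))"
  proof (rule smooth_on_cong)
    show "smooth_on (\<phi> ` (U \<inter> W)) (\<lambda>x. f' (inv_into U \<phi> x))"
      using C_infty_chart[OF W(3) c] by (rule smooth_on_subset) auto
  qed (use W chart_inv[OF c] chart_open_image[OF c W(1)] in auto)
  moreover have "x \<in> \<phi> ` (U \<inter> W)" using x W(2) chart_inv[OF c] by auto
  ultimately show "\<exists>T. open T \<and> x \<in> T \<and> smooth_on T (\<lambda>x. f (inv_into U \<phi> x))"
    using chart_open_image[OF c W(1)] by blast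
qed

text \<open>The Hausdorff property makes this work: the part of \<open>U\<close> that corresponds to
  \<open>K\<close> is compact, hence closed, so a point outside \<open>U\<close> has a neighbourhood
  missing it, and there the extension is 0.\<close>

lemma chart_extend:
  assumes c: "(U, \<phi>) \<in> A" and K: "compact K" "K \<subseteq> \<phi> ` U" and w: "smooth_on (\<phi> ` U) w"
    and w0: "\<And>x. x \<notin> K \<Longrightarrow> w x = 0"
  shows "(\<lambda>q. if q \<in> U then w (\<phi> q) else 0) \<in> C_infty A" (is "?f \<in> _")
proof (intro C_inftyI smooth_on_local)
  fix V \<psi> x assume d: "(V, \<psi>) \<in> A" and x: "x \<in> \<psi> ` V"
  have xV: "inv_into V \<psi> x \<in> V" "\<psi> (inv_into V \<psi> x) = x" using x by (auto simp: inv_into_into f_inv_into_f)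
  show "\<exists>T. open T \<and> x \<in> T \<and> smooth_on T (\<lambda>x. ?f (inv_into V \<psi> x))"
  proof (cases "inv_into V \<psi> x \<in> U")
    case True
    have "smooth_on (\<psi> ` (V \<inter> U)) (\<lambda>x. w ((\<phi> \<circ> inv_into V \<psi>) x))"
      by (rule smooth_on_compose[OF _ chart(2)[OF c] _ w chart_transition[OF d c]])
        (use chart_inv[OF d] chart_open_image[OF d chart(1)[OF c]] in auto)
    then have "smooth_on (\<psi> ` (V \<inter> U)) (\<lambda>x. ?f (inv_into V \<psi> x))"
      by (rule smooth_on_cong[rotated 2])
        (use chart_inv[OF d] chart_open_image[OF d chart(1)[OF c]] in auto)
    moreover have "x \<in> \<psi> ` (V \<inter> U)" using True xV by (intro image_eqI[of _ _ "inv_into V \<psi> x"]) auto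
    ultimately show ?thesis using chart_open_image[OF d chart(1)[OF c]] by blast
  next
    case False
    let ?K = "inv_into U \<phi> ` K"
    have "compact ?K"
      using homeomorphism_cont2[OF chart(3)[OF c]] K
      by (intro compact_continuous_image) (auto intro: continuous_on_subset)
    then have o: "open (\<psi> ` (V \<inter> - ?K))"
      by (intro chart_open_image[OF d]) (simp add: compact_imp_closed open_Compl)
    have "smooth_on (\<psi> ` (V \<inter> - ?K)) (\<lambda>x. ?f (inv_into V \<psi> x))"
    proof (rule smooth_on_cong[OF o _ smooth_on_const[OF o]])
      fix y assume "y \<in> \<psi> ` (V \<inter> - ?K)"
      then obtain q where q: "q \<in> V" "q \<notin> ?K" "y = \<psi> q" by auto
      then have "\<phi> q \<notin> K" if "q \<in> U" using chart_inv[OF c that] by force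
      then show "0 = ?f (inv_into V \<psi> y)" using q chart_inv[OF d] w0 by auto
    qed
    moreover have "inv_into V \<psi> x \<notin> ?K"
    proof
      assume "inv_into V \<psi> x \<in> ?K"
      then have "inv_into V \<psi> x \<in> U" using K(2) by (auto simp: inv_into_into subset_iff)
      then show False using False by simp
    qed
    moreover have "x \<in> \<psi> ` (V \<inter> - ?K)" if "inv_into V \<psi> x \<notin> ?K"
      using that xV by (intro image_eqI[of _ _ "inv_into V \<psi> x"]) auto
    ultimately show ?thesis using o by blast
  qed
qed

lemma chart_cutoff:
  assumes c: "(U, \<phi>) \<in> A" "p \<in> U" and T: "open T" "\<phi> p \<in> T"
  obtains \<beta> K W where "smooth_on UNIV \<beta>" "compact K" "K \<subseteq> T" "\<And>x. x \<notin> K \<Longrightarrow> \<beta> x = (0::real)"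
    "open W" "p \<in> W" "W \<subseteq> U" "\<And>q. q \<in> W \<Longrightarrow> \<phi> q \<in> T" "\<And>q. q \<in> W \<Longrightarrow> \<beta> (\<phi> q) = 1"
proof -
  obtain r where r: "r > 0" "cball (\<phi> p) r \<subseteq> T" using T open_contains_cball by blast
  then have r2: "r / 2 > 0" by simp
  obtain \<beta> where \<beta>: "smooth_on UNIV \<beta>" "\<And>x. x \<in> ball (\<phi> p) (r / 2) \<Longrightarrow> \<beta> x = (1::real)"
    "\<And>x. x \<notin> cball (\<phi> p) (2 * (r / 2)) \<Longrightarrow> \<beta> x = 0"
    using smooth_bump[OF r2, of "\<phi> p"] by blast
  show ?thesis
  proof (rule that[of \<beta> "cball (\<phi> p) r" "U \<inter> \<phi> -` ball (\<phi> p) (r / 2)"])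
    show "\<phi> q \<in> T" if "q \<in> U \<inter> \<phi> -` ball (\<phi> p) (r / 2)" for q
      using that r by (auto simp: subset_iff)
  qed (use \<beta> r c chart_open_preimage[OF c(1) open_ball] in auto)
qed

text \<open>Multiply by a cutoff that is 1 near \<open>p\<close> and supported in \<open>T\<close>.
  The set \<open>W\<close> is fixed before \<open>u\<close> is given, so a whole family of functions
  can be extended with one common neighbourhood.\<close>

lemma local_extension:
  assumes c: "(U, \<phi>) \<in> A" "p \<in> U" and T: "open T" "\<phi> p \<in> T" "T \<subseteq> \<phi> ` U"
  obtains W where "open W" "p \<in> W" "W \<subseteq> U" "\<And>q. q \<in> W \<Longrightarrow> \<phi> q \<in> T"
    "\<And>u. smooth_on T u \<Longrightarrow> \<exists>f\<in>C_infty A. \<forall>q\<in>W. f q = u (\<phi> q)"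
proof -
  obtain \<beta> K W where \<beta>: "smooth_on UNIV \<beta>" "compact K" "K \<subseteq> T" "\<And>x. x \<notin> K \<Longrightarrow> \<beta> x = (0::real)"
    and W: "open W" "p \<in> W" "W \<subseteq> U" "\<And>q. q \<in> W \<Longrightarrow> \<phi> q \<in> T" "\<And>q. q \<in> W \<Longrightarrow> \<beta> (\<phi> q) = 1"
    by (rule chart_cutoff[OF c T(1,2)]) (rule that)
  show ?thesis
  proof (rule that[OF W(1-4)])
    fix u :: "'e \<Rightarrow> real" assume u: "smooth_on T u"
    let ?w = "\<lambda>x. if x \<in> T then \<beta> x * u x else 0"
    have "smooth_on (\<phi> ` U) ?w"
    proof (rule smooth_on_local)
      fix x assume "x \<in> \<phi> ` U"
      show "\<exists>S. open S \<and> x \<in> S \<and> smooth_on S ?w"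
      proof (cases "x \<in> T")
        case True
        have "smooth_on T (\<lambda>x. \<beta> x * u x)"
          by (intro smooth_on_mult u T smooth_on_subset[OF \<beta>(1)]) auto
        then have "smooth_on T ?w" by (rule smooth_on_cong[OF T(1), rotated]) auto
        then show ?thesis using True T by blast
      next
        case False
        have o: "open (- K)" using \<beta>(2) by (simp add: compact_imp_closed open_Compl)
        have "smooth_on (- K) ?w"
          by (rule smooth_on_cong[OF o _ smooth_on_const[OF o, of 0]]) (use \<beta>(4) in auto)
        then show ?thesis using False \<beta>(3) o by blast
      qed
    qed
    from chart_extend[OF c(1) \<beta>(2) _ this] have "(\<lambda>q. if q \<in> U then ?w (\<phi> q) else 0) \<in> C_infty A"
      using \<beta> T by auto
    then show "\<exists>f\<in>C_infty A. \<forall>q\<in>W. f q = u (\<phi> q)"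
      by (rule bexI[rotated]) (use W in auto)
  qed
qed

lemma bump_function:
  assumes "open W" "p \<in> W"
  obtains \<rho> where "\<rho> \<in> C_infty A" "\<rho> p = 1" "\<And>q. q \<notin> W \<Longrightarrow> \<rho> q = 0"
proof -
  obtain U \<phi> where c: "(U, \<phi>) \<in> A" "p \<in> U" by (rule chart_at)
  have T: "open (\<phi> ` (U \<inter> W))" "\<phi> p \<in> \<phi> ` (U \<inter> W)"
    using chart_open_image[OF c(1) assms(1)] assms(2) c(2) by auto
  obtain \<beta> K W' where \<beta>: "smooth_on UNIV \<beta>" "compact K" "K \<subseteq> \<phi> ` (U \<inter> W)" "\<And>x. x \<notin> K \<Longrightarrow> \<beta> x = (0::real)"
    and W': "open W'" "p \<in> W'" "W' \<subseteq> U" "\<And>q. q \<in> W' \<Longrightarrow> \<phi> q \<in> \<phi> ` (U \<inter> W)" "\<And>q. q \<in> W' \<Longrightarrow> \<beta> (\<phi> q) = 1"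
    by (rule chart_cutoff[OF c T]) (rule that)
  show ?thesis
  proof (rule that)
    show "(\<lambda>q. if q \<in> U then \<beta> (\<phi> q) else 0) \<in> C_infty A"
      by (rule chart_extend[OF c(1) \<beta>(2) _ smooth_on_subset[OF \<beta>(1)]]) (use \<beta> in auto)
    show "(if p \<in> U then \<beta> (\<phi> p) else 0) = 1" using W' by auto
    fix q assume "q \<notin> W"
    then have "\<phi> q \<notin> \<phi> ` (U \<inter> W)" if "q \<in> U"
      using that chart_inv[OF c(1)] by (metis IntE imageE)
    then show "(if q \<in> U then \<beta> (\<phi> q) else 0) = 0" using \<beta> by auto
  qed
qed

text \<open>Real powers are smooth only on the positive axis, so the power is formed on the open set
  where \<open>f\<close> is positive and then extended from a neighbourhood of
  \<open>p\<close>.\<close>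

lemma C_infty_powr:
  assumes f: "f \<in> C_infty A" "f p > 0"
  obtains h W where "h \<in> C_infty A" "open W" "p \<in> W" "\<And>q. q \<in> W \<Longrightarrow> f q > 0 \<and> h q = f q powr a"
proof -
  obtain U \<phi> where c: "(U, \<phi>) \<in> A" "p \<in> U" by (rule chart_at)
  let ?P = "{q. f q > 0}" and ?T = "\<phi> ` (U \<inter> {q. f q > 0})"
  have "open ?P"
    using open_vimage[OF open_greaterThan C_infty_continuous[OF f(1)], of 0] by (simp add: vimage_def)
  then have T: "open ?T" "\<phi> p \<in> ?T" "?T \<subseteq> \<phi> ` U"
    using chart_open_image[OF c(1)] f(2) c(2) by auto
  obtain W where W: "open W" "p \<in> W" "W \<subseteq> U" "\<And>q. q \<in> W \<Longrightarrow> \<phi> q \<in> ?T"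
    "\<And>u. smooth_on ?T u \<Longrightarrow> \<exists>f\<in>C_infty A. \<forall>q\<in>W. f q = u (\<phi> q)"
    by (rule local_extension[OF c T]) (rule that)
  have "smooth_on ?T (\<lambda>x. f (inv_into U \<phi> x) powr a)"
    by (rule smooth_on_compose[OF T(1) open_greaterThan _ smooth_on_powr smooth_on_subset[OF C_infty_chart[OF f(1) c(1)] T(3)]])
      (auto simp: chart_inv[OF c(1)])
  from W(5)[OF this] obtain h where h: "h \<in> C_infty A" "\<And>q. q \<in> W \<Longrightarrow> h q = f (inv_into U \<phi> (\<phi> q)) powr a"
    by auto
  show ?thesis
  proof (rule that[OF h(1) W(1,2)])
    fix q assume q: "q \<in> W"
    obtain q' where "q' \<in> U" "f q' > 0" "\<phi> q = \<phi> q'" using W(4)[OF q] by auto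
    moreover from this have "q = q'" using chart_inv[OF c(1)] q W(3) by (metis subsetD)
    ultimately have "f q > 0" by simp
    then show "f q > 0 \<and> h q = f q powr a" using h(2)[OF q] q W(3) chart_inv[OF c(1)] by auto
  qed
qed

section \<open>Tangent vectors as derivations\<close>

lemma tangent_comb:
  assumes "v \<in> tangent_space A p" "f \<in> C_infty A" "h \<in> C_infty A"
  shows "v (a *\<^sub>R f + b *\<^sub>R h) = a * v f + b * v h"
proof -
  have "linear_over (C_infty A) v" using assms(1) by (simp add: tangent_space_def)
  from this[unfolded linear_over_def, rule_format, OF assms(2,3), of a b] show ?thesis by simp
qed

lemma tangent_add: "v \<in> tangent_space A p \<Longrightarrow> f \<in> C_infty A \<Longrightarrow> h \<in> C_infty A \<Longrightarrow> v (f + h) = v f + v h"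
  using tangent_comb[of v p f h 1 1] by simp

lemma tangent_scaleR: "v \<in> tangent_space A p \<Longrightarrow> f \<in> C_infty A \<Longrightarrow> v (c *\<^sub>R f) = c * v f"
  using tangent_comb[of v p f f c 0] by simp

lemma tangent_diff: "v \<in> tangent_space A p \<Longrightarrow> f \<in> C_infty A \<Longrightarrow> h \<in> C_infty A \<Longrightarrow> v (f - h) = v f - v h"
  using tangent_add[of v p f "(-1) *\<^sub>R h"] tangent_scaleR[of v p h "-1"] C_infty_scaleR[of h "-1"] by simp

lemma tangent_mult:
  "v \<in> tangent_space A p \<Longrightarrow> f \<in> C_infty A \<Longrightarrow> h \<in> C_infty A \<Longrightarrow> v (f * h) = v f * h p + f p * v h"
  by (simp add: tangent_space_def)

lemma tangent_not_smooth: "v \<in> tangent_space A p \<Longrightarrow> f \<notin> C_infty A \<Longrightarrow> v f = 0"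
  by (simp add: tangent_space_def)

lemma tangent_0: "v \<in> tangent_space A p \<Longrightarrow> v 0 = 0"
  using tangent_scaleR[of v p 0 0] C_infty_0 by simp

lemma tangent_const: "v \<in> tangent_space A p \<Longrightarrow> v (\<lambda>_. c) = 0"
proof -
  assume v: "v \<in> tangent_space A p"
  have "v 1 = 0" using tangent_mult[OF v C_infty_1 C_infty_1] by simp
  moreover have "(\<lambda>_. c) = c *\<^sub>R (1 :: 'a \<Rightarrow> real)" by (simp add: scaleR_fun_def)
  ultimately show ?thesis using tangent_scaleR[OF v C_infty_1, of c] by simp
qed

lemma tangent_sum:
  "v \<in> tangent_space A p \<Longrightarrow> (\<And>i. i \<in> I \<Longrightarrow> f i \<in> C_infty A) \<Longrightarrow> v (\<Sum>i\<in>I. f i) = (\<Sum>i\<in>I. v (f i))"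
  by (induction I rule: infinite_finite_induct) (auto simp: tangent_0 tangent_add C_infty_sum)

text \<open>A bump function \<rho> with value 1 at \<open>p\<close> that vanishes off
  \<open>W\<close> makes the product of \<rho> and \<open>f - h\<close> zero; by the Leibniz rule at
  \<open>p\<close>, where \<open>f - h\<close> vanishes, this leaves
  \<open>v (f - h) = 0\<close>.\<close>

lemma tangent_local:
  assumes v: "v \<in> tangent_space A p" and f: "f \<in> C_infty A" and h: "h \<in> C_infty A"
    and W: "open W" "p \<in> W" "\<And>q. q \<in> W \<Longrightarrow> f q = h q"
  shows "v f = v h"
proof -
  obtain \<rho> where \<rho>: "\<rho> \<in> C_infty A" "\<rho> p = 1" "\<And>q. q \<notin> W \<Longrightarrow> \<rho> q = 0"
    by (rule bump_function[OF W(1,2)]) (rule that)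
  have "(f - h) * \<rho> = 0" using W(3) \<rho>(3) by (auto simp: fun_eq_iff)
  then have "v (f - h) * \<rho> p + (f - h) p * v \<rho> = 0"
    using tangent_mult[OF v C_infty_diff[OF f h] \<rho>(1)] tangent_0[OF v] by simp
  then show ?thesis using W \<rho> tangent_diff[OF v f h] by simp
qed

lemma tangentI:
  assumes "\<And>f h a b. f \<in> C_infty A \<Longrightarrow> h \<in> C_infty A \<Longrightarrow> v (a *\<^sub>R f + b *\<^sub>R h) = a * v f + b * v h"
    and "\<And>f h. f \<in> C_infty A \<Longrightarrow> h \<in> C_infty A \<Longrightarrow> v (f * h) = v f * h p + f p * v h"
    and "\<And>f. f \<notin> C_infty A \<Longrightarrow> v f = 0"
  shows "v \<in> tangent_space A p"
  using assms by (simp add: tangent_space_def linear_over_def)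

lemma subspace_tangent_space: "subspace (tangent_space A p)"
proof (rule subspaceI)
  show "0 \<in> tangent_space A p" by (rule tangentI) auto
  show "u + v \<in> tangent_space A p" if "u \<in> tangent_space A p" "v \<in> tangent_space A p" for u v
    by (rule tangentI)
      (use that in \<open>auto simp: tangent_comb tangent_mult tangent_not_smooth algebra_simps\<close>)
  have ev: "(c *\<^sub>R v) f = c * v f" for c f and v :: "'a tvec" by (simp add: scaleR_fun_def)
  show "c *\<^sub>R v \<in> tangent_space A p" if "v \<in> tangent_space A p" for c v
    by (rule tangentI; unfold ev)
      (use that in \<open>auto simp: tangent_comb tangent_mult tangent_not_smooth algebra_simps\<close>)
qed

text \<open>The directional derivative at \<open>p\<close> along \<open>b\<close>, taken in the
  chart. The value 0 off the smooth functions matches the convention of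
  \<open>tangent_space\<close>.\<close>

definition coord_vec :: "'a set \<Rightarrow> ('a \<Rightarrow> 'e) \<Rightarrow> 'a \<Rightarrow> 'e \<Rightarrow> 'a tvec" where
  "coord_vec U \<phi> p b f =
     (if f \<in> C_infty A then frechet_derivative (\<lambda>x. f (inv_into U \<phi> x)) (at (\<phi> p)) b else 0)"

lemma C_infty_chart_derivative:
  "f \<in> C_infty A \<Longrightarrow> (U, \<phi>) \<in> A \<Longrightarrow> p \<in> U \<Longrightarrow> ((\<lambda>x. f (inv_into U \<phi> x)) has_derivative
    frechet_derivative (\<lambda>x. f (inv_into U \<phi> x)) (at (\<phi> p))) (at (\<phi> p))"
  by (rule smooth_on_has_derivative[OF C_infty_chart]) auto

lemma coord_vec_tangent:
  assumes c: "(U, \<phi>) \<in> A" "p \<in> U"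
  shows "coord_vec U \<phi> p b \<in> tangent_space A p"
proof (rule tangentI)
  let ?D = "\<lambda>f. frechet_derivative (\<lambda>x. f (inv_into U \<phi> x)) (at (\<phi> p))"
  fix f h assume f: "f \<in> C_infty A" and h: "h \<in> C_infty A"
  note d = C_infty_chart_derivative[OF f c] C_infty_chart_derivative[OF h c]
  show "coord_vec U \<phi> p b (x *\<^sub>R f + y *\<^sub>R h) = x * coord_vec U \<phi> p b f + y * coord_vec U \<phi> p b h" for x y
  proof -
    have "((\<lambda>z. (x *\<^sub>R f + y *\<^sub>R h) (inv_into U \<phi> z)) has_derivative (\<lambda>v. x * ?D f v + y * ?D h v)) (at (\<phi> p))"
      using has_derivative_add[OF has_derivative_mult_right[OF d(1), of x] has_derivative_mult_right[OF d(2), of y]]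
      by (simp add: scaleR_fun_def)
    from fun_cong[OF frechet_derivative_at[OF this], of b] f h show ?thesis
      by (simp add: coord_vec_def C_infty_add C_infty_scaleR)
  qed
  show "coord_vec U \<phi> p b (f * h) = coord_vec U \<phi> p b f * h p + f p * coord_vec U \<phi> p b h"
  proof -
    have "((\<lambda>z. (f * h) (inv_into U \<phi> z)) has_derivative (\<lambda>v. f p * ?D h v + ?D f v * h p)) (at (\<phi> p))"
      using has_derivative_mult[OF d] chart_inv[OF c] by simp
    from fun_cong[OF frechet_derivative_at[OF this], of b] f h show ?thesis
      by (simp add: coord_vec_def C_infty_mult)
  qed
qed (simp add: coord_vec_def)

lemma coord_functions:
  assumes c: "(U, \<phi>) \<in> A" "p \<in> U"
  obtains W x where "open W" "p \<in> W" "W \<subseteq> U" "\<And>b. x b \<in> C_infty A" "\<And>b q. q \<in> W \<Longrightarrow> x b q = \<phi> q \<bullet> b"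
proof -
  obtain W where W: "open W" "p \<in> W" "W \<subseteq> U"
    "\<And>u. smooth_on (\<phi> ` U) u \<Longrightarrow> \<exists>f\<in>C_infty A. \<forall>q\<in>W. f q = u (\<phi> q)"
    using local_extension[OF c chart(2)[OF c(1)]] c by (metis image_eqI order_refl)
  have "\<exists>f\<in>C_infty A. \<forall>q\<in>W. f q = \<phi> q \<bullet> b" for b
    by (rule W(4)[OF smooth_on_linear[OF _ bounded_linear_inner_left smooth_on_ident]]) (use chart(2)[OF c(1)] in auto)
  then show ?thesis using that[OF W(1-3)] by metis
qed

lemma coord_vec_coord:
  assumes c: "(U, \<phi>) \<in> A" and W: "open W" "W \<subseteq> U" "q \<in> W"
    and x: "x \<in> C_infty A" "\<And>q. q \<in> W \<Longrightarrow> x q = \<phi> q \<bullet> b"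
  shows "coord_vec U \<phi> q v x = v \<bullet> b"
proof -
  have "((\<lambda>y. y \<bullet> b) has_derivative (\<lambda>v. v \<bullet> b)) (at (\<phi> q))"
    by (auto intro!: derivative_eq_intros)
  moreover have "open (\<phi> ` (U \<inter> W))" by (rule chart_open_image[OF c W(1)])
  moreover have "\<phi> q \<in> \<phi> ` (U \<inter> W)" using W by auto
  moreover have "y \<bullet> b = x (inv_into U \<phi> y)" if "y \<in> \<phi> ` (U \<inter> W)" for y
    using that x(2) chart_inv[OF c] by auto
  ultimately have "((\<lambda>y. x (inv_into U \<phi> y)) has_derivative (\<lambda>v. v \<bullet> b)) (at (\<phi> q))"
    by (rule has_derivative_transform_within_open)
  from frechet_derivative_at[OF this] show ?thesis
    using x(1) by (simp add: coord_vec_def fun_eq_iff)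
qed

text \<open>Near \<open>p\<close>, Hadamard's lemma writes \<open>f\<close> as a constant plus the
  sum of the products of \<open>x b - x b p\<close> with smooth \<open>k b\<close>. A derivation
  sees only \<open>v (x b) * k b p\<close>, and \<open>k b p\<close> is the partial derivative of
  \<open>f\<close>.\<close>

lemma tangent_representation:
  assumes c: "(U, \<phi>) \<in> A" and W: "open W" "W \<subseteq> U" "p \<in> W"
    and x: "\<And>b. x b \<in> C_infty A" "\<And>b q. q \<in> W \<Longrightarrow> x b q = \<phi> q \<bullet> b"
    and v: "v \<in> tangent_space A p"
  shows "v = (\<Sum>b\<in>Basis. v (x b) *\<^sub>R coord_vec U \<phi> p b)"
proof
  fix f
  have pU: "p \<in> U" using W by auto
  show "v f = (\<Sum>b\<in>Basis. v (x b) *\<^sub>R coord_vec U \<phi> p b) f"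
  proof (cases "f \<in> C_infty A")
    case False
    then show ?thesis using v by (simp add: tangent_not_smooth sum_fun_apply scaleR_fun_def coord_vec_def)
  next
    case f: True
    let ?f = "\<lambda>x. f (inv_into U \<phi> x)"
    obtain r where r: "r > 0" "ball (\<phi> p) r \<subseteq> \<phi> ` (U \<inter> W)"
      using openE[OF chart_open_image[OF c W(1)], of "\<phi> p"] W pU by auto
    have T: "open (ball (\<phi> p) r)" "\<phi> p \<in> ball (\<phi> p) r" "ball (\<phi> p) r \<subseteq> \<phi> ` U" using r by auto
    have smf: "smooth_on (ball (\<phi> p) r) ?f" by (rule smooth_on_subset[OF C_infty_chart[OF f c] T(3)])
    obtain h where h: "\<And>b. smooth_on (ball (\<phi> p) r) (h b)"
      "\<And>x. x \<in> ball (\<phi> p) r \<Longrightarrow> ?f x = ?f (\<phi> p) + (\<Sum>b\<in>Basis. ((x - \<phi> p) \<bullet> b) * h b x)"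
      "\<And>b. h b (\<phi> p) = frechet_derivative ?f (at (\<phi> p)) b"
      by (rule Hadamard[OF smf r(1)]) (rule that)
    obtain W' where W': "open W'" "p \<in> W'" "W' \<subseteq> U" "\<And>q. q \<in> W' \<Longrightarrow> \<phi> q \<in> ball (\<phi> p) r"
      "\<And>u. smooth_on (ball (\<phi> p) r) u \<Longrightarrow> \<exists>f\<in>C_infty A. \<forall>q\<in>W'. f q = u (\<phi> q)"
      by (rule local_extension[OF c pU T]) (rule that)
    from W'(5)[OF h(1)] obtain k where k: "\<And>b. k b \<in> C_infty A" "\<And>b q. q \<in> W' \<Longrightarrow> k b q = h b (\<phi> q)"
      by metis
    let ?F = "(\<lambda>_. f p) + (\<Sum>b\<in>Basis. (x b - (\<lambda>_. \<phi> p \<bullet> b)) * k b)"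
    have s: "(x b - (\<lambda>_. \<phi> p \<bullet> b)) * k b \<in> C_infty A" "x b - (\<lambda>_. \<phi> p \<bullet> b) \<in> C_infty A" for b
      by (intro C_infty_mult C_infty_diff x k C_infty_const)+
    have "v f = v ?F"
    proof (rule tangent_local[OF v f])
      show "?F \<in> C_infty A" by (intro C_infty_add C_infty_const C_infty_sum s)
      show "open (W' \<inter> W)" "p \<in> W' \<inter> W" using W' W by auto
      fix q assume "q \<in> W' \<inter> W"
      then show "f q = ?F q"
        using h(2)[OF W'(4)[of q]] chart_inv[OF c, of q] chart_inv[OF c pU] W'(3)
        by (auto simp: sum_fun_apply x(2) k(2) inner_diff_left)
    qed
    also have "\<dots> = (\<Sum>b\<in>Basis. v ((x b - (\<lambda>_. \<phi> p \<bullet> b)) * k b))"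
      using v s by (simp add: tangent_add tangent_sum tangent_const C_infty_const C_infty_sum)
    also have "\<dots> = (\<Sum>b\<in>Basis. v (x b) * coord_vec U \<phi> p b f)"
    proof (rule sum.cong[OF refl])
      fix b :: 'e
      have "v ((x b - (\<lambda>_. \<phi> p \<bullet> b)) * k b) = v (x b) * k b p"
        using tangent_mult[OF v s(2) k(1)] tangent_diff[OF v x(1) C_infty_const] tangent_const[OF v]
          x(2)[OF W(3)] by simp
      then show "v ((x b - (\<lambda>_. \<phi> p \<bullet> b)) * k b) = v (x b) * coord_vec U \<phi> p b f"
        using k(2)[OF W'(2)] h(3) f by (simp add: coord_vec_def)
    qed
    finally show ?thesis by (simp add: sum_fun_apply scaleR_fun_def)
  qed
qed

text \<open>The coordinate vectors span by \<open>tangent_representation\<close> and are independent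
  because the coordinate functions are dual to them. Every dimension count for the distribution
  rests on this.\<close>

lemma tangent_basis:
  obtains S where "finite S" "card S = DIM('e)" "independent S" "span S = tangent_space A p"
proof -
  obtain U \<phi> where c: "(U, \<phi>) \<in> A" "p \<in> U" by (rule chart_at)
  obtain W x where W: "open W" "p \<in> W" "W \<subseteq> U"
    and x: "\<And>b. x b \<in> C_infty A" "\<And>b q. q \<in> W \<Longrightarrow> x b q = \<phi> q \<bullet> b"
    by (rule coord_functions[OF c]) (rule that)
  let ?e = "coord_vec U \<phi> p"
  have ex: "?e b (x b') = b \<bullet> b'" for b b'
    by (rule coord_vec_coord[OF c(1) W(1,3,2) x])
  have inj: "inj_on ?e Basis"
  proof (rule inj_onI)
    fix b b' :: 'e assume b: "b \<in> Basis" "b' \<in> Basis" "?e b = ?e b'"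
    then have "b \<bullet> b = b' \<bullet> b" using ex by metis
    then show "b = b'" using b by (metis inner_not_same_Basis inner_same_Basis zero_neq_one)
  qed
  have "independent (?e ` Basis)"
  proof
    assume "dependent (?e ` Basis)"
    then obtain u v where v: "v \<in> ?e ` Basis" "u v \<noteq> 0" and z: "(\<Sum>y\<in>?e ` Basis. u y *\<^sub>R y) = 0"
      using dependent_finite[of "?e ` Basis"] by auto
    from v obtain b where b: "b \<in> Basis" "v = ?e b" by auto
    have "(\<Sum>b\<in>Basis. u (?e b) *\<^sub>R ?e b) = 0"
      using z by (simp only: sum.reindex[OF inj] o_def)
    then have "0 = (\<Sum>b'\<in>Basis. u (?e b') *\<^sub>R ?e b') (x b)"
      by (simp only: zero_fun_apply)
    also have "\<dots> = (\<Sum>b'\<in>Basis. u (?e b') * (b' \<bullet> b))"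
      by (simp add: sum_fun_apply scaleR_fun_def ex)
    also have "\<dots> = (\<Sum>b'\<in>Basis. if b' = b then u (?e b') else 0)"
      by (rule sum.cong[OF refl]) (simp add: inner_Basis b(1))
    also have "\<dots> = u (?e b)" by (simp only: sum.delta[OF finite_Basis] b(1) if_True)
    finally have "0 = u (?e b)" .
    with v(2) b(2) show False by simp
  qed
  moreover have "span (?e ` Basis) = tangent_space A p"
  proof (rule antisym)
    show "span (?e ` Basis) \<subseteq> tangent_space A p"
      by (rule span_minimal[OF _ subspace_tangent_space]) (use coord_vec_tangent[OF c] in auto)
    show "tangent_space A p \<subseteq> span (?e ` Basis)"
    proof
      fix v assume "v \<in> tangent_space A p"
      from tangent_representation[OF c(1) W(1,3,2) x this]
      have "v = (\<Sum>b\<in>Basis. v (x b) *\<^sub>R ?e b)" .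
      moreover have "(\<Sum>b\<in>Basis. v (x b) *\<^sub>R ?e b) \<in> span (?e ` Basis)"
        by (intro span_sum span_scale span_base) auto
      ultimately show "v \<in> span (?e ` Basis)" by metis
    qed
  qed
  ultimately show ?thesis using that[of "?e ` Basis"] card_image[OF inj] by auto
qed

section \<open>Vector fields, brackets and extension of tangent vectors\<close>

lemma vector_fieldI:
  "(\<And>p. X p \<in> tangent_space A p) \<Longrightarrow> (\<And>f. f \<in> C_infty A \<Longrightarrow> (\<lambda>p. X p f) \<in> C_infty A) \<Longrightarrow> X \<in> vector_fields A"
  by (auto simp: vector_fields_def app_def)

lemma vector_field_tangent: "X \<in> vector_fields A \<Longrightarrow> X p \<in> tangent_space A p"
  by (simp add: vector_fields_def)

lemma app_C_infty: "X \<in> vector_fields A \<Longrightarrow> f \<in> C_infty A \<Longrightarrow> app X f \<in> C_infty A"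
  by (simp add: vector_fields_def)

lemma vector_field_0: "0 \<in> vector_fields A"
  by (rule vector_fieldI) (use subspace_0[OF subspace_tangent_space] C_infty_const[of 0] in auto)

lemma vector_field_add:
  assumes "X \<in> vector_fields A" "Y \<in> vector_fields A"
  shows "X + Y \<in> vector_fields A"
proof (rule vector_fieldI)
  show "(X + Y) p \<in> tangent_space A p" for p
    using subspace_add[OF subspace_tangent_space vector_field_tangent[OF assms(1)] vector_field_tangent[OF assms(2)]]
    by simp
  show "(\<lambda>p. (X + Y) p f) \<in> C_infty A" if "f \<in> C_infty A" for f
    using C_infty_add[OF app_C_infty[OF assms(1) that] app_C_infty[OF assms(2) that]]
    by (simp add: app_def plus_fun_def)
qed

lemma vector_field_mult:
  assumes "f \<in> C_infty A" "X \<in> vector_fields A"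
  shows "(\<lambda>p. f p *\<^sub>R X p) \<in> vector_fields A"
proof (rule vector_fieldI)
  show "f p *\<^sub>R X p \<in> tangent_space A p" for p
    by (rule subspace_scale[OF subspace_tangent_space vector_field_tangent[OF assms(2)]])
  show "(\<lambda>p. (f p *\<^sub>R X p) h) \<in> C_infty A" if "h \<in> C_infty A" for h
    using C_infty_mult[OF assms(1) app_C_infty[OF assms(2) that]]
    by (simp add: app_def scaleR_fun_def times_fun_def)
qed

lemma vector_field_scaleR: "X \<in> vector_fields A \<Longrightarrow> c *\<^sub>R X \<in> vector_fields A"
  using vector_field_mult[OF C_infty_const, of X c] by (simp add: scaleR_fun_def)

lemma vector_field_diff: "X \<in> vector_fields A \<Longrightarrow> Y \<in> vector_fields A \<Longrightarrow> X - Y \<in> vector_fields A"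
  using vector_field_add[OF _ vector_field_scaleR, of X Y "-1"] by simp

lemma vector_field_sum: "(\<And>i. i \<in> I \<Longrightarrow> X i \<in> vector_fields A) \<Longrightarrow> (\<Sum>i\<in>I. X i) \<in> vector_fields A"
  by (induction I rule: infinite_finite_induct) (auto intro: vector_field_0 vector_field_add)

text \<open>The commutator is again a derivation because, in the Leibniz rule, the mixed products of
  first derivatives of \<open>f\<close> and \<open>h\<close> cancel.\<close>

lemma bracket_vector_field:
  assumes X: "X \<in> vector_fields A" and Y: "Y \<in> vector_fields A"
  shows "bracket X Y \<in> vector_fields A"
proof (rule vector_fieldI)
  note t = vector_field_tangent[OF X] vector_field_tangent[OF Y]
  show "bracket X Y p \<in> tangent_space A p" for p
  proof (rule tangentI)
    fix f h assume f: "f \<in> C_infty A" and h: "h \<in> C_infty A"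
    have lin: "app Z (a *\<^sub>R f + b *\<^sub>R h) = a *\<^sub>R app Z f + b *\<^sub>R app Z h" if "Z \<in> vector_fields A" for Z a b
      using tangent_comb[OF vector_field_tangent[OF that] f h] by (auto simp: app_def fun_eq_iff scaleR_fun_def)
    have leib: "app Z (f * h) = app Z f * h + f * app Z h" if "Z \<in> vector_fields A" for Z
      using tangent_mult[OF vector_field_tangent[OF that] f h] by (auto simp: app_def fun_eq_iff)
    note sm = app_C_infty[OF X f] app_C_infty[OF Y f] app_C_infty[OF X h] app_C_infty[OF Y h]
    show "bracket X Y p (a *\<^sub>R f + b *\<^sub>R h) = a * bracket X Y p f + b * bracket X Y p h" for a b
      by (simp add: bracket_def lin[OF X] lin[OF Y] tangent_comb[OF t(1)] tangent_comb[OF t(2)] sm algebra_simps)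
    show "bracket X Y p (f * h) = bracket X Y p f * h p + f p * bracket X Y p h"
      by (simp add: bracket_def leib[OF X] leib[OF Y] tangent_add[OF t(1)] tangent_add[OF t(2)]
          tangent_mult[OF t(1)] tangent_mult[OF t(2)] C_infty_mult sm f h algebra_simps) (simp add: app_def)
  next
    fix f assume f: "f \<notin> C_infty A"
    then have "app Z f = 0" if "Z \<in> vector_fields A" for Z
      using tangent_not_smooth[OF vector_field_tangent[OF that]] by (auto simp: app_def fun_eq_iff)
    then show "bracket X Y p f = 0"
      using X Y tangent_0[OF t(1)] tangent_0[OF t(2)] by (simp add: bracket_def)
  qed
  show "(\<lambda>p. bracket X Y p f) \<in> C_infty A" if "f \<in> C_infty A" for f
    using C_infty_diff[OF app_C_infty[OF X app_C_infty[OF Y that]] app_C_infty[OF Y app_C_infty[OF X that]]]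
    by (simp add: bracket_def app_def fun_diff_def)
qed

lemma vector_field_local:
  assumes "\<And>p. X p \<in> tangent_space A p"
    and "\<And>p. \<exists>W X'. open W \<and> p \<in> W \<and> X' \<in> vector_fields A \<and> (\<forall>q\<in>W. X q = X' q)"
  shows "X \<in> vector_fields A"
proof (rule vector_fieldI[OF assms(1)], rule C_infty_local)
  fix f p assume f: "f \<in> C_infty A"
  obtain W X' where W: "open W" "p \<in> W" "X' \<in> vector_fields A" "\<And>q. q \<in> W \<Longrightarrow> X q = X' q"
    using assms(2) by meson
  show "\<exists>W f'. open W \<and> p \<in> W \<and> f' \<in> C_infty A \<and> (\<forall>q\<in>W. X q f = f' q)"
    by (rule exI[of _ W], rule exI[of _ "app X' f"]) (use W app_C_infty[OF W(3) f] in \<open>auto simp: app_def\<close>)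
qed

text \<open>Coordinate fields live on the chart domain only; a cutoff turns them into global vector
  fields that are unchanged near \<open>p\<close>.\<close>

lemma coord_frame:
  assumes c: "(U, \<phi>) \<in> A" "p \<in> U"
  obtains W E where "open W" "p \<in> W" "W \<subseteq> U" "\<And>b. E b \<in> vector_fields A"
    "\<And>b q. q \<in> W \<Longrightarrow> E b q = coord_vec U \<phi> q b"
proof -
  have "\<phi> p \<in> \<phi> ` U" using c by auto
  then obtain \<beta> K W where \<beta>: "smooth_on UNIV \<beta>" "compact K" "K \<subseteq> \<phi> ` U" "\<And>x. x \<notin> K \<Longrightarrow> \<beta> x = (0::real)"
    and W: "open W" "p \<in> W" "W \<subseteq> U" "\<And>q. q \<in> W \<Longrightarrow> \<phi> q \<in> \<phi> ` U" "\<And>q. q \<in> W \<Longrightarrow> \<beta> (\<phi> q) = 1"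
    by (rule chart_cutoff[OF c chart(2)[OF c(1)]]) (rule that)
  let ?E = "\<lambda>b q. if q \<in> U then \<beta> (\<phi> q) *\<^sub>R coord_vec U \<phi> q b else 0"
  show ?thesis
  proof (rule that[OF W(1-3)])
    show "?E b \<in> vector_fields A" for b
    proof (rule vector_fieldI)
      show "?E b q \<in> tangent_space A q" for q
        using subspace_0[OF subspace_tangent_space] subspace_scale[OF subspace_tangent_space coord_vec_tangent[OF c(1)]]
        by auto
      fix f assume f: "f \<in> C_infty A"
      have "(\<lambda>q. if q \<in> U then (\<lambda>x. \<beta> x * frechet_derivative (\<lambda>x. f (inv_into U \<phi> x)) (at x) b) (\<phi> q) else 0)
          \<in> C_infty A"
        by (rule chart_extend[OF c(1) \<beta>(2,3)], intro smooth_on_mult chart(2)[OF c(1)] smooth_on_subset[OF \<beta>(1)]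
            smooth_on_frechet_derivative C_infty_chart[OF f c(1)]) (use \<beta>(4) in auto)
      moreover have "(\<lambda>q. ?E b q f) = (\<lambda>q. if q \<in> U then (\<lambda>x. \<beta> x * frechet_derivative (\<lambda>x. f (inv_into U \<phi> x)) (at x) b) (\<phi> q) else 0)"
        using f by (auto simp: fun_eq_iff scaleR_fun_def coord_vec_def)
      ultimately show "(\<lambda>q. ?E b q f) \<in> C_infty A" by simp
    qed
    show "?E b q = coord_vec U \<phi> q b" if "q \<in> W" for b q using that W by auto
  qed
qed

lemma tangent_extension:
  assumes v: "v \<in> tangent_space A p"
  obtains X where "X \<in> vector_fields A" "X p = v"
proof -
  obtain U \<phi> where c: "(U, \<phi>) \<in> A" "p \<in> U" by (rule chart_at)
  obtain W x where W: "open W" "p \<in> W" "W \<subseteq> U"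
    and x: "\<And>b. x b \<in> C_infty A" "\<And>b q. q \<in> W \<Longrightarrow> x b q = \<phi> q \<bullet> b"
    by (rule coord_functions[OF c]) (rule that)
  obtain W' E where E: "open W'" "p \<in> W'" "\<And>b. E b \<in> vector_fields A" "\<And>b q. q \<in> W' \<Longrightarrow> E b q = coord_vec U \<phi> q b"
    by (rule coord_frame[OF c]) (rule that)
  show ?thesis
  proof (rule that)
    show "(\<Sum>b\<in>Basis. v (x b) *\<^sub>R E b) \<in> vector_fields A"
      by (intro vector_field_sum vector_field_scaleR E)
    have "(\<Sum>b\<in>Basis. v (x b) *\<^sub>R E b) p = (\<Sum>b\<in>Basis. v (x b) *\<^sub>R coord_vec U \<phi> p b)"
      by (simp add: sum_fun_apply scaleR_fun_def[of _ "E _"] E)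
    then show "(\<Sum>b\<in>Basis. v (x b) *\<^sub>R E b) p = v"
      using tangent_representation[OF c(1) W(1,3,2) x v] by metis
  qed
qed

text \<open>In a chart one can pass to a ball, which is convex, so a function whose derivative
  vanishes there is constant.\<close>

lemma locally_constant:
  assumes f: "f \<in> C_infty A" and W: "open W" "p \<in> W"
    and z: "\<And>q v. q \<in> W \<Longrightarrow> v \<in> tangent_space A q \<Longrightarrow> v f = 0"
  obtains W' where "open W'" "p \<in> W'" "W' \<subseteq> W" "\<And>q. q \<in> W' \<Longrightarrow> f q = f p"
proof -
  obtain U \<phi> where c: "(U, \<phi>) \<in> A" "p \<in> U" by (rule chart_at)
  let ?f = "\<lambda>x. f (inv_into U \<phi> x)"
  obtain r where r: "r > 0" "ball (\<phi> p) r \<subseteq> \<phi> ` (U \<inter> W)"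
    using openE[OF chart_open_image[OF c(1) W(1)], of "\<phi> p"] W c(2) by auto
  have "\<exists>k. \<forall>x\<in>ball (\<phi> p) r. ?f x = k"
  proof (rule has_derivative_zero_constant[OF convex_ball])
    fix x assume x: "x \<in> ball (\<phi> p) r"
    then obtain q where q: "q \<in> U" "q \<in> W" "x = \<phi> q" using r by auto
    have "frechet_derivative ?f (at x) v = 0" for v
      using z[OF q(2) coord_vec_tangent[OF c(1) q(1), of v]] f q(3) by (simp add: coord_vec_def)
    then have "frechet_derivative ?f (at x) = (\<lambda>v. 0)" by (rule ext)
    then show "(?f has_derivative (\<lambda>v. 0)) (at x within ball (\<phi> p) r)"
      using C_infty_chart_derivative[OF f c(1) q(1)] q(3) by (auto intro: has_derivative_at_withinI)
  qed
  then obtain k where k: "\<And>x. x \<in> ball (\<phi> p) r \<Longrightarrow> ?f x = k" by blast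
  show ?thesis
  proof (rule that)
    show "open (U \<inter> \<phi> -` ball (\<phi> p) r)" by (rule chart_open_preimage[OF c(1) open_ball])
    show "p \<in> U \<inter> \<phi> -` ball (\<phi> p) r" using c r by auto
    show "f q = f p" if "q \<in> U \<inter> \<phi> -` ball (\<phi> p) r" for q
      using that k[of "\<phi> q"] k[of "\<phi> p"] r chart_inv[OF c(1)] c(2) by auto
    show "U \<inter> \<phi> -` ball (\<phi> p) r \<subseteq> W"
    proof
      fix q assume q: "q \<in> U \<inter> \<phi> -` ball (\<phi> p) r"
      then obtain q' where "q' \<in> U" "q' \<in> W" "\<phi> q = \<phi> q'" using r by auto
      then show "q \<in> W" using chart_inv[OF c(1)] q by (metis IntD1)
    qed
  qed
qed

end

section \<open>The algebra of the curvature at a point\<close>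

lemma quadratic_nonneg_imp_0:
  fixes b c :: real
  assumes "\<And>t. 0 \<le> 2 * t * b + t\<^sup>2 * c"
  shows "b = 0"
proof (rule ccontr)
  assume b: "b \<noteq> 0"
  \<comment> \<open>Adding 1 keeps \<open>d\<close> positive when \<open>c = 0\<close>. At t = -b/d
    the quadratic equals (b/d)^2 (c - 2d), which is negative because c < d.\<close>
  define d where "d = \<bar>c\<bar> + 1"
  have d: "d > 0" "c < d" by (auto simp: d_def)
  have "2 * (- b / d) * b + (- b / d)\<^sup>2 * c = (b\<^sup>2 / d\<^sup>2) * (c - 2 * d)"
    using d by (simp add: field_simps power2_eq_square)
  moreover have "(b\<^sup>2 / d\<^sup>2) * (c - 2 * d) < 0"
    using b d by (intro mult_pos_neg) auto
  ultimately show False using assms[of "- b / d"] by linarith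
qed

text \<open>Maximise the quadratic form of \<open>P\<close> on the unit sphere of \<open>S\<close>,
  with maximum \<mu> at \<open>v\<close>. Moving from \<open>v\<close> in the direction \<mu> v - P
  v cannot increase the form beyond \<mu> times the squared length, and to first order this forces
  that direction to be 0.\<close>

lemma symmetric_eigenvector:
  fixes P :: "'e::euclidean_space \<Rightarrow> 'e"
  assumes S: "subspace S" "S \<noteq> {0}" and P: "linear P" "\<And>x. P x \<in> S" "\<And>x y. P x \<bullet> y = x \<bullet> P y"
  obtains v \<mu> where "v \<in> S" "v \<noteq> 0" "P v = \<mu> *\<^sub>R v"
proof -
  let ?K = "S \<inter> sphere 0 1"
  obtain x where x: "x \<in> S" "x \<noteq> 0" using S subspace_0 by blast
  then have "(1 / norm x) *\<^sub>R x \<in> ?K" using S(1) by (auto intro: subspace_scale)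
  then have "?K \<noteq> {}" by blast
  moreover have "compact ?K" by (intro closed_Int_compact closed_subspace S compact_sphere)
  moreover have "continuous_on ?K (\<lambda>v. P v \<bullet> v)"
    by (intro continuous_intros linear_continuous_on_compose[OF continuous_on_id P(1)])
  ultimately obtain v where v: "v \<in> ?K" "\<And>w. w \<in> ?K \<Longrightarrow> P w \<bullet> w \<le> P v \<bullet> v"
    using continuous_attains_sup[of ?K "\<lambda>v. P v \<bullet> v"] by blast
  define \<mu> where "\<mu> = P v \<bullet> v"
  have vv: "v \<bullet> v = 1" "v \<in> S" "v \<noteq> 0" using v(1) by (auto simp: norm_eq_1)
  have max: "P w \<bullet> w \<le> \<mu> * (w \<bullet> w)" if w: "w \<in> S" for w
  proof (cases "w = 0")
    case True
    then show ?thesis by simp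
  next
    case False
    let ?w = "(1 / norm w) *\<^sub>R w"
    have "?w \<in> ?K" using False w S(1) by (auto intro: subspace_scale)
    then have "P ?w \<bullet> ?w \<le> \<mu>" unfolding \<mu>_def by (rule v(2))
    moreover have "P ?w \<bullet> ?w = (P w \<bullet> w) / (w \<bullet> w)"
      using P(1) by (simp add: linear_scale dot_square_norm power2_eq_square)
    ultimately have "(P w \<bullet> w) / (w \<bullet> w) \<le> \<mu>" by (simp only:)
    moreover have "w \<bullet> w > 0" using False by simp
    ultimately show ?thesis by (simp only: pos_divide_le_eq)
  qed
  define w where "w = \<mu> *\<^sub>R v - P v"
  have w: "w \<in> S" unfolding w_def using vv S(1) P(2) by (auto intro: subspace_diff subspace_scale)
  have "0 \<le> 2 * t * (w \<bullet> w) + t\<^sup>2 * (\<mu> * (w \<bullet> w) - P w \<bullet> w)" for t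
  proof -
    have "v + t *\<^sub>R w \<in> S" using vv w S(1) by (auto intro: subspace_add subspace_scale)
    from max[OF this] have "P v \<bullet> v + t * (P v \<bullet> w) + (t * (P w \<bullet> v) + t * (t * (P w \<bullet> w)))
       \<le> \<mu> * (v \<bullet> v + 2 * t * (v \<bullet> w) + t * (t * (w \<bullet> w)))"
      using P(1) by (simp add: linear_add linear_scale inner_add inner_commute algebra_simps)
    moreover have "P w \<bullet> v = P v \<bullet> w" using P(3)[of w v] inner_commute[of w "P v"] by (simp only:)
    ultimately have "2 * (t * (P v \<bullet> w)) + t\<^sup>2 * (P w \<bullet> w) \<le> 2 * (t * (\<mu> * (v \<bullet> w))) + t\<^sup>2 * (\<mu> * (w \<bullet> w))"
      unfolding vv(1) \<mu>_def[symmetric] by (simp add: power2_eq_square algebra_simps)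
    moreover have "w \<bullet> w = \<mu> * (v \<bullet> w) - P v \<bullet> w"
      by (subst (1) w_def) (simp add: inner_diff_left)
    then have "t * (w \<bullet> w) = t * (\<mu> * (v \<bullet> w)) - t * (P v \<bullet> w)"
      by (simp only: right_diff_distrib)
    moreover have "2 * t * (w \<bullet> w) + t\<^sup>2 * (\<mu> * (w \<bullet> w) - P w \<bullet> w)
        = 2 * (t * (w \<bullet> w)) + (t\<^sup>2 * (\<mu> * (w \<bullet> w)) - t\<^sup>2 * (P w \<bullet> w))"
      by (simp only: right_diff_distrib mult.assoc)
    ultimately show ?thesis by linarith
  qed
  from quadratic_nonneg_imp_0[OF this] have "P v = \<mu> *\<^sub>R v" by (simp add: w_def)
  then show ?thesis using that vv by blast
qed

lemma subspace_component:
  fixes V :: "'e::euclidean_space set"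
  assumes "subspace V"
  obtains y where "y \<in> V" "\<And>w. w \<in> V \<Longrightarrow> y \<bullet> w = x \<bullet> w"
proof -
  obtain y z where "y \<in> span V" "\<And>w. w \<in> span V \<Longrightarrow> orthogonal z w" "x = y + z"
    using orthogonal_subspace_decomp_exists[of V x] by blast
  moreover have "span V = V" using assms by (simp only: span_eq_iff)
  ultimately show ?thesis
    using that[of y] by (simp add: orthogonal_def inner_add_left)
qed

section \<open>Curvature on an invariant orthogonal splitting\<close>

text \<open>The data of the decomposition of R, with its Bianchi identity rewritten in
  \<open>K\<close> and \<open>C\<close>. The conditions on \<open>V\<close> and \<open>W\<close> are
  symmetric, so the locale can be interpreted again with the two summands exchanged.\<close>

locale split_curvature =
  fixes A C :: "'e::euclidean_space \<Rightarrow> 'e" and K :: "'e \<Rightarrow> 'e \<Rightarrow> 'e \<Rightarrow> 'e" and V W :: "'e set"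
  assumes V: "subspace V" and W: "subspace W" and VW: "\<And>x y. x \<in> V \<Longrightarrow> y \<in> W \<Longrightarrow> x \<bullet> y = 0"
    and A_V: "\<And>x. x \<in> V \<Longrightarrow> A x \<in> V" and A_W: "\<And>x. x \<in> W \<Longrightarrow> A x \<in> W"
    and K_V: "\<And>x y z. z \<in> V \<Longrightarrow> K x y z \<in> V" and K_W: "\<And>x y z. z \<in> W \<Longrightarrow> K x y z \<in> W"
    and A_lin: "linear A" and A_skew: "\<And>x y. A x \<bullet> y = - (x \<bullet> A y)"
    and A_inj: "\<And>x. x \<in> V \<union> W \<Longrightarrow> A x = 0 \<Longrightarrow> x = 0"
    and K_anti: "\<And>x y z. K x y z = - K y x z"
    and K_skew: "\<And>x y z w. K x y z \<bullet> w = - (z \<bullet> K x y w)"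
    and K_comm: "\<And>x y z. A (K x y z) = K x y (A z)"
    and C_symp: "\<And>z w. A (C z) \<bullet> w + A z \<bullet> C w = 0"
    and Bianchi: "\<And>x y z. K x y z + K y z x + K z x y
        + (A x \<bullet> y) *\<^sub>R C z + (A y \<bullet> z) *\<^sub>R C x + (A z \<bullet> x) *\<^sub>R C y = 0"
begin

lemma Bianchi_inner:
  "K x y z \<bullet> w + K y z x \<bullet> w + K z x y \<bullet> w + (A x \<bullet> y) * (C z \<bullet> w) + (A y \<bullet> z) * (C x \<bullet> w)
    + (A z \<bullet> x) * (C y \<bullet> w) = 0"
  using arg_cong[OF Bianchi[of x y z], of "\<lambda>u. u \<bullet> w"] by (simp add: inner_add_left)

text \<open>Insert \<open>x\<close>, \<open>A x\<close>, \<open>z\<close> into the Bianchi identity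
  and pair with \<open>w\<close>. Every term that mixes \<open>V\<close> and \<open>W\<close>
  vanishes, which leaves \<open>K x (A x) z \<bullet> w\<close> against a positive multiple of
  \<open>C z \<bullet> w\<close>; the former is skew in \<open>z\<close> and \<open>w\<close>, so
  symmetrising eliminates it.\<close>

lemma sym_part_diagonal:
  assumes x: "x \<in> V" "x \<noteq> 0" and z: "z \<in> W" "w \<in> W"
  shows "C z \<bullet> w + z \<bullet> C w = 0"
proof -
  have Ax: "A x \<in> V" "A x \<bullet> A x \<noteq> 0" using x A_V A_inj by auto
  have "K x (A x) z \<bullet> w + (A x \<bullet> A x) * (C z \<bullet> w) = 0" if "z \<in> W" "w \<in> W" for z w
    using Bianchi_inner[of x "A x" z w] VW[OF K_V[OF x(1)] that(2), of "A x" z] VW[OF K_V[OF Ax(1)] that(2), of z x]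
      VW[OF A_V[OF Ax(1)] that(1)] VW[OF x(1) A_W[OF that(1)]] by (simp add: inner_commute)
  from this[OF z] this[OF z(2,1)] K_skew[of x "A x" z w]
  have "(A x \<bullet> A x) * (C z \<bullet> w + C w \<bullet> z) = 0" by (simp add: algebra_simps inner_commute)
  then show ?thesis using Ax(2) by (simp add: inner_commute)
qed

text \<open>A vector \<open>n\<close> orthogonal to the image of \<open>U\<close> is in particular
  orthogonal to \<open>A (A n)\<close>, and by skewness this product is minus the squared length of
  \<open>A n\<close>.\<close>

lemma A_perp:
  assumes "subspace U" "U \<subseteq> V \<or> U \<subseteq> W" "\<And>x. x \<in> U \<Longrightarrow> A x \<in> U" "n \<in> U" "\<And>x. x \<in> U \<Longrightarrow> A x \<bullet> n = 0"
  shows "n = 0"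
proof -
  have "A n \<bullet> A n = 0" using assms(5)[OF assms(3)[OF assms(4)]] A_skew[of "A n" n] by simp
  then show ?thesis using A_inj[of n] assms(2,4) by auto
qed

text \<open>For fixed \<open>z\<close>, let \<open>q\<close> be the \<open>V\<close>-component of
  \<open>C z\<close>. The Bianchi identity determines the form
  \<open>f x y w = K x z y \<bullet> w\<close> on \<open>V\<close> from \<open>q\<close> alone. That
  \<open>K\<close> commutes with \<open>A\<close> then becomes a linear condition on
  \<open>q\<close>, and it can only hold for \<open>q = 0\<close> once \<open>V\<close> contains a
  nonzero vector orthogonal to \<open>q\<close> and \<open>A q\<close>.\<close>

lemma off_diagonal:
  assumes dim: "3 \<le> dim V" and z: "z \<in> W" and w: "w \<in> V"
  shows "C z \<bullet> w = 0"
proof -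
  obtain q where q: "q \<in> V" "\<And>w. w \<in> V \<Longrightarrow> q \<bullet> w = C z \<bullet> w"
    using subspace_component[OF V] by blast
  define f where "f x y w = K x z y \<bullet> w" for x y w
  have skew: "f x y w = - f x w y" for x y w
    unfolding f_def using K_skew by (metis inner_commute)
  have cyc: "f x y w = f y x w + (A x \<bullet> y) * (q \<bullet> w)" if "x \<in> V" "y \<in> V" "w \<in> V" for x y w
    using Bianchi_inner[of x y z w] VW[OF that(3) K_W[OF z], of x y] VW[OF A_V[OF that(2)] z] VW[OF that(1) A_W[OF z]]
      K_anti[of z x y] by (simp add: f_def inner_commute q(2) that)
  \<comment> \<open>solved for \<open>f\<close> as in the Koszul formula\<close>
  have f: "2 * f x y w = (A x \<bullet> y) * (q \<bullet> w) + (A w \<bullet> x) * (q \<bullet> y) - (A y \<bullet> w) * (q \<bullet> x)"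
    if "x \<in> V" "y \<in> V" "w \<in> V" for x y w
    using cyc[OF that] cyc[OF that(2,3,1)] cyc[OF that(3,1,2)] skew[of x y w] skew[of y w x] skew[of w x y] by linarith
  have A_f: "f x (A y) w = - f x y (A w)" for x y w
    unfolding f_def using K_comm A_skew by (metis (no_types))
  \<comment> \<open>This is \<open>f x (A y) w = - f x y (A w)\<close> with the formula for
    \<open>f\<close> inserted: the terms containing \<open>q \<bullet> x\<close> cancel, and what
    remains is the inner product of \<open>A x\<close> with the vector on the left.\<close>
  have key: "(q \<bullet> w) *\<^sub>R A y - (q \<bullet> A y) *\<^sub>R w + (q \<bullet> A w) *\<^sub>R y - (q \<bullet> y) *\<^sub>R A w = 0"
    if yw: "y \<in> V" "w \<in> V" for y w
  proof (rule A_perp[OF V])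
    show "(q \<bullet> w) *\<^sub>R A y - (q \<bullet> A y) *\<^sub>R w + (q \<bullet> A w) *\<^sub>R y - (q \<bullet> y) *\<^sub>R A w \<in> V"
      by (intro subspace_add[OF V] subspace_diff[OF V] subspace_scale[OF V] A_V yw)
    fix x assume x: "x \<in> V"
    have "A w \<bullet> x = - (A x \<bullet> w)" "A (A w) \<bullet> x = - (A x \<bullet> A w)" "A (A y) \<bullet> w = - (A y \<bullet> A w)"
      using A_skew by (metis inner_commute)+
    then show "A x \<bullet> ((q \<bullet> w) *\<^sub>R A y - (q \<bullet> A y) *\<^sub>R w + (q \<bullet> A w) *\<^sub>R y - (q \<bullet> y) *\<^sub>R A w) = 0"
      using f[OF x A_V[OF yw(1)] yw(2)] f[OF x yw(1) A_V[OF yw(2)]] A_f[of x y w]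
      by (simp add: inner_diff_right inner_add_right algebra_simps)
  qed (use A_V in auto)
  have "span {q, A q} \<noteq> V"
  proof
    assume "span {q, A q} = V"
    then have "dim V = dim {q, A q}" by (metis dim_span)
    moreover have "dim {q, A q} \<le> card {q, A q}" by (rule dim_le_card') simp
    moreover have "card {q, A q} \<le> 2" by (simp add: card_insert_if)
    ultimately show False using dim by linarith
  qed
  moreover have "span {q, A q} \<subseteq> V" by (rule span_minimal) (use q A_V V in auto)
  moreover have sV: "span V = V" using V by (simp only: span_eq_iff)
  ultimately have "span {q, A q} \<subset> span V" unfolding psubset_eq sV by blast
  then obtain y where y: "y \<noteq> 0" "y \<in> span V" "\<And>x. x \<in> span {q, A q} \<Longrightarrow> orthogonal y x"
    using orthogonal_to_subspace_exists_gen by metis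
  have yV: "y \<in> V" using y(2) unfolding sV .
  have qy: "q \<bullet> y = 0" "q \<bullet> A y = 0"
    using y(3)[of q] y(3)[of "A q"] A_skew[of q y] by (auto simp: orthogonal_def span_base inner_commute)
  \<comment> \<open>For this \<open>y\<close> the vectors \<open>y\<close> and \<open>A y\<close>
    are nonzero and orthogonal to each other, so both coefficients must vanish.\<close>
  have "(q \<bullet> w) *\<^sub>R A y + (q \<bullet> A w) *\<^sub>R y = 0"
    using key[OF yV w] qy by simp
  from arg_cong[OF this, of "\<lambda>v. v \<bullet> u" for u]
  have e: "(q \<bullet> w) * (A y \<bullet> u) + (q \<bullet> A w) * (y \<bullet> u) = 0" for u
    by (simp add: inner_add_left)
  have "A y \<bullet> y = 0" using A_skew[of y y] by (simp add: inner_commute)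
  then have "q \<bullet> A w = 0" using e[of y] y(1) by simp
  then have "(q \<bullet> w) * (A y \<bullet> A y) = 0" using e[of "A y"] by simp
  moreover have "A y \<noteq> 0" using A_inj yV y(1) by auto
  ultimately show ?thesis using q(2)[OF w] by simp
qed

text \<open>For \<open>x\<close> in \<open>W\<close> the symplectic identity turns the vanishing of
  \<open>C x \<bullet> A w\<close>, known from \<open>off_diagonal\<close>, into that of
  \<open>A x \<bullet> C w\<close>; then \<open>A_perp\<close> removes the \<open>A\<close>.\<close>

lemma off_diagonal':
  assumes dim: "3 \<le> dim V" and z: "z \<in> W" and w: "w \<in> V"
  shows "z \<bullet> C w = 0"
proof -
  obtain q where q: "q \<in> W" "\<And>z. z \<in> W \<Longrightarrow> q \<bullet> z = C w \<bullet> z"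
    using subspace_component[OF W] by blast
  have "q = 0"
  proof (rule A_perp[OF W])
    fix x assume x: "x \<in> W"
    have "A (C x) \<bullet> w = 0" using off_diagonal[OF dim x A_V[OF w]] A_skew by simp
    then show "A x \<bullet> q = 0" using C_symp[of x w] q(2)[OF A_W[OF x]] by (simp add: inner_commute)
  qed (use q A_W in auto)
  then show ?thesis using q(2)[OF z] by (simp add: inner_commute)
qed

text \<open>Each diagonal block is handled by a nonzero vector of the opposite summand, so the
  locale is used with both orders of \<open>V\<close> and \<open>W\<close>; both mixed blocks vanish
  because of the dimension of \<open>V\<close>.\<close>

lemma sym_part_eq_0:
  assumes "V \<noteq> {0}" "W \<noteq> {0}" "3 \<le> dim V" "z \<in> V \<or> z \<in> W" "w \<in> V \<or> w \<in> W"
  shows "C z \<bullet> w + z \<bullet> C w = 0"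
proof -
  have WV: "x \<bullet> y = 0" if "x \<in> W" "y \<in> V" for x y using VW[OF that(2,1)] by (simp add: inner_commute)
  have inj: "x = 0" if "x \<in> W \<union> V" "A x = 0" for x using A_inj that by blast
  interpret swap: split_curvature A C K W V
    by (rule split_curvature.intro) (fact V W WV A_V A_W K_V K_W A_lin A_skew inj K_anti K_skew K_comm C_symp Bianchi)+
  obtain x y where "x \<in> V" "x \<noteq> 0" "y \<in> W" "y \<noteq> 0"
    using assms(1,2) subspace_0[OF V] subspace_0[OF W] by blast
  then show ?thesis
    using assms(3-) sym_part_diagonal[of x z w] swap.sym_part_diagonal[of y z w]
      off_diagonal[of z w] off_diagonal'[of z w] off_diagonal[of w z] off_diagonal'[of w z]
    by (auto simp: inner_commute)
qed

end

text \<open>The distribution has dimension \<open>DIM('e) - 1\<close>, so it is modelled by a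
  subspace \<open>S\<close> of the coordinate space, while \<open>A\<close> and \<open>R\<close> are
  defined on the whole space with values in \<open>S\<close>. The bilinear form \<omega> is
  \<open>A x \<bullet> y\<close>.\<close>

lemma curvature_algebra:
  fixes A :: "'e::euclidean_space \<Rightarrow> 'e" and R :: "'e \<Rightarrow> 'e \<Rightarrow> 'e \<Rightarrow> 'e" and \<tau> :: "'e \<Rightarrow> 'e \<Rightarrow> real"
  assumes S: "subspace S" and dim: "5 \<le> dim S"
    and A: "linear A" "\<And>x. A x \<in> S" "\<And>x y. A x \<bullet> y = - (x \<bullet> A y)" "\<And>x. x \<in> S \<Longrightarrow> A x = 0 \<Longrightarrow> x = 0"
    and R: "\<And>x y. linear (R x y)" "\<And>x y z. R x y z \<in> S" "\<And>x y z. R x y z = - R y x z"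
    and R_metric: "\<And>x y z w. R x y z \<bullet> w + z \<bullet> R x y w = - 2 * (A x \<bullet> y) * \<tau> z w"
    and R_symp: "\<And>x y z w. A (R x y z) \<bullet> w + A z \<bullet> R x y w = 0"
    and Bianchi: "\<And>x y z. R x y z + R y z x + R z x y = 0"
    and \<tau>: "z0 \<in> S" "w0 \<in> S" "\<tau> z0 w0 \<noteq> 0"
  obtains \<mu> where "\<And>x. x \<in> S \<Longrightarrow> A (A x) = \<mu> *\<^sub>R x"
proof -
  have "S \<noteq> {0}" using dim by auto
  then obtain x0 where x0: "x0 \<in> S" "x0 \<noteq> 0" using S subspace_0 by blast
  then have Ax0: "A x0 \<noteq> 0" using A(4) by auto
  \<comment> \<open>Scaled so that \<omega>(x0,y0) = 1. Then \<open>C\<close> has symmetric part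
    -\<tau>, and subtracting \<omega> \<otimes> \<open>C\<close> from \<open>R\<close> leaves a skew
    \<open>K\<close>.\<close>
  define y0 where "y0 = (1 / (A x0 \<bullet> A x0)) *\<^sub>R A x0"
  have xy0: "A x0 \<bullet> y0 = 1" using Ax0 by (simp add: y0_def)
  define C where "C = R x0 y0"
  define K where "K x y z = R x y z - (A x \<bullet> y) *\<^sub>R C z" for x y z
  have \<tau>_C: "- 2 * \<tau> z w = C z \<bullet> w + z \<bullet> C w" for z w
    using R_metric[of x0 y0 z w] xy0 by (simp add: C_def)
  have C_symp: "A (C z) \<bullet> w + A z \<bullet> C w = 0" for z w using R_symp by (simp add: C_def)
  have C_lin: "linear C" unfolding C_def by (rule R)
  have A_anti: "A x \<bullet> y = - (A y \<bullet> x)" for x y using A(3)[of x y] by (simp add: inner_commute)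
  have K_anti: "K x y z = - K y x z" for x y z
    using R(3)[of x y z] A_anti[of x y] by (simp add: K_def)
  have K_skew: "K x y z \<bullet> w = - (z \<bullet> K x y w)" for x y z w
  proof -
    have "K x y z \<bullet> w + z \<bullet> K x y w = (R x y z \<bullet> w + z \<bullet> R x y w) - (A x \<bullet> y) * (C z \<bullet> w + z \<bullet> C w)"
      by (simp add: K_def inner_diff_left inner_diff_right algebra_simps)
    also have "\<dots> = 0" unfolding R_metric \<tau>_C[symmetric] by simp
    finally show ?thesis by simp
  qed
  \<comment> \<open>\<open>K\<close> inherits the infinitesimal symplectic identity from
    \<open>R\<close> and \<open>C\<close>; for a skew map this identity says that it commutes with
    \<open>A\<close>.\<close>
  have K_comm: "A (K x y z) = K x y (A z)" for x y z
  proof -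
    have "A (K x y z) \<bullet> w = K x y (A z) \<bullet> w" for w
    proof -
      have "A (K x y z) = A (R x y z) - (A x \<bullet> y) *\<^sub>R A (C z)"
        using A(1) by (simp add: K_def linear_diff linear_scale)
      then have "A (K x y z) \<bullet> w = A (R x y z) \<bullet> w - (A x \<bullet> y) * (A (C z) \<bullet> w)"
        by (simp only: inner_diff_left inner_scaleR_left)
      then have "A (K x y z) \<bullet> w + A z \<bullet> K x y w
          = (A (R x y z) \<bullet> w + A z \<bullet> R x y w) - (A x \<bullet> y) * (A (C z) \<bullet> w + A z \<bullet> C w)"
        by (simp only: K_def[of x y w] inner_diff_right inner_scaleR_right) (simp add: algebra_simps)
      then show ?thesis using R_symp[of x y z w] C_symp[of z w] K_skew[of x y "A z" w] by simp
    qed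
    then show ?thesis by (metis vector_eq_rdot)
  qed
  have K_Bianchi: "K x y z + K y z x + K z x y
        + (A x \<bullet> y) *\<^sub>R C z + (A y \<bullet> z) *\<^sub>R C x + (A z \<bullet> x) *\<^sub>R C y = 0" for x y z
    using Bianchi[of x y z] by (simp add: K_def algebra_simps)
  have K_S: "K x y z \<in> S" for x y z
    unfolding K_def C_def by (intro subspace_diff[OF S] subspace_scale[OF S] R)
  have AA: "linear (\<lambda>x. A (A x))" using linear_compose[OF A(1) A(1)] by (simp add: o_def)
  have AA_sym: "A (A x) \<bullet> y = x \<bullet> A (A y)" for x y by (simp add: A(3))
  obtain v \<mu> where v: "v \<in> S" "v \<noteq> 0" "A (A v) = \<mu> *\<^sub>R v"
    using symmetric_eigenvector[OF S \<open>S \<noteq> {0}\<close> AA A(2) AA_sym] by blast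
  \<comment> \<open>The eigenspace is invariant under \<open>A\<close> and under all
    \<open>K x y\<close>, since these commute with the square of \<open>A\<close>. Its orthogonal
    complement in \<open>S\<close> is then invariant by skewness.\<close>
  define V where "V = {x \<in> S. A (A x) = \<mu> *\<^sub>R x}"
  define W where "W = {y \<in> S. \<forall>x\<in>V. orthogonal x y}"
  have V: "subspace V"
    unfolding V_def using S A(1)
    by (auto simp: subspace_def linear_add linear_scale linear_0 scaleR_add_right)
  have W: "subspace W"
    unfolding W_def using S by (auto simp: subspace_def orthogonal_clauses orthogonal_def inner_add_right)
  have A_V: "A x \<in> V" if "x \<in> V" for x using that A(1,2) by (auto simp: V_def linear_scale)
  have K_lin: "K x y (c *\<^sub>R z) = c *\<^sub>R K x y z" for x y z c
    using R(1) C_lin by (simp add: K_def linear_scale scaleR_diff_right)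
  have K_V: "K x y z \<in> V" if "z \<in> V" for x y z
    using that K_comm K_lin K_S by (auto simp: V_def)
  have A_W: "A x \<in> W" if "x \<in> W" for x
    using that A_V A(2) by (auto simp: W_def orthogonal_def) (metis A(3) A_V neg_equal_0_iff_equal)
  have K_W: "K x y z \<in> W" if "z \<in> W" for x y z
    using that K_V K_S by (auto simp: W_def orthogonal_def) (metis K_skew K_V neg_equal_0_iff_equal)
  have VW: "x \<bullet> y = 0" if "x \<in> V" "y \<in> W" for x y using that by (auto simp: W_def orthogonal_def)
  have VS: "V \<subseteq> S" and WS: "W \<subseteq> S" by (auto simp: V_def W_def)
  have WV: "x \<bullet> y = 0" if "x \<in> W" "y \<in> V" for x y using VW[OF that(2,1)] by (simp add: inner_commute)
  have inj: "x = 0" if "x \<in> V \<union> W" "A x = 0" for x using A(4) that VS WS by blast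
  have inj': "x = 0" if "x \<in> W \<union> V" "A x = 0" for x using inj that by blast
  interpret VW: split_curvature A C K V W
    by (rule split_curvature.intro) (fact V W VW A_V A_W K_V K_W A(1,3) inj K_anti K_skew K_comm C_symp K_Bianchi)+
  interpret WV: split_curvature A C K W V
    by (rule split_curvature.intro) (fact V W WV A_V A_W K_V K_W A(1,3) inj' K_anti K_skew K_comm C_symp K_Bianchi)+
  have V0: "V \<noteq> {0}" using v by (auto simp: V_def)
  have dim_VW: "dim W + dim V = dim S"
    unfolding W_def by (rule dim_subspace_orthogonal_to_vectors[OF V S VS])
  have decomp: "\<exists>y\<in>V. \<exists>z\<in>W. x = y + z" if x: "x \<in> S" for x
  proof -
    obtain y where y: "y \<in> V" "\<And>w. w \<in> V \<Longrightarrow> y \<bullet> w = x \<bullet> w"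
      using subspace_component[OF V] by blast
    then have "x - y \<in> W"
      using x VS S by (auto simp: W_def orthogonal_def inner_diff_right inner_commute intro: subspace_diff)
    then show ?thesis using y(1) by (metis add_diff_cancel_left' diff_add_cancel add.commute)
  qed
  show ?thesis
  proof (cases "W = {0}")
    case True
    then have "x \<in> V" if "x \<in> S" for x using decomp[OF that] by auto
    then show ?thesis using that[of \<mu>] by (auto simp: V_def)
  next
    case False
    \<comment> \<open>The dimensions of \<open>V\<close> and \<open>W\<close> add up to at least 5,
      so one of them is at least 3 and can take the distinguished role in
      \<open>sym_part_eq_0\<close>.\<close>
    have zero: "C z \<bullet> w + z \<bullet> C w = 0" if "z \<in> V \<or> z \<in> W" "w \<in> V \<or> w \<in> W" for z w
    proof (cases "3 \<le> dim V")
      case True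
      then show ?thesis by (rule VW.sym_part_eq_0[OF V0 False _ that])
    next
      case F: False
      then have "3 \<le> dim W" using dim dim_VW by linarith
      then show ?thesis using WV.sym_part_eq_0[OF False V0 _ that[THEN disj_commute[THEN iffD1]]] by blast
    qed
    obtain z1 z2 w1 w2 where d: "z1 \<in> V" "z2 \<in> W" "z0 = z1 + z2" "w1 \<in> V" "w2 \<in> W" "w0 = w1 + w2"
      using decomp[OF \<tau>(1)] decomp[OF \<tau>(2)] by blast
    have "C z0 \<bullet> w0 + z0 \<bullet> C w0 = (C z1 \<bullet> w1 + z1 \<bullet> C w1) + (C z1 \<bullet> w2 + z1 \<bullet> C w2)
        + (C z2 \<bullet> w1 + z2 \<bullet> C w1) + (C z2 \<bullet> w2 + z2 \<bullet> C w2)"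
      unfolding d(3,6) using C_lin by (simp add: linear_add inner_add_left inner_add_right)
    also have "\<dots> = 0"
      using zero[of z1 w1] zero[of z1 w2] zero[of z2 w1] zero[of z2 w2] d by simp
    finally show ?thesis using \<tau>_C[of z0 w0] \<tau>(3) by simp
  qed
qed

section \<open>Brackets and frames on a contact sub-Riemannian manifold\<close>

lemma scaleR_fun_apply: "(c *\<^sub>R f) x = c *\<^sub>R f x"
  by (simp add: scaleR_fun_def)

text \<open>The module action of functions on vector fields, named so that its product rules can
  serve as rewrite rules.\<close>

definition fmult :: "('a \<Rightarrow> real) \<Rightarrow> 'a vfield \<Rightarrow> 'a vfield" where
  "fmult f X = (\<lambda>q. f q *\<^sub>R X q)"

lemma fmult_apply: "fmult f X q = f q *\<^sub>R X q"
  by (simp add: fmult_def)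

lemma app_left:
  "app (X + Y) f = app X f + app Y f" "app (X - Y) f = app X f - app Y f" "app (- X) f = - app X f"
  "app (fmult h X) f = h * app X f" "app (c *\<^sub>R X) f = c *\<^sub>R app X f" "app 0 f = 0"
  by (simp_all add: app_def fun_eq_iff fmult_apply scaleR_fun_apply)

lemma app_bracket: "app (bracket X Y) f = app X (app Y f) - app Y (app X f)"
  by (simp add: app_def bracket_def fun_eq_iff)

lemma bracket_swap: "bracket Y X = - bracket X Y"
  by (simp add: bracket_def fun_eq_iff)

section \<open>Lie brackets as commutators of derivations\<close>

context smooth_mfd
begin

lemma vector_field_fmult: "f \<in> C_infty A \<Longrightarrow> X \<in> vector_fields A \<Longrightarrow> fmult f X \<in> vector_fields A"
  unfolding fmult_def by (rule vector_field_mult)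

lemma app_right:
  assumes "X \<in> vector_fields A" "f \<in> C_infty A"
  shows "h \<in> C_infty A \<Longrightarrow> app X (f + h) = app X f + app X h"
    and "h \<in> C_infty A \<Longrightarrow> app X (f - h) = app X f - app X h"
    and "h \<in> C_infty A \<Longrightarrow> app X (f * h) = app X f * h + f * app X h"
  using tangent_add[OF vector_field_tangent[OF assms(1)] assms(2)]
    tangent_diff[OF vector_field_tangent[OF assms(1)] assms(2)]
    tangent_mult[OF vector_field_tangent[OF assms(1)] assms(2)]
  by (simp_all add: app_def fun_eq_iff)

lemma app_const: "X \<in> vector_fields A \<Longrightarrow> app X (\<lambda>_. c) = 0"
  using tangent_const[OF vector_field_tangent] by (simp add: app_def fun_eq_iff)

lemma app_0: "X \<in> vector_fields A \<Longrightarrow> app X 0 = 0"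
  using app_const[of X 0] by (simp add: zero_fun_def)

lemma app_1: "X \<in> vector_fields A \<Longrightarrow> app X 1 = 0"
  using app_const[of X 1] by (simp add: one_fun_def)

lemma tangent_eqI:
  "u \<in> tangent_space A p \<Longrightarrow> v \<in> tangent_space A p \<Longrightarrow> (\<And>f. f \<in> C_infty A \<Longrightarrow> u f = v f) \<Longrightarrow> u = v"
  using tangent_not_smooth by (metis ext)

lemma vector_field_eqI:
  assumes "X \<in> vector_fields A" "Y \<in> vector_fields A" "\<And>f. f \<in> C_infty A \<Longrightarrow> app X f = app Y f"
  shows "X = Y"
proof
  fix p
  show "X p = Y p"
    by (rule tangent_eqI[OF vector_field_tangent[OF assms(1)] vector_field_tangent[OF assms(2)]])
      (use assms(3) in \<open>auto simp: app_def fun_eq_iff\<close>)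
qed

lemma bracket_add:
  assumes "X \<in> vector_fields A" "Y \<in> vector_fields A" "Z \<in> vector_fields A"
  shows "bracket X (Y + Z) = bracket X Y + bracket X Z"
proof (rule vector_field_eqI)
  fix f assume "f \<in> C_infty A"
  then show "app (bracket X (Y + Z)) f = app (bracket X Y + bracket X Z) f"
    by (simp add: app_bracket app_left app_right app_C_infty assms algebra_simps)
qed (intro bracket_vector_field vector_field_add assms)+

lemma bracket_fmult:
  assumes "X \<in> vector_fields A" "Y \<in> vector_fields A" "h \<in> C_infty A"
  shows "bracket X (fmult h Y) = fmult (app X h) Y + fmult h (bracket X Y)"
proof (rule vector_field_eqI)
  fix f assume "f \<in> C_infty A"
  then show "app (bracket X (fmult h Y)) f = app (fmult (app X h) Y + fmult h (bracket X Y)) f"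
    by (simp add: app_bracket app_left app_right app_C_infty assms algebra_simps)
qed (intro bracket_vector_field vector_field_add vector_field_fmult app_C_infty assms)+

lemma Jacobi:
  assumes "X \<in> vector_fields A" "Y \<in> vector_fields A" "Z \<in> vector_fields A"
  shows "bracket X (bracket Y Z) + bracket Y (bracket Z X) + bracket Z (bracket X Y) = 0"
proof (rule vector_field_eqI)
  fix f assume "f \<in> C_infty A"
  then show "app (bracket X (bracket Y Z) + bracket Y (bracket Z X) + bracket Z (bracket X Y)) f = app 0 f"
    by (simp add: app_bracket app_left app_right app_C_infty assms algebra_simps)
qed (intro bracket_vector_field vector_field_add vector_field_0 assms)+

lemma bracket_local:
  assumes X: "X \<in> vector_fields A" and Y: "Y \<in> vector_fields A" "Y' \<in> vector_fields A"
    and W: "open W" "p \<in> W" "\<And>q. q \<in> W \<Longrightarrow> Y q = Y' q"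
  shows "bracket X Y p = bracket X Y' p"
proof (rule tangent_eqI)
  fix f assume f: "f \<in> C_infty A"
  have "X p (app Y f) = X p (app Y' f)"
    by (rule tangent_local[OF vector_field_tangent[OF X] app_C_infty[OF Y(1) f] app_C_infty[OF Y(2) f] W(1,2)])
      (use W(3) in \<open>auto simp: app_def\<close>)
  then show "bracket X Y p f = bracket X Y' p f" using W by (simp add: bracket_def)
qed (rule vector_field_tangent[OF bracket_vector_field[OF X Y(1)]] vector_field_tangent[OF bracket_vector_field[OF X Y(2)]])+

end

section \<open>The contact form, the Reeb field and the metric\<close>

locale contact_sR = smooth_mfd A
  for A :: "('a::{t2_space, second_countable_topology}, 'e::euclidean_space) atlas" +
  fixes \<theta> :: "'a form1" and g :: "'a form2" and \<xi> :: "'a vfield"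
  assumes contact: "contact_form A \<theta>" and metric: "sub_metric A \<theta> g" and Reeb: "Reeb_field A \<theta> \<xi>"
begin

abbreviation "\<Gamma> \<equiv> sections A \<theta>"
abbreviation "\<D> \<equiv> dist_at A \<theta>"
abbreviation "\<omega> \<equiv> ext_d \<theta>"
abbreviation "pr \<equiv> proj_dist \<theta> \<xi>"
abbreviation "G \<equiv> ev2 g"

lemma Reeb_vf: "\<xi> \<in> vector_fields A"
  using Reeb by (simp add: Reeb_field_def)

lemma theta_Reeb: "\<theta> p (\<xi> p) = 1"
  using Reeb unfolding Reeb_field_def ev_def by (metis one_fun_apply)

lemma theta_lin:
  assumes "u \<in> tangent_space A p" "v \<in> tangent_space A p"
  shows "\<theta> p (a *\<^sub>R u + b *\<^sub>R v) = a * \<theta> p u + b * \<theta> p v"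
  using contact assms unfolding contact_form_def one_forms_def linear_over_def by simp

lemma theta_add: "u \<in> tangent_space A p \<Longrightarrow> v \<in> tangent_space A p \<Longrightarrow> \<theta> p (u + v) = \<theta> p u + \<theta> p v"
  using theta_lin[of u p v 1 1] by simp

lemma theta_scaleR: "u \<in> tangent_space A p \<Longrightarrow> \<theta> p (c *\<^sub>R u) = c * \<theta> p u"
  using theta_lin[of u p u c 0] by simp

lemma theta_C_infty: "X \<in> vector_fields A \<Longrightarrow> ev \<theta> X \<in> C_infty A"
  using contact by (simp add: contact_form_def one_forms_def)

lemma theta_Reeb_bracket:
  assumes "X \<in> vector_fields A"
  shows "ev \<theta> (bracket \<xi> X) = app \<xi> (ev \<theta> X)"
proof -
  have "ext_d \<theta> \<xi> X = 0" "ev \<theta> \<xi> = 1" using Reeb assms by (auto simp: Reeb_field_def)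
  then show ?thesis using app_1[OF assms] by (simp add: ext_d_def)
qed

lemma subspace_dist: "subspace (\<D> p)"
proof (rule subspaceI)
  note T = subspace_tangent_space[of p]
  show "0 \<in> \<D> p" using subspace_0[OF T] theta_scaleR[of 0 p 0] by (simp add: dist_at_def)
  show "u + v \<in> \<D> p" if "u \<in> \<D> p" "v \<in> \<D> p" for u v
    using that subspace_add[OF T] by (simp add: dist_at_def theta_add)
  show "c *\<^sub>R u \<in> \<D> p" if "u \<in> \<D> p" for c u
    using that subspace_scale[OF T] by (simp add: dist_at_def theta_scaleR)
qed

lemma dist_tangent: "v \<in> \<D> p \<Longrightarrow> v \<in> tangent_space A p"
  by (simp add: dist_at_def)

lemma section_vf: "X \<in> \<Gamma> \<Longrightarrow> X \<in> vector_fields A"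
  by (simp add: sections_def)

lemma section_dist: "X \<in> \<Gamma> \<Longrightarrow> X p \<in> \<D> p"
  by (simp add: sections_def)

lemma sectionI: "X \<in> vector_fields A \<Longrightarrow> (\<And>p. \<theta> p (X p) = 0) \<Longrightarrow> X \<in> \<Gamma>"
  using vector_field_tangent[of X] by (simp add: sections_def dist_at_def)

lemma sectionI': "X \<in> vector_fields A \<Longrightarrow> (\<And>p. X p \<in> \<D> p) \<Longrightarrow> X \<in> \<Gamma>"
  by (simp add: sections_def)

lemma section_add: "X \<in> \<Gamma> \<Longrightarrow> Y \<in> \<Gamma> \<Longrightarrow> X + Y \<in> \<Gamma>"
  by (rule sectionI') (simp_all add: vector_field_add section_vf section_dist subspace_add[OF subspace_dist])

lemma section_diff: "X \<in> \<Gamma> \<Longrightarrow> Y \<in> \<Gamma> \<Longrightarrow> X - Y \<in> \<Gamma>"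
  by (rule sectionI') (simp_all add: vector_field_diff section_vf section_dist subspace_diff[OF subspace_dist])

lemma section_fmult: "f \<in> C_infty A \<Longrightarrow> X \<in> \<Gamma> \<Longrightarrow> fmult f X \<in> \<Gamma>"
  by (rule sectionI')
    (simp_all add: vector_field_fmult section_vf section_dist fmult_apply subspace_scale[OF subspace_dist])

lemma section_0: "0 \<in> \<Gamma>"
  by (rule sectionI') (simp_all add: vector_field_0 subspace_0[OF subspace_dist])

lemma section_sum: "(\<And>i. i \<in> I \<Longrightarrow> X i \<in> \<Gamma>) \<Longrightarrow> (\<Sum>i\<in>I. X i) \<in> \<Gamma>"
  by (induction I rule: infinite_finite_induct) (auto intro: section_0 section_add)

text \<open>By the Reeb conditions \<theta>([\<xi>,X]) = \<xi>(\<theta>(X)), which is 0 for a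
  section. This is what allows bracketing with \<xi> to act as a derivative of sections.\<close>

lemma Reeb_bracket_section: "X \<in> \<Gamma> \<Longrightarrow> bracket \<xi> X \<in> \<Gamma>"
proof (rule sectionI)
  assume X: "X \<in> \<Gamma>"
  show "bracket \<xi> X \<in> vector_fields A" by (intro bracket_vector_field Reeb_vf section_vf X)
  have "ev \<theta> X = 0" using section_dist[OF X] by (auto simp: ev_def dist_at_def fun_eq_iff)
  then have "ev \<theta> (bracket \<xi> X) = 0"
    using theta_Reeb_bracket[OF section_vf[OF X]] app_0[OF Reeb_vf] by simp
  then show "\<theta> p (bracket \<xi> X p) = 0" for p
    unfolding ev_def by (metis zero_fun_apply)
qed

lemma pr_eq: "pr X = X - fmult (ev \<theta> X) \<xi>"
  by (simp add: proj_dist_def fun_eq_iff fmult_apply ev_def)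

lemma pr_section:
  assumes "X \<in> vector_fields A"
  shows "pr X \<in> \<Gamma>"
proof (rule sectionI)
  show "pr X \<in> vector_fields A"
    unfolding pr_eq by (intro vector_field_diff vector_field_fmult Reeb_vf theta_C_infty assms)
  show "\<theta> p (pr X p) = 0" for p
    using theta_lin[OF vector_field_tangent[OF assms] vector_field_tangent[OF Reeb_vf], of p 1 "- \<theta> p (X p)"]
      theta_Reeb by (simp add: proj_dist_def)
qed

lemma pr_id: "X \<in> \<Gamma> \<Longrightarrow> pr X = X"
  using section_dist by (auto simp: proj_dist_def fun_eq_iff dist_at_def)

lemma pr_apply: "pr X p = X p - \<theta> p (X p) *\<^sub>R \<xi> p"
  by (simp add: proj_dist_def)

lemma pr_add:
  assumes "X \<in> vector_fields A" "Y \<in> vector_fields A"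
  shows "pr (X + Y) = pr X + pr Y"
  using theta_add[OF vector_field_tangent[OF assms(1)] vector_field_tangent[OF assms(2)]]
  by (auto simp: pr_apply fun_eq_iff scaleR_fun_apply algebra_simps)

lemma pr_fmult:
  assumes "X \<in> vector_fields A"
  shows "pr (fmult f X) = fmult f (pr X)"
  using theta_scaleR[OF vector_field_tangent[OF assms]]
  by (auto simp: pr_apply fun_eq_iff fmult_apply scaleR_fun_apply algebra_simps)

lemma pr_Reeb: "pr \<xi> = 0"
  by (simp add: fun_eq_iff pr_apply theta_Reeb)

lemma dist_extension:
  assumes "v \<in> \<D> p"
  obtains X where "X \<in> \<Gamma>" "X p = v"
proof -
  obtain X where X: "X \<in> vector_fields A" "X p = v"
    using tangent_extension[OF dist_tangent[OF assms]] by blast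
  have "pr X p = v" using assms X(2) by (simp add: pr_apply dist_at_def)
  then show ?thesis using that pr_section[OF X(1)] by blast
qed

lemma omega_eq:
  assumes "X \<in> \<Gamma>" "Y \<in> \<Gamma>"
  shows "\<omega> X Y = - ev \<theta> (bracket X Y)"
proof -
  have "ev \<theta> Z = 0" if "Z \<in> \<Gamma>" for Z
    using section_dist[OF that] by (auto simp: ev_def dist_at_def fun_eq_iff)
  then show ?thesis using assms app_0[OF section_vf] by (simp add: ext_d_def)
qed

text \<open>The vertical part of a bracket of sections is measured by \<omega>, with the sign coming
  from the convention for the exterior derivative. The Reeb term of the curvature and the bracket
  generating property both originate here.\<close>

lemma bracket_decomp:
  assumes "X \<in> \<Gamma>" "Y \<in> \<Gamma>"
  shows "bracket X Y = pr (bracket X Y) - fmult (\<omega> X Y) \<xi>"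
  by (simp add: pr_eq omega_eq[OF assms] fun_eq_iff fmult_apply)

lemma omega_C_infty: "X \<in> \<Gamma> \<Longrightarrow> Y \<in> \<Gamma> \<Longrightarrow> \<omega> X Y \<in> C_infty A"
  by (simp add: omega_eq C_infty_uminus theta_C_infty bracket_vector_field section_vf)

lemma omega_swap: "X \<in> \<Gamma> \<Longrightarrow> Y \<in> \<Gamma> \<Longrightarrow> \<omega> Y X = - \<omega> X Y"
proof -
  assume XY: "X \<in> \<Gamma>" "Y \<in> \<Gamma>"
  have "\<theta> p (- bracket X Y p) = - \<theta> p (bracket X Y p)" for p
    using theta_scaleR[OF vector_field_tangent[OF bracket_vector_field[OF section_vf[OF XY(1)] section_vf[OF XY(2)]]], of p "-1"]
    by simp
  then show ?thesis using XY by (simp add: omega_eq ev_def fun_eq_iff bracket_swap[of Y X])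
qed

lemma omega_add_right:
  assumes "X \<in> \<Gamma>" "Y \<in> \<Gamma>" "Z \<in> \<Gamma>"
  shows "\<omega> X (Y + Z) = \<omega> X Y + \<omega> X Z"
proof -
  note v = section_vf[OF assms(1)] section_vf[OF assms(2)] section_vf[OF assms(3)]
  show ?thesis
    using theta_add[OF vector_field_tangent[OF bracket_vector_field[OF v(1,2)]] vector_field_tangent[OF bracket_vector_field[OF v(1,3)]]]
    by (simp add: omega_eq assms section_add bracket_add v ev_def fun_eq_iff)
qed

lemma omega_fmult_right:
  assumes "X \<in> \<Gamma>" "Y \<in> \<Gamma>" "f \<in> C_infty A"
  shows "\<omega> X (fmult f Y) = f * \<omega> X Y"
proof -
  note v = section_vf[OF assms(1)] section_vf[OF assms(2)]
  have "\<theta> p (Y p) = 0" for p using section_dist[OF assms(2), of p] by (simp add: dist_at_def)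
  then have "\<theta> p (app X f p *\<^sub>R Y p + f p *\<^sub>R bracket X Y p) = f p * \<theta> p (bracket X Y p)" for p
    using theta_lin[OF vector_field_tangent[OF v(2)] vector_field_tangent[OF bracket_vector_field[OF v]], of p] by simp
  then show ?thesis
    by (simp add: omega_eq assms section_fmult bracket_fmult v ev_def fun_eq_iff fmult_apply)
qed

lemma omega_add_left: "X \<in> \<Gamma> \<Longrightarrow> Y \<in> \<Gamma> \<Longrightarrow> Z \<in> \<Gamma> \<Longrightarrow> \<omega> (X + Y) Z = \<omega> X Z + \<omega> Y Z"
  by (simp add: omega_swap[of Z] section_add omega_add_right)

lemma omega_fmult_left: "X \<in> \<Gamma> \<Longrightarrow> Y \<in> \<Gamma> \<Longrightarrow> f \<in> C_infty A \<Longrightarrow> \<omega> (fmult f X) Y = f * \<omega> X Y"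
  by (simp add: omega_swap[of Y] section_fmult omega_fmult_right)

lemma omega_local:
  assumes "X \<in> \<Gamma>" "Y \<in> \<Gamma>" "Y' \<in> \<Gamma>" "open W" "p \<in> W" "\<And>q. q \<in> W \<Longrightarrow> Y q = Y' q"
  shows "\<omega> X Y p = \<omega> X Y' p"
  using bracket_local[OF section_vf[OF assms(1)] section_vf[OF assms(2)] section_vf[OF assms(3)] assms(4-6)]
  by (simp add: omega_eq assms(1-3) ev_def)

lemma omega_nondegenerate:
  assumes "X \<in> \<Gamma>" "X p \<noteq> 0"
  obtains Y where "Y \<in> \<Gamma>" "\<omega> X Y p \<noteq> 0"
  using contact assms unfolding contact_form_def by blast

lemma g_facts:
  assumes "u \<in> \<D> p"
  shows "linear_over (\<D> p) (g p u)" "v \<in> \<D> p \<Longrightarrow> g p u v = g p v u" "u \<noteq> 0 \<Longrightarrow> g p u u > 0"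
  using metric assms unfolding sub_metric_def by blast+

lemma g_lin:
  assumes "u \<in> \<D> p" "v \<in> \<D> p" "w \<in> \<D> p"
  shows "g p u (a *\<^sub>R v + b *\<^sub>R w) = a * g p u v + b * g p u w"
  using g_facts(1)[OF assms(1)] assms unfolding linear_over_def by simp

lemma g_add: "u \<in> \<D> p \<Longrightarrow> v \<in> \<D> p \<Longrightarrow> w \<in> \<D> p \<Longrightarrow> g p u (v + w) = g p u v + g p u w"
  using g_lin[of u p v w 1 1] by simp

lemma g_diff: "u \<in> \<D> p \<Longrightarrow> v \<in> \<D> p \<Longrightarrow> w \<in> \<D> p \<Longrightarrow> g p u (v - w) = g p u v - g p u w"
  using g_lin[of u p v w 1 "-1"] by simp

lemma g_scaleR: "u \<in> \<D> p \<Longrightarrow> v \<in> \<D> p \<Longrightarrow> g p u (c *\<^sub>R v) = c * g p u v"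
  using g_lin[of u p v v c 0] by simp

lemma g_zero: "u \<in> \<D> p \<Longrightarrow> g p u 0 = 0" "u \<in> \<D> p \<Longrightarrow> g p 0 u = 0"
  using g_scaleR[of u p u 0] g_facts(2)[of u p 0] subspace_0[OF subspace_dist] by auto

lemma g_sum: "u \<in> \<D> p \<Longrightarrow> (\<And>i. i \<in> I \<Longrightarrow> v i \<in> \<D> p) \<Longrightarrow> g p u (\<Sum>i\<in>I. v i) = (\<Sum>i\<in>I. g p u (v i))"
  by (induction I rule: infinite_finite_induct)
    (auto simp: g_zero g_add subspace_sum[OF subspace_dist])

lemma g_eq_0_iff: "u \<in> \<D> p \<Longrightarrow> g p u u = 0 \<longleftrightarrow> u = 0"
  using g_facts(3)[of u p] g_zero[of u p] by force

lemma g_eqI: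
  assumes "u \<in> \<D> p" "v \<in> \<D> p" "\<And>w. w \<in> \<D> p \<Longrightarrow> g p w u = g p w v"
  shows "u = v"
proof -
  have "u - v \<in> \<D> p" by (rule subspace_diff[OF subspace_dist assms(1,2)])
  then show ?thesis using g_eq_0_iff[of "u - v" p] g_diff[of "u - v" p u v] assms by simp
qed

lemma G_C_infty: "X \<in> \<Gamma> \<Longrightarrow> Y \<in> \<Gamma> \<Longrightarrow> G X Y \<in> C_infty A"
  using metric by (simp add: sub_metric_def)

lemma G_swap: "X \<in> \<Gamma> \<Longrightarrow> Y \<in> \<Gamma> \<Longrightarrow> G X Y = G Y X"
  using g_facts(2)[OF section_dist section_dist] by (auto simp: ev2_def fun_eq_iff)

lemma G_add_right: "X \<in> \<Gamma> \<Longrightarrow> Y \<in> \<Gamma> \<Longrightarrow> Z \<in> \<Gamma> \<Longrightarrow> G X (Y + Z) = G X Y + G X Z"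
  by (simp add: ev2_def fun_eq_iff g_add section_dist)

lemma G_fmult_right: "X \<in> \<Gamma> \<Longrightarrow> Y \<in> \<Gamma> \<Longrightarrow> G X (fmult f Y) = f * G X Y"
  by (simp add: ev2_def fun_eq_iff fmult_apply g_scaleR section_dist)

lemma G_add_left: "X \<in> \<Gamma> \<Longrightarrow> Y \<in> \<Gamma> \<Longrightarrow> Z \<in> \<Gamma> \<Longrightarrow> G (X + Y) Z = G X Z + G Y Z"
  by (simp add: G_swap[of _ Z] section_add G_add_right)

lemma G_fmult_left: "X \<in> \<Gamma> \<Longrightarrow> Y \<in> \<Gamma> \<Longrightarrow> f \<in> C_infty A \<Longrightarrow> G (fmult f X) Y = f * G X Y"
  by (simp add: G_swap[of _ Y] section_fmult G_fmult_right)

section \<open>Orthonormal frames of the distribution\<close>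

lemma orthonormal_independent:
  assumes "finite I" "\<And>i. i \<in> I \<Longrightarrow> f i \<in> \<D> p"
    and "\<And>i j. i \<in> I \<Longrightarrow> j \<in> I \<Longrightarrow> g p (f i) (f j) = (if i = j then 1 else 0)"
  shows "inj_on f I" "independent (f ` I)"
proof -
  show inj: "inj_on f I"
  proof (rule inj_onI)
    fix i j assume "i \<in> I" "j \<in> I" "f i = f j"
    then show "i = j" using assms(3)[of i j] assms(3)[of i i] by (auto split: if_splits)
  qed
  show "independent (f ` I)"
  proof
    assume "dependent (f ` I)"
    then obtain u v where v: "v \<in> f ` I" "u v \<noteq> 0" and z: "(\<Sum>y\<in>f ` I. u y *\<^sub>R y) = 0"
      using dependent_finite[of "f ` I"] assms(1) by auto
    from v obtain k where k: "k \<in> I" "v = f k" by auto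
    have "(\<Sum>i\<in>I. u (f i) *\<^sub>R f i) = 0" using z by (simp only: sum.reindex[OF inj] o_def)
    then have "0 = g p (f k) (\<Sum>i\<in>I. u (f i) *\<^sub>R f i)" using g_zero(1)[OF assms(2)[OF k(1)]] by (simp only:)
    also have "\<dots> = (\<Sum>i\<in>I. u (f i) * g p (f k) (f i))"
      using assms(2) k by (subst g_sum) (auto simp: g_scaleR subspace_scale[OF subspace_dist])
    also have "\<dots> = (\<Sum>i\<in>I. if i = k then u (f i) else 0)"
      by (rule sum.cong[OF refl]) (use assms(3) k in auto)
    also have "\<dots> = u (f k)" by (simp only: sum.delta[OF assms(1)] k(1) if_True)
    finally have "0 = u (f k)" .
    with v(2) k(2) show False by simp
  qed
qed

text \<open>The tangent space is the distribution plus the line of \<xi>; if \<open>S\<close>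
  spanned the distribution, \<open>card S + 1\<close> vectors would span the tangent space.\<close>

lemma dist_not_spanned:
  assumes "finite S" "card S + 1 < DIM('e)"
  obtains v where "v \<in> \<D> p" "v \<notin> span S"
proof (rule ccontr)
  assume "\<not> thesis"
  then have sub: "\<D> p \<subseteq> span S" using that by blast
  obtain B where B: "finite B" "card B = DIM('e)" "independent B" "span B = tangent_space A p"
    by (rule tangent_basis) (rule that)
  have "B \<subseteq> span (insert (\<xi> p) S)"
  proof
    fix v assume "v \<in> B"
    then have v: "v \<in> tangent_space A p" using B(4) span_base by blast
    note xi = vector_field_tangent[OF Reeb_vf, of p]
    have "v - \<theta> p v *\<^sub>R \<xi> p \<in> \<D> p"
      using theta_lin[OF v xi, of 1 "- \<theta> p v"] theta_Reeb v xi
      by (simp add: dist_at_def subspace_diff subspace_scale subspace_tangent_space)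
    then have "v - \<theta> p v *\<^sub>R \<xi> p \<in> span S" using sub by blast
    then show "v \<in> span (insert (\<xi> p) S)" by (auto simp: span_breakdown_eq)
  qed
  then have "card B \<le> card (insert (\<xi> p) S)"
    using independent_span_bound[of "insert (\<xi> p) S" B] assms(1) B(3) by simp
  also have "\<dots> \<le> card S + 1" using card_insert_le_m1[of "card S + 1" S "\<xi> p"] assms(1) by (simp add: card_insert_if)
  finally show False using assms(2) B(2) by simp
qed

text \<open>An orthonormal family of horizontal vectors stays independent after \<xi> is adjoined,
  and this accounts for the additional 1.\<close>

lemma orthonormal_card:
  assumes "finite I" "\<And>i. i \<in> I \<Longrightarrow> f i \<in> \<D> p"
    and "\<And>i j. i \<in> I \<Longrightarrow> j \<in> I \<Longrightarrow> g p (f i) (f j) = (if i = j then 1 else 0)"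
  shows "card I + 1 \<le> DIM('e)"
proof -
  note o = orthonormal_independent[of I f p, OF assms]
  obtain B where B: "finite B" "card B = DIM('e)" "independent B" "span B = tangent_space A p"
    by (rule tangent_basis) (rule that)
  have "span (f ` I) \<subseteq> \<D> p" by (rule span_minimal[OF _ subspace_dist]) (use assms(2) in auto)
  moreover have "\<xi> p \<notin> \<D> p" using theta_Reeb by (simp add: dist_at_def)
  ultimately have n: "\<xi> p \<notin> span (f ` I)" by blast
  then have 1: "independent (insert (\<xi> p) (f ` I))" using o(2) by (simp add: independent_insert)
  have 2: "insert (\<xi> p) (f ` I) \<subseteq> span B"
    unfolding B(4) using vector_field_tangent[OF Reeb_vf] dist_tangent[OF assms(2)] by blast
  have 3: "card (insert (\<xi> p) (f ` I)) \<le> DIM('e)"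
    unfolding B(2)[symmetric] by (rule conjunct2[OF independent_span_bound[OF B(1) 1 2]])
  have 4: "\<xi> p \<notin> f ` I" using n span_superset[of "f ` I"] by (rule contra_subsetD[rotated])
  show ?thesis
    using 3 card_image[OF o(1)] unfolding card_insert_disjoint[OF finite_imageI[OF assms(1)] 4] by simp
qed

text \<open>A nonzero remainder, once normalised, would enlarge the family by one vector and
  contradict \<open>orthonormal_card\<close>.\<close>

lemma orthonormal_expansion:
  assumes I: "finite I" "card I + 1 = DIM('e)" and f: "\<And>i. i \<in> I \<Longrightarrow> f i \<in> \<D> p"
    and on: "\<And>i j. i \<in> I \<Longrightarrow> j \<in> I \<Longrightarrow> g p (f i) (f j) = (if i = j then 1 else 0)"
    and v: "v \<in> \<D> p"
  shows "v = (\<Sum>i\<in>I. g p v (f i) *\<^sub>R f i)"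
proof (rule ccontr)
  assume ne: "v \<noteq> (\<Sum>i\<in>I. g p v (f i) *\<^sub>R f i)"
  define w where "w = v - (\<Sum>i\<in>I. g p v (f i) *\<^sub>R f i)"
  have s: "(\<Sum>i\<in>I. g p v (f i) *\<^sub>R f i) \<in> \<D> p"
    by (intro subspace_sum[OF subspace_dist] subspace_scale[OF subspace_dist] f)
  have w: "w \<in> \<D> p" "w \<noteq> 0" unfolding w_def using subspace_diff[OF subspace_dist v s] ne by auto
  have wf: "g p w (f k) = 0" if k: "k \<in> I" for k
  proof -
    have "g p (f k) (\<Sum>i\<in>I. g p v (f i) *\<^sub>R f i) = (\<Sum>i\<in>I. g p v (f i) * g p (f k) (f i))"
      using f k by (subst g_sum) (auto simp: g_scaleR subspace_scale[OF subspace_dist])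
    also have "\<dots> = (\<Sum>i\<in>I. if i = k then g p v (f i) else 0)"
      by (rule sum.cong[OF refl]) (use on k in auto)
    also have "\<dots> = g p (f k) v" using k I(1) g_facts(2)[OF v f[OF k]] by simp
    finally have "g p (f k) w = 0" unfolding w_def using g_diff[OF f[OF k] v s] by simp
    then show ?thesis using g_facts(2)[OF w(1) f[OF k]] by simp
  qed
  define r where "r = 1 / sqrt (g p w w)"
  have pos: "g p w w > 0" by (rule g_facts(3)[OF w])
  have rw: "r *\<^sub>R w \<in> \<D> p" by (rule subspace_scale[OF subspace_dist w(1)])
  have "g p (r *\<^sub>R w) (r *\<^sub>R w) = r * (r * g p w w)"
    using g_scaleR[OF rw w(1), of r] g_facts(2)[OF rw w(1)] g_scaleR[OF w(1) w(1), of r] by simp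
  also have "\<dots> = 1" using pos by (simp add: r_def field_simps)
  finally have rr: "g p (r *\<^sub>R w) (r *\<^sub>R w) = 1" .
  have rf: "g p (r *\<^sub>R w) (f k) = 0" "g p (f k) (r *\<^sub>R w) = 0" if "k \<in> I" for k
    using g_scaleR[OF f[OF that] w(1), of r] g_facts(2)[OF w(1) f[OF that]] g_facts(2)[OF rw f[OF that]] wf[OF that] by auto
  \<comment> \<open>The option type supplies one further index, which the index type itself may not
    have.\<close>
  have "card (insert None (Some ` I)) + 1 \<le> DIM('e)"
    by (rule orthonormal_card[where f = "\<lambda>i. case i of None \<Rightarrow> r *\<^sub>R w | Some k \<Rightarrow> f k" and p = p])
      (use I(1) rw f rr rf on in \<open>auto split: if_splits\<close>)
  moreover have "card (insert None (Some ` I)) = card I + 1"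
    using I(1) by (subst card_insert_disjoint) (auto simp: card_image)
  ultimately show False using I(2) by simp
qed

text \<open>Gram-Schmidt with functions as coefficients. The fields are global sections but
  orthonormal only on \<open>W\<close>, which shrinks at each step to a region where the new field
  has no zero and can be normalised.\<close>

lemma orthonormal_frame:
  assumes "finite I" "card I + 1 \<le> DIM('e)"
  shows "\<exists>F W. open W \<and> p \<in> W \<and> (\<forall>i\<in>I. F i \<in> \<Gamma>) \<and>
    (\<forall>q\<in>W. \<forall>i\<in>I. \<forall>j\<in>I. g q (F i q) (F j q) = (if i = j then 1 else 0))"
  using assms
proof (induction I rule: finite_induct)
  case empty
  show ?case by (rule exI, rule exI[of _ UNIV]) auto
next
  case (insert k I)
  have "card I + 1 \<le> DIM('e)" using insert.prems insert.hyps by simp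
  from insert.IH[OF this] obtain F W where FW: "open W \<and> p \<in> W \<and> (\<forall>i\<in>I. F i \<in> \<Gamma>) \<and>
    (\<forall>q\<in>W. \<forall>i\<in>I. \<forall>j\<in>I. g q (F i q) (F j q) = (if i = j then 1 else 0))"
    by (elim exE) (rule that)
  then have W: "open W" "p \<in> W" and F: "\<And>i. i \<in> I \<Longrightarrow> F i \<in> \<Gamma>" by blast+
  have on: "g q (F i q) (F j q) = (if i = j then 1 else 0)" if "q \<in> W" "i \<in> I" "j \<in> I" for q i j
    by (rule FW[THEN conjunct2, THEN conjunct2, THEN conjunct2, rule_format, OF that])
  have "card ((\<lambda>i. F i p) ` I) \<le> card I" using insert.hyps(1) by (rule card_image_le)
  then have "card ((\<lambda>i. F i p) ` I) + 1 < DIM('e)" using insert.prems insert.hyps by simp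
  then obtain v where v: "v \<in> \<D> p" "v \<notin> span ((\<lambda>i. F i p) ` I)"
    using dist_not_spanned[of "(\<lambda>i. F i p) ` I" p] insert.hyps(1) by blast
  obtain X where X: "X \<in> \<Gamma>" "X p = v" by (rule dist_extension[OF v(1)]) (rule that)
  define Y where "Y = X - (\<Sum>i\<in>I. fmult (G X (F i)) (F i))"
  have s: "(\<Sum>i\<in>I. fmult (G X (F i)) (F i)) \<in> \<Gamma>" by (intro section_sum section_fmult G_C_infty X F)
  have Y: "Y \<in> \<Gamma>" unfolding Y_def by (rule section_diff[OF X(1) s])
  have "(\<Sum>i\<in>I. fmult (G X (F i)) (F i)) p \<in> span ((\<lambda>i. F i p) ` I)"
    unfolding sum_fun_apply[of "\<lambda>i. fmult (G X (F i)) (F i)"] fmult_apply by (intro span_sum span_scale span_base) auto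
  then have "Y p \<noteq> 0" using v(2) X(2) by (auto simp: Y_def)
  then have "G Y Y p > 0" using g_facts(3)[OF section_dist[OF Y]] by (simp add: ev2_def)
  then obtain h W' where h: "h \<in> C_infty A" and W': "open W'" "p \<in> W'"
    "\<And>q. q \<in> W' \<Longrightarrow> G Y Y q > 0 \<and> h q = G Y Y q powr (- 1 / 2)"
    using C_infty_powr[OF G_C_infty[OF Y Y], of p "- 1 / 2"] by metis
  define F' where "F' = F(k := fmult h Y)"
  have YF: "g q (F i q) (Y q) = 0" if q: "q \<in> W" and i: "i \<in> I" for q i
  proof -
    have "g q (F i q) ((\<Sum>j\<in>I. fmult (G X (F j)) (F j)) q) = (\<Sum>j\<in>I. G X (F j) q * g q (F i q) (F j q))"
      unfolding sum_fun_apply[of "\<lambda>i. fmult (G X (F i)) (F i)"] fmult_apply using F i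
      by (subst g_sum) (auto simp: g_scaleR section_dist subspace_scale[OF subspace_dist])
    also have "\<dots> = (\<Sum>j\<in>I. if j = i then G X (F j) q else 0)"
      by (rule sum.cong[OF refl]) (use on q i in auto)
    also have "\<dots> = g q (F i q) (X q)"
      using i insert.hyps(1) g_facts(2)[OF section_dist[OF X(1)] section_dist[OF F[OF i]]] by (simp add: ev2_def)
    finally show ?thesis
      using g_diff[OF section_dist[OF F[OF i]] section_dist[OF X(1)] section_dist[OF s], of q] by (simp add: Y_def)
  qed
  have hY: "g q (h q *\<^sub>R Y q) (h q *\<^sub>R Y q) = 1" if q: "q \<in> W'" for q
  proof -
    note Yq = section_dist[OF Y, of q]
    have hYq: "h q *\<^sub>R Y q \<in> \<D> q" by (rule subspace_scale[OF subspace_dist Yq])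
    have "g q (h q *\<^sub>R Y q) (h q *\<^sub>R Y q) = h q * (h q * g q (Y q) (Y q))"
      using g_scaleR[OF hYq Yq, of "h q"] g_facts(2)[OF hYq Yq] g_scaleR[OF Yq Yq, of "h q"] by simp
    also have "\<dots> = (h q * h q) * G Y Y q" by (simp add: ev2_def)
    also have "h q * h q = G Y Y q powr (- 1)" using W'(3)[OF q] by (simp flip: powr_add)
    also have "G Y Y q powr (- 1) * G Y Y q = 1" using W'(3)[OF q] by (simp add: powr_minus)
    finally show ?thesis .
  qed
  show ?case
  proof (rule exI[of _ F'], rule exI[of _ "W \<inter> W'"], intro conjI ballI)
    show "F' i \<in> \<Gamma>" if "i \<in> insert k I" for i
      using that F section_fmult[OF h Y] by (auto simp: F'_def)
    fix q i j assume q: "q \<in> W \<inter> W'" and ij: "i \<in> insert k I" "j \<in> insert k I"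
    have *: "g q (F l q) (h q *\<^sub>R Y q) = 0" "g q (h q *\<^sub>R Y q) (F l q) = 0" if "l \<in> I" for l
    proof -
      note d = section_dist[OF F[OF that], of q] section_dist[OF Y, of q]
      show 1: "g q (F l q) (h q *\<^sub>R Y q) = 0" using g_scaleR[OF d] YF[OF _ that] q by simp
      show "g q (h q *\<^sub>R Y q) (F l q) = 0"
        using 1 g_facts(2)[OF d(1) subspace_scale[OF subspace_dist d(2)]] by simp
    qed
    show "g q (F' i q) (F' j q) = (if i = j then 1 else 0)"
      using q ij insert.hyps(2) * hY[of q] on[of q i j] by (auto simp: F'_def fmult_apply)
  qed (use W W' in auto)
qed

definition frame :: "'i set \<Rightarrow> ('i \<Rightarrow> 'a vfield) \<Rightarrow> 'a set \<Rightarrow> bool" where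
  "frame I F W \<longleftrightarrow> finite I \<and> card I + 1 = DIM('e) \<and> open W \<and> (\<forall>i\<in>I. F i \<in> \<Gamma>) \<and>
    (\<forall>q\<in>W. \<forall>i\<in>I. \<forall>j\<in>I. g q (F i q) (F j q) = (if i = j then 1 else 0))"

lemma frame_exists:
  assumes "finite I" "card I + 1 = DIM('e)"
  obtains F W where "frame I F W" "p \<in> W"
  using orthonormal_frame[OF assms(1), of p] assms unfolding frame_def by auto

lemma frame_expansion:
  assumes "frame I F W" "q \<in> W" "v \<in> \<D> q"
  shows "v = (\<Sum>i\<in>I. g q v (F i q) *\<^sub>R F i q)"
  by (rule orthonormal_expansion) (use assms section_dist in \<open>auto simp: frame_def\<close>)

text \<open>Leaving out one basis vector gives an index set of the size of the dimension of the
  distribution. Since the indices are themselves basis vectors, they can double as coordinate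
  directions.\<close>

lemma frame_at: obtains I :: "'e set" and F W where "frame I F W" "p \<in> W" "I \<subseteq> Basis"
proof -
  obtain b :: 'e where b: "b \<in> Basis" using nonempty_Basis by blast
  have "card (Basis - {b}) + 1 = DIM('e)" using b by (simp add: card_Diff_singleton DIM_positive Suc_leI)
  then show ?thesis using frame_exists[of "Basis - {b}" p] that by (metis Diff_subset finite_Diff finite_Basis)
qed

text \<open>Near \<open>p\<close> a section is a combination of frame fields with smooth
  coefficients, and \<open>T\<close> sees only the values of these coefficients at \<open>p\<close>.
  Locality is a separate hypothesis because the expansion holds only near \<open>p\<close>.\<close>

lemma tensorial:
  fixes T :: "'a vfield \<Rightarrow> real"
  assumes add: "\<And>X Y. X \<in> \<Gamma> \<Longrightarrow> Y \<in> \<Gamma> \<Longrightarrow> T (X + Y) = T X + T Y"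
    and mult: "\<And>f X. f \<in> C_infty A \<Longrightarrow> X \<in> \<Gamma> \<Longrightarrow> T (fmult f X) = f p * T X"
    and loc: "\<And>X Y W. X \<in> \<Gamma> \<Longrightarrow> Y \<in> \<Gamma> \<Longrightarrow> open W \<Longrightarrow> p \<in> W \<Longrightarrow> (\<And>q. q \<in> W \<Longrightarrow> X q = Y q) \<Longrightarrow> T X = T Y"
    and X: "X \<in> \<Gamma>" "Y \<in> \<Gamma>" "X p = Y p"
  shows "T X = T Y"
proof -
  obtain I :: "'e set" and F W where F: "frame I F W" "p \<in> W" "I \<subseteq> Basis" by (rule frame_at) (rule that)
  have FI: "F i \<in> \<Gamma>" if "i \<in> I" for i using F(1) that by (simp add: frame_def)
  have oW: "open W" using F(1) by (simp add: frame_def)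
  have T0: "T 0 = 0" using add[OF section_0 section_0] by simp
  have T_sum: "T (\<Sum>i\<in>J. Z i) = (\<Sum>i\<in>J. T (Z i))" if "\<And>i. i \<in> J \<Longrightarrow> Z i \<in> \<Gamma>" for J :: "'e set" and Z
    using that by (induction J rule: infinite_finite_induct) (auto simp: T0 add section_sum)
  have exp: "T X = (\<Sum>i\<in>I. g p (X p) (F i p) * T (F i))" if X: "X \<in> \<Gamma>" for X
  proof -
    have s: "(\<Sum>i\<in>I. fmult (G X (F i)) (F i)) \<in> \<Gamma>"
      by (intro section_sum section_fmult G_C_infty X FI)
    have "X q = (\<Sum>i\<in>I. fmult (G X (F i)) (F i)) q" if "q \<in> W" for q
      unfolding sum_fun_apply[of "\<lambda>i. fmult (G X (F i)) (F i)"] unfolding fmult_apply ev2_def by (rule frame_expansion[OF F(1) that section_dist[OF X]])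
    then have "T X = T (\<Sum>i\<in>I. fmult (G X (F i)) (F i))"
      by (rule loc[OF X s oW F(2)])
    also have "\<dots> = (\<Sum>i\<in>I. g p (X p) (F i p) * T (F i))"
      by (simp add: T_sum section_fmult G_C_infty X FI mult) (simp add: ev2_def)
    finally show ?thesis .
  qed
  show ?thesis using exp[OF X(1)] exp[OF X(2)] X(3) by simp
qed

lemma omega_tensorial_right:
  assumes "X \<in> \<Gamma>" "Y \<in> \<Gamma>" "Y' \<in> \<Gamma>" "Y p = Y' p"
  shows "\<omega> X Y p = \<omega> X Y' p"
proof (rule tensorial[of "\<lambda>Y. \<omega> X Y p" p Y Y'])
  show "\<omega> X Z p = \<omega> X Z' p" if "Z \<in> \<Gamma>" "Z' \<in> \<Gamma>" "open W" "p \<in> W" "\<And>q. q \<in> W \<Longrightarrow> Z q = Z' q" for Z Z' W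
    by (rule omega_local[OF assms(1) that])
qed (simp_all add: assms omega_add_right omega_fmult_right)

lemma omega_tensorial:
  assumes "X \<in> \<Gamma>" "Y \<in> \<Gamma>" "X' \<in> \<Gamma>" "Y' \<in> \<Gamma>" "X p = X' p" "Y p = Y' p"
  shows "\<omega> X Y p = \<omega> X' Y' p"
  using omega_tensorial_right[OF assms(1,2,4,6)] omega_tensorial_right[OF assms(4,1,3,5)]
    omega_swap[OF assms(4,1)] omega_swap[OF assms(4,3)] by simp

end

section \<open>The curvature of the Schouten connection\<close>

context contact_sR
begin

lemma app_uminus:
  assumes "X \<in> vector_fields A" "f \<in> C_infty A"
  shows "app X (- f) = - app X f"
  using app_right(1)[OF assms C_infty_uminus[OF assms(2)]] app_0[OF assms(1)] by (simp add: eq_neg_iff_add_eq_0 add.commute)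

lemma ev_theta_add:
  assumes "X \<in> vector_fields A" "Y \<in> vector_fields A"
  shows "ev \<theta> (X + Y) = ev \<theta> X + ev \<theta> Y"
  using theta_add[OF vector_field_tangent[OF assms(1)] vector_field_tangent[OF assms(2)]]
  by (simp add: ev_def fun_eq_iff)

section \<open>Lie derivatives along the Reeb field\<close>

text \<open>The Lie derivative of \<omega> along \<xi> is 0: apply \<theta> to the Jacobi identity
  for \<xi>, \<open>Z\<close>, \<open>W\<close>, and use \<theta>([\<xi>,V]) = \<xi>(\<theta>(V))
  for V = [Z,W].\<close>

lemma omega_Reeb:
  assumes Z: "Z \<in> \<Gamma>" and W: "W \<in> \<Gamma>"
  shows "app \<xi> (\<omega> Z W) = \<omega> (bracket \<xi> Z) W + \<omega> Z (bracket \<xi> W)"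
proof -
  note v = Reeb_vf section_vf[OF Z] section_vf[OF W]
  note b = bracket_vector_field[OF v(1,2)] bracket_vector_field[OF v(1,3)] bracket_vector_field[OF v(2,3)]
  have "bracket W (bracket \<xi> Z) = - bracket (bracket \<xi> Z) W" by (rule bracket_swap)
  moreover have "bracket Z (bracket W \<xi>) = - bracket Z (bracket \<xi> W)"
  proof -
    have "bracket W \<xi> + bracket \<xi> W = 0" unfolding bracket_swap[of W \<xi>] by simp
    moreover have "bracket Z 0 = 0" using bracket_add[OF v(2) vector_field_0 vector_field_0] by simp
    ultimately have "bracket Z (bracket W \<xi>) + bracket Z (bracket \<xi> W) = 0"
      using bracket_add[OF v(2) bracket_vector_field[OF v(3,1)] b(2)] by simp
    then show ?thesis by (simp only: eq_neg_iff_add_eq_0)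
  qed
  ultimately have "bracket \<xi> (bracket Z W) + - bracket Z (bracket \<xi> W) + - bracket (bracket \<xi> Z) W = 0"
    using Jacobi[OF v] by (simp only:)
  moreover have "x = (x + - y + - z) + (z + y)" for x y z :: "'a vfield" by simp
  ultimately have "bracket \<xi> (bracket Z W) = bracket (bracket \<xi> Z) W + bracket Z (bracket \<xi> W)"
    by (metis add_0)
  then have "ev \<theta> (bracket \<xi> (bracket Z W)) = ev \<theta> (bracket (bracket \<xi> Z) W) + ev \<theta> (bracket Z (bracket \<xi> W))"
    using ev_theta_add[OF bracket_vector_field[OF b(1) v(3)] bracket_vector_field[OF v(2) b(2)]] by simp
  then show ?thesis
    using theta_Reeb_bracket[OF b(3)] app_uminus[OF v(1) theta_C_infty[OF b(3)]]
    by (simp add: omega_eq Z W Reeb_bracket_section)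
qed

text \<open>Twice the sub-torsion; the factor 1/2 is left out because this is the expression that
  the curvature identity produces.\<close>

definition Lie_metric :: "'a vfield \<Rightarrow> 'a vfield \<Rightarrow> 'a \<Rightarrow> real" where
  "Lie_metric X Y = app \<xi> (G X Y) - G (bracket \<xi> X) Y - G X (bracket \<xi> Y)"

lemma Lie_metric_swap: "X \<in> \<Gamma> \<Longrightarrow> Y \<in> \<Gamma> \<Longrightarrow> Lie_metric X Y = Lie_metric Y X"
  by (simp add: Lie_metric_def G_swap[of X Y] G_swap[of "bracket \<xi> X" Y] G_swap[of X "bracket \<xi> Y"] Reeb_bracket_section)

text \<open>For a multiple by \<open>f\<close>, the derivative of \<open>f\<close> along \<xi>
  appears once from differentiating the product and once from the bracket, with opposite
  signs.\<close>

lemma Lie_metric_tensorial_right: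
  assumes "X \<in> \<Gamma>" "Y \<in> \<Gamma>" "Y' \<in> \<Gamma>" "Y p = Y' p"
  shows "Lie_metric X Y p = Lie_metric X Y' p"
proof (rule tensorial[of "\<lambda>Y. Lie_metric X Y p" p Y Y'])
  note X = assms(1)
  show "Lie_metric X (Z + Z') p = Lie_metric X Z p + Lie_metric X Z' p" if "Z \<in> \<Gamma>" "Z' \<in> \<Gamma>" for Z Z'
    by (simp add: Lie_metric_def G_add_right X that Reeb_bracket_section bracket_add Reeb_vf section_vf app_right G_C_infty)
  show "Lie_metric X (fmult f Z) p = f p * Lie_metric X Z p" if "f \<in> C_infty A" "Z \<in> \<Gamma>" for f Z
  proof -
    have "bracket \<xi> (fmult f Z) = fmult (app \<xi> f) Z + fmult f (bracket \<xi> Z)"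
      by (intro bracket_fmult Reeb_vf section_vf that)
    then show ?thesis
      by (simp add: Lie_metric_def G_fmult_right G_add_right X that Reeb_bracket_section Reeb_vf app_right G_C_infty
          section_fmult app_C_infty algebra_simps)
  qed
  show "Lie_metric X Z p = Lie_metric X Z' p" if "Z \<in> \<Gamma>" "Z' \<in> \<Gamma>" "open W" "p \<in> W" "\<And>q. q \<in> W \<Longrightarrow> Z q = Z' q" for Z Z' W
  proof -
    have "\<xi> p (G X Z) = \<xi> p (G X Z')"
      by (rule tangent_local[OF vector_field_tangent[OF Reeb_vf] G_C_infty[OF X that(1)] G_C_infty[OF X that(2)] that(3,4)])
        (simp add: ev2_def that(5))
    moreover have "bracket \<xi> Z p = bracket \<xi> Z' p"
      by (rule bracket_local[OF Reeb_vf section_vf[OF that(1)] section_vf[OF that(2)] that(3,4,5)])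
    ultimately show ?thesis using that(4,5) by (simp add: Lie_metric_def app_def ev2_def)
  qed
qed (use assms in auto)

lemma Lie_metric_tensorial:
  assumes "X \<in> \<Gamma>" "Y \<in> \<Gamma>" "X' \<in> \<Gamma>" "Y' \<in> \<Gamma>" "X p = X' p" "Y p = Y' p"
  shows "Lie_metric X Y p = Lie_metric X' Y' p"
  using Lie_metric_tensorial_right[OF assms(1,2,4,6)] Lie_metric_tensorial_right[OF assms(4,1,3,5)]
    Lie_metric_swap[OF assms(4,1)] Lie_metric_swap[OF assms(4,3)] by simp

lemma sub_torsion_eq: "sub_torsion \<xi> g X Y = (1 / 2) *\<^sub>R Lie_metric X Y"
  by (simp add: sub_torsion_def Lie_metric_def)

section \<open>The endomorphism that represents d\<theta>\<close>

text \<open>The coefficients in a local orthonormal frame are inner products with sections, so their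
  smoothness gives that of \<open>X\<close>.\<close>

lemma smooth_sectionI:
  assumes X: "\<And>p. X p \<in> \<D> p" and G: "\<And>Y. Y \<in> \<Gamma> \<Longrightarrow> (\<lambda>p. g p (X p) (Y p)) \<in> C_infty A"
  shows "X \<in> \<Gamma>"
proof (rule sectionI'[OF vector_field_local X])
  show "X p \<in> tangent_space A p" for p by (rule dist_tangent[OF X])
  fix p
  obtain I :: "'e set" and F W where F: "frame I F W" "p \<in> W" "I \<subseteq> Basis" by (rule frame_at) (rule that)
  have FI: "F i \<in> \<Gamma>" if "i \<in> I" for i using F(1) that by (simp add: frame_def)
  let ?X = "\<Sum>i\<in>I. fmult (\<lambda>p. g p (X p) (F i p)) (F i)"
  have "?X \<in> \<Gamma>" by (intro section_sum section_fmult G FI)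
  moreover have "X q = ?X q" if "q \<in> W" for q
    unfolding sum_fun_apply[of "\<lambda>i. fmult (\<lambda>p. g p (X p) (F i p)) (F i)"] unfolding fmult_apply
    by (rule frame_expansion[OF F(1) that X])
  moreover have "open W" using F(1) by (simp add: frame_def)
  ultimately show "\<exists>W X'. open W \<and> p \<in> W \<and> X' \<in> vector_fields A \<and> (\<forall>q\<in>W. X q = X' q)"
    using F(2) section_vf by blast
qed

text \<open>\<omega> acts on sections, so the representing vector is characterised through all
  sections with value \<open>v\<close> at \<open>p\<close>; tensoriality makes the choice among them
  irrelevant.\<close>

lemma Riesz:
  assumes "v \<in> \<D> p"
  shows "\<exists>u\<in>\<D> p. \<forall>X\<in>\<Gamma>. \<forall>Y\<in>\<Gamma>. X p = v \<longrightarrow> g p u (Y p) = \<omega> X Y p"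
proof -
  obtain X0 where X0: "X0 \<in> \<Gamma>" "X0 p = v" by (rule dist_extension[OF assms]) (rule that)
  obtain I :: "'e set" and F W where F: "frame I F W" "p \<in> W" "I \<subseteq> Basis" by (rule frame_at) (rule that)
  have FI: "F i \<in> \<Gamma>" if "i \<in> I" for i using F(1) that by (simp add: frame_def)
  define u where "u = (\<Sum>i\<in>I. \<omega> X0 (F i) p *\<^sub>R F i p)"
  have u: "u \<in> \<D> p"
    unfolding u_def by (intro subspace_sum[OF subspace_dist] subspace_scale[OF subspace_dist] section_dist FI)
  have "g p u (Y p) = \<omega> X Y p" if X: "X \<in> \<Gamma>" and Y: "Y \<in> \<Gamma>" and "X p = v" for X Y
  proof -
    \<comment> \<open>A combination of frame fields with constant coefficients and the same value as
      \<open>Y\<close> at \<open>p\<close>, so that \<omega> can be expanded by linearity.\<close>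
    define Y' where "Y' = (\<Sum>i\<in>I. fmult (\<lambda>_. g p (Y p) (F i p)) (F i))"
    have Y': "Y' \<in> \<Gamma>" unfolding Y'_def by (intro section_sum section_fmult C_infty_const FI)
    have "Y p = Y' p"
      unfolding Y'_def sum_fun_apply[of "\<lambda>i. fmult (\<lambda>_. g p (Y p) (F i p)) (F i)"] unfolding fmult_apply
      by (rule frame_expansion[OF F(1,2) section_dist[OF Y]])
    then have "\<omega> X Y p = \<omega> X0 Y' p"
      using omega_tensorial[OF X Y X0(1) Y'] X0(2) \<open>X p = v\<close> by simp
    also have "\<omega> X0 Y' = (\<Sum>i\<in>I. \<omega> X0 (fmult (\<lambda>_. g p (Y p) (F i p)) (F i)))"
    proof -
      have "\<omega> X0 0 = 0" using omega_add_right[OF X0(1) section_0 section_0] by simp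
      then have "\<omega> X0 (\<Sum>i\<in>J. Z i) = (\<Sum>i\<in>J. \<omega> X0 (Z i))" if "\<And>i. i \<in> J \<Longrightarrow> Z i \<in> \<Gamma>" for J :: "'e set" and Z
        using that by (induction J rule: infinite_finite_induct) (simp_all add: omega_add_right X0(1) section_sum)
      then show ?thesis unfolding Y'_def by (simp add: section_fmult C_infty_const FI)
    qed
    also have "\<dots> p = (\<Sum>i\<in>I. g p (Y p) (F i p) * \<omega> X0 (F i) p)"
      by (simp add: sum_fun_apply omega_fmult_right X0(1) FI C_infty_const)
    also have "\<dots> = (\<Sum>i\<in>I. g p (Y p) (\<omega> X0 (F i) p *\<^sub>R F i p))"
      by (simp add: g_scaleR section_dist Y FI mult.commute)
    also have "\<dots> = g p (Y p) u"
      unfolding u_def by (rule g_sum[symmetric]) (use Y FI section_dist subspace_scale[OF subspace_dist] in auto)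
    also have "\<dots> = g p u (Y p)" by (rule g_facts(2)[OF section_dist[OF Y] u])
    finally show ?thesis by simp
  qed
  then show ?thesis using u by blast
qed

text \<open>The endomorphism called \<open>A\<close> in the introduction; here \<open>A\<close> is the atlas.\<close>

definition rep :: "'a endo" where
  "rep p v = (SOME u. u \<in> \<D> p \<and> (\<forall>X\<in>\<Gamma>. \<forall>Y\<in>\<Gamma>. X p = v \<longrightarrow> g p u (Y p) = \<omega> X Y p))"

lemma rep_facts:
  assumes "v \<in> \<D> p"
  shows "rep p v \<in> \<D> p" "X \<in> \<Gamma> \<Longrightarrow> Y \<in> \<Gamma> \<Longrightarrow> X p = v \<Longrightarrow> g p (rep p v) (Y p) = \<omega> X Y p"
  using someI_ex[OF Riesz[OF assms, unfolded Bex_def]] unfolding rep_def by blast+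

lemma G_rep: "X \<in> \<Gamma> \<Longrightarrow> Y \<in> \<Gamma> \<Longrightarrow> G (act rep X) Y = \<omega> X Y"
  using rep_facts(2)[OF section_dist] by (auto simp: ev2_def act_def fun_eq_iff)

lemma rep_section: "X \<in> \<Gamma> \<Longrightarrow> act rep X \<in> \<Gamma>"
proof (rule smooth_sectionI)
  assume X: "X \<in> \<Gamma>"
  show "act rep X p \<in> \<D> p" for p using rep_facts(1)[OF section_dist[OF X]] by (simp add: act_def)
  show "(\<lambda>p. g p (act rep X p) (Y p)) \<in> C_infty A" if "Y \<in> \<Gamma>" for Y
    using G_rep[OF X that] omega_C_infty[OF X that] by (simp add: ev2_def)
qed

lemma rep_lin:
  assumes "u \<in> \<D> p" "v \<in> \<D> p"
  shows "rep p (a *\<^sub>R u + b *\<^sub>R v) = a *\<^sub>R rep p u + b *\<^sub>R rep p v"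
proof (rule g_eqI)
  note sc = subspace_scale[OF subspace_dist] and ad = subspace_add[OF subspace_dist]
  obtain X where X: "X \<in> \<Gamma>" "X p = u" by (rule dist_extension[OF assms(1)]) (rule that)
  obtain Y where Y: "Y \<in> \<Gamma>" "Y p = v" by (rule dist_extension[OF assms(2)]) (rule that)
  let ?Z = "fmult (\<lambda>_. a) X + fmult (\<lambda>_. b) Y"
  have Z: "?Z \<in> \<Gamma>" "?Z p = a *\<^sub>R u + b *\<^sub>R v"
    using X Y by (auto intro!: section_add section_fmult C_infty_const simp: fmult_apply)
  have d: "a *\<^sub>R u + b *\<^sub>R v \<in> \<D> p" by (intro ad sc assms)
  note r = rep_facts(1)[OF assms(1)] rep_facts(1)[OF assms(2)] rep_facts(1)[OF d]
  show "rep p (a *\<^sub>R u + b *\<^sub>R v) \<in> \<D> p" by (rule r)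
  show "a *\<^sub>R rep p u + b *\<^sub>R rep p v \<in> \<D> p" by (intro ad sc r)
  fix w assume w: "w \<in> \<D> p"
  obtain V where V: "V \<in> \<Gamma>" "V p = w" by (rule dist_extension[OF w]) (rule that)
  have "g p w (rep p (a *\<^sub>R u + b *\<^sub>R v)) = g p (rep p (a *\<^sub>R u + b *\<^sub>R v)) (V p)"
    unfolding V(2) by (rule g_facts(2)[OF w r(3)])
  also have "\<dots> = \<omega> ?Z V p" by (rule rep_facts(2)[OF d Z(1) V(1) Z(2)])
  also have "\<dots> = a * \<omega> X V p + b * \<omega> Y V p"
    using X Y V by (simp add: omega_add_left omega_fmult_left section_fmult C_infty_const)
  also have "\<dots> = a * g p w (rep p u) + b * g p w (rep p v)"
    using rep_facts(2)[OF assms(1) X(1) V(1) X(2)] rep_facts(2)[OF assms(2) Y(1) V(1) Y(2)] V(2)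
      g_facts(2)[OF w r(1)] g_facts(2)[OF w r(2)] by simp
  also have "\<dots> = g p w (a *\<^sub>R rep p u + b *\<^sub>R rep p v)" by (rule g_lin[OF w r(1,2), symmetric])
  finally show "g p w (rep p (a *\<^sub>R u + b *\<^sub>R v)) = g p w (a *\<^sub>R rep p u + b *\<^sub>R rep p v)" .
qed

lemma rep_add: "u \<in> \<D> p \<Longrightarrow> v \<in> \<D> p \<Longrightarrow> rep p (u + v) = rep p u + rep p v"
  using rep_lin[of u p v 1 1] by simp

lemma rep_scaleR: "u \<in> \<D> p \<Longrightarrow> rep p (c *\<^sub>R u) = c *\<^sub>R rep p u"
  using rep_lin[of u p u c 0] by simp

lemma G_rep_swap: "X \<in> \<Gamma> \<Longrightarrow> Y \<in> \<Gamma> \<Longrightarrow> G X (act rep Y) = - G (act rep X) Y"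
  using G_swap[of X "act rep Y"] by (simp add: rep_section G_rep omega_swap[of X Y])

end

section \<open>Rules for the Schouten connection\<close>

locale contact_Schouten = contact_sR A \<theta> g \<xi>
  for A :: "('a::{t2_space, second_countable_topology}, 'e::euclidean_space) atlas" and \<theta> g \<xi> +
  fixes D :: "'a partial_conn"
  assumes Schouten: "Schouten_connection A \<theta> g \<xi> D" and parallel: "parallel2 A \<theta> D (ext_d \<theta>)"
begin

abbreviation "nab \<equiv> cov D"

lemma
  shows D_endo: "Y \<in> \<Gamma> \<Longrightarrow> D Y \<in> endo_fields A \<theta>"
    and D_add: "Y \<in> \<Gamma> \<Longrightarrow> Z \<in> \<Gamma> \<Longrightarrow> v \<in> \<D> p \<Longrightarrow> D (Y + Z) p v = D Y p v + D Z p v"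
    and D_fmult: "f \<in> C_infty A \<Longrightarrow> Y \<in> \<Gamma> \<Longrightarrow> v \<in> \<D> p \<Longrightarrow> D (fmult f Y) p v = v f *\<^sub>R Y p + f p *\<^sub>R D Y p v"
  using Schouten unfolding Schouten_connection_def partial_connection_def fmult_def by blast+

lemma nab_section: "X \<in> \<Gamma> \<Longrightarrow> Y \<in> \<Gamma> \<Longrightarrow> nab X Y \<in> \<Gamma>"
  using D_endo[of Y] by (simp add: cov_def endo_fields_def)

lemma nab_lin_left:
  assumes "X \<in> \<Gamma>" "X' \<in> \<Gamma>" "Y \<in> \<Gamma>"
  shows "nab (X + X') Y = nab X Y + nab X' Y" "nab (fmult f X) Y = fmult f (nab X Y)"
proof -
  have lin: "D Y p (a *\<^sub>R u + b *\<^sub>R v) = a *\<^sub>R D Y p u + b *\<^sub>R D Y p v" if "u \<in> \<D> p" "v \<in> \<D> p" for a b u v p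
    using D_endo[OF assms(3)] that unfolding endo_fields_def linear_over_def by blast
  show "nab (X + X') Y = nab X Y + nab X' Y"
  proof
    fix p show "nab (X + X') Y p = (nab X Y + nab X' Y) p"
      using lin[OF section_dist[OF assms(1)] section_dist[OF assms(2)], of p 1 1] by (simp add: cov_def act_def)
  qed
  show "nab (fmult f X) Y = fmult f (nab X Y)"
  proof
    fix p show "nab (fmult f X) Y p = fmult f (nab X Y) p"
      using lin[OF section_dist[OF assms(1)] section_dist[OF assms(1)], of p "f p" 0]
      by (simp add: cov_def act_def fmult_apply)
  qed
qed

lemma nab_apply: "nab X Y p = D Y p (X p)"
  by (simp add: cov_def act_def)

lemma nab_add_right: "X \<in> \<Gamma> \<Longrightarrow> Y \<in> \<Gamma> \<Longrightarrow> Z \<in> \<Gamma> \<Longrightarrow> nab X (Y + Z) = nab X Y + nab X Z"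
proof
  fix p assume a: "X \<in> \<Gamma>" "Y \<in> \<Gamma>" "Z \<in> \<Gamma>"
  show "nab X (Y + Z) p = (nab X Y + nab X Z) p"
    by (simp only: nab_apply plus_fun_apply[of "nab X Y"] D_add[OF a(2,3) section_dist[OF a(1)]])
qed

lemma nab_diff_right: "X \<in> \<Gamma> \<Longrightarrow> Y \<in> \<Gamma> \<Longrightarrow> Z \<in> \<Gamma> \<Longrightarrow> nab X (Y - Z) = nab X Y - nab X Z"
  using nab_add_right[of X "Y - Z" Z] by (simp add: section_diff eq_diff_eq)

lemma nab_diff_left: "X \<in> \<Gamma> \<Longrightarrow> X' \<in> \<Gamma> \<Longrightarrow> Y \<in> \<Gamma> \<Longrightarrow> nab (X - X') Y = nab X Y - nab X' Y"
  using nab_lin_left(1)[of "X - X'" X' Y] by (simp add: section_diff eq_diff_eq)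

lemma nab_fmult_right:
  "X \<in> \<Gamma> \<Longrightarrow> Y \<in> \<Gamma> \<Longrightarrow> f \<in> C_infty A \<Longrightarrow> nab X (fmult f Y) = fmult (app X f) Y + fmult f (nab X Y)"
proof
  fix p assume a: "X \<in> \<Gamma>" "Y \<in> \<Gamma>" "f \<in> C_infty A"
  show "nab X (fmult f Y) p = (fmult (app X f) Y + fmult f (nab X Y)) p"
    by (subst plus_fun_apply) (simp only: nab_apply fmult_apply app_def D_fmult[OF a(3,2) section_dist[OF a(1)]])
qed

lemma nab_metric:
  assumes "X \<in> \<Gamma>" "Y \<in> \<Gamma>" "Z \<in> \<Gamma>"
  shows "app X (G Y Z) = G (nab X Y) Z + G Y (nab X Z)"
proof -
  have "cov2 D G X Y Z = 0"
    using Schouten assms unfolding Schouten_connection_def parallel2_def by blast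
  then show ?thesis by (simp add: cov2_def algebra_simps)
qed

lemma nab_omega:
  assumes "X \<in> \<Gamma>" "Y \<in> \<Gamma>" "Z \<in> \<Gamma>"
  shows "app X (\<omega> Y Z) = \<omega> (nab X Y) Z + \<omega> Y (nab X Z)"
proof -
  have "cov2 D \<omega> X Y Z = 0"
    using parallel assms unfolding parallel2_def by blast
  then show ?thesis by (simp add: cov2_def algebra_simps)
qed

lemma nab_torsion: "X \<in> \<Gamma> \<Longrightarrow> Y \<in> \<Gamma> \<Longrightarrow> nab X Y - nab Y X = pr (bracket X Y)"
  using Schouten unfolding Schouten_connection_def by blast

section \<open>The curvature and its symmetries\<close>

text \<open>The vertical part of the bracket of \<open>X\<close> and \<open>Y\<close> is
  -\<omega>(X,Y) \<xi>. Subtracting a derivative along the bracket therefore adds \<omega>(X,Y)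
  times the substitute [\<xi>,Z], whence the plus sign of the last term.\<close>

definition curv :: "'a vfield \<Rightarrow> 'a vfield \<Rightarrow> 'a vfield \<Rightarrow> 'a vfield" where
  "curv X Y Z = nab X (nab Y Z) - nab Y (nab X Z) - nab (pr (bracket X Y)) Z + fmult (\<omega> X Y) (bracket \<xi> Z)"

lemma pr_bracket_section: "X \<in> \<Gamma> \<Longrightarrow> Y \<in> \<Gamma> \<Longrightarrow> pr (bracket X Y) \<in> \<Gamma>"
  by (intro pr_section bracket_vector_field section_vf)

lemma curv_section:
  assumes "X \<in> \<Gamma>" "Y \<in> \<Gamma>" "Z \<in> \<Gamma>"
  shows "curv X Y Z \<in> \<Gamma>"
  unfolding curv_def
  by (intro section_add section_diff nab_section pr_bracket_section section_fmult omega_C_infty Reeb_bracket_section assms)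

text \<open>Together with \<open>curv_scaleR\<close> this is linearity over constants in the last
  argument. That is enough, because at a point the curvature is evaluated on combinations of frame
  fields with constant coefficients.\<close>

lemma curv_add:
  assumes "X \<in> \<Gamma>" "Y \<in> \<Gamma>" "Z \<in> \<Gamma>" "Z' \<in> \<Gamma>"
  shows "curv X Y (Z + Z') = curv X Y Z + curv X Y Z'"
proof -
  have "bracket \<xi> (Z + Z') = bracket \<xi> Z + bracket \<xi> Z'" by (intro bracket_add Reeb_vf section_vf assms)
  moreover have "fmult f (V + V') = fmult f V + fmult f V'" for f :: "'a \<Rightarrow> real" and V V' :: "'a vfield"
    by (simp add: fun_eq_iff fmult_apply scaleR_fun_apply algebra_simps)
  ultimately show ?thesis
    by (simp add: curv_def nab_add_right nab_section pr_bracket_section assms algebra_simps)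
qed

lemma curv_scaleR:
  assumes "X \<in> \<Gamma>" "Y \<in> \<Gamma>" "Z \<in> \<Gamma>"
  shows "curv X Y (fmult (\<lambda>_. c) Z) = fmult (\<lambda>_. c) (curv X Y Z)"
proof -
  have z: "fmult 0 V = 0" for V :: "'a vfield" by (simp add: fun_eq_iff fmult_apply scaleR_fun_apply)
  have "bracket \<xi> (fmult (\<lambda>_. c) Z) = fmult (\<lambda>_. c) (bracket \<xi> Z)"
    using bracket_fmult[OF Reeb_vf section_vf[OF assms(3)] C_infty_const, of c] app_const[OF Reeb_vf, of c] z by simp
  moreover have "nab V (fmult (\<lambda>_. c) V') = fmult (\<lambda>_. c) (nab V V')" if "V \<in> \<Gamma>" "V' \<in> \<Gamma>" for V V'
    using nab_fmult_right[OF that C_infty_const, of c] app_const[OF section_vf[OF that(1)], of c] z by simp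
  ultimately show ?thesis
    by (simp add: curv_def nab_section pr_bracket_section assms)
      (simp add: fun_eq_iff fmult_apply scaleR_fun_apply algebra_simps)
qed

lemma curv_swap:
  assumes "X \<in> \<Gamma>" "Y \<in> \<Gamma>" "Z \<in> \<Gamma>"
  shows "curv Y X Z = - curv X Y Z"
proof -
  have sw: "pr (bracket Y X) = - pr (bracket X Y)" using nab_torsion[OF assms(1,2)] nab_torsion[OF assms(2,1)]
    by (metis minus_diff_eq)
  have "nab 0 Z = 0" using nab_lin_left(1)[OF section_0 section_0 assms(3)] by simp
  then have "nab (pr (bracket Y X)) Z = - nab (pr (bracket X Y)) Z"
    using nab_diff_left[OF section_0 pr_bracket_section[OF assms(1,2)] assms(3)] sw by simp
  moreover have "fmult (- f) V = - fmult f V" for f :: "'a \<Rightarrow> real" and V :: "'a vfield"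
    by (simp add: fun_eq_iff fmult_apply scaleR_fun_apply)
  ultimately show ?thesis by (simp add: curv_def omega_swap[OF assms(1,2)])
qed

text \<open>Ricci identity for a parallel pairing; the last term of the curvature contributes the Lie
  derivative along the Reeb field.\<close>

lemma curv_pairing:
  fixes T :: "'a vfield \<Rightarrow> 'a vfield \<Rightarrow> 'a \<Rightarrow> real"
  assumes sm: "\<And>X Y. X \<in> \<Gamma> \<Longrightarrow> Y \<in> \<Gamma> \<Longrightarrow> T X Y \<in> C_infty A"
    and add_l: "\<And>X Y Z. X \<in> \<Gamma> \<Longrightarrow> Y \<in> \<Gamma> \<Longrightarrow> Z \<in> \<Gamma> \<Longrightarrow> T (X + Y) Z = T X Z + T Y Z"
    and add_r: "\<And>X Y Z. X \<in> \<Gamma> \<Longrightarrow> Y \<in> \<Gamma> \<Longrightarrow> Z \<in> \<Gamma> \<Longrightarrow> T X (Y + Z) = T X Y + T X Z"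
    and mult_l: "\<And>f X Y. f \<in> C_infty A \<Longrightarrow> X \<in> \<Gamma> \<Longrightarrow> Y \<in> \<Gamma> \<Longrightarrow> T (fmult f X) Y = f * T X Y"
    and mult_r: "\<And>f X Y. f \<in> C_infty A \<Longrightarrow> X \<in> \<Gamma> \<Longrightarrow> Y \<in> \<Gamma> \<Longrightarrow> T X (fmult f Y) = f * T X Y"
    and par: "\<And>X Y Z. X \<in> \<Gamma> \<Longrightarrow> Y \<in> \<Gamma> \<Longrightarrow> Z \<in> \<Gamma> \<Longrightarrow> app X (T Y Z) = T (nab X Y) Z + T Y (nab X Z)"
    and X: "X \<in> \<Gamma>" and Y: "Y \<in> \<Gamma>" and Z: "Z \<in> \<Gamma>" and W: "W \<in> \<Gamma>"
  shows "T (curv X Y Z) W + T Z (curv X Y W)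
    = - \<omega> X Y * (app \<xi> (T Z W) - T (bracket \<xi> Z) W - T Z (bracket \<xi> W))"
proof -
  have diff_l: "T (U - V) U' = T U U' - T V U'" if "U \<in> \<Gamma>" "V \<in> \<Gamma>" "U' \<in> \<Gamma>" for U V U'
    using add_l[OF section_diff[OF that(1,2)] that(2,3)] by (simp add: eq_diff_eq)
  have diff_r: "T U' (U - V) = T U' U - T U' V" if "U \<in> \<Gamma>" "V \<in> \<Gamma>" "U' \<in> \<Gamma>" for U V U'
    using add_r[OF that(3) section_diff[OF that(1,2)] that(2)] by (simp add: eq_diff_eq)
  note sec = nab_section pr_bracket_section Reeb_bracket_section section_diff section_fmult omega_C_infty
  let ?P = "pr (bracket X Y)"
  have second: "app U (app V (T Z W)) = T (nab U (nab V Z)) W + T (nab V Z) (nab U W)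
      + (T (nab U Z) (nab V W) + T Z (nab U (nab V W)))" if "U \<in> \<Gamma>" "V \<in> \<Gamma>" for U V
    using that by (simp add: par Z W sec app_right section_vf sm)
  \<comment> \<open>After antisymmetrising in \<open>X\<close> and \<open>Y\<close>, the mixed
    products of first derivatives in \<open>second\<close> cancel. The result is compared with the
    bracket acting on \<open>T Z W\<close>, split into its horizontal and vertical parts.\<close>
  have "app (bracket X Y) (T Z W) = app ?P (T Z W) - \<omega> X Y * app \<xi> (T Z W)"
    by (subst bracket_decomp[OF X Y]) (simp only: app_left)
  then have 1: "T (nab X (nab Y Z)) W + T Z (nab X (nab Y W)) - T (nab Y (nab X Z)) W - T Z (nab Y (nab X W))
     = T (nab ?P Z) W + T Z (nab ?P W) - \<omega> X Y * app \<xi> (T Z W)"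
    unfolding app_bracket second[OF X Y] second[OF Y X] par[OF pr_bracket_section[OF X Y] Z W]
    by (simp add: algebra_simps)
  have 2: "T (curv X Y Z) W = T (nab X (nab Y Z)) W - T (nab Y (nab X Z)) W - T (nab ?P Z) W + \<omega> X Y * T (bracket \<xi> Z) W"
    unfolding curv_def by (simp add: add_l diff_l mult_l sec X Y Z W)
  have 3: "T Z (curv X Y W) = T Z (nab X (nab Y W)) - T Z (nab Y (nab X W)) - T Z (nab ?P W) + \<omega> X Y * T Z (bracket \<xi> W)"
    unfolding curv_def by (simp add: add_r diff_r mult_r sec X Y Z W)
  have "T (curv X Y Z) W + T Z (curv X Y W)
    = (T (nab X (nab Y Z)) W + T Z (nab X (nab Y W)) - T (nab Y (nab X Z)) W - T Z (nab Y (nab X W)))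
      - (T (nab ?P Z) W + T Z (nab ?P W)) + \<omega> X Y * (T (bracket \<xi> Z) W + T Z (bracket \<xi> W))"
    unfolding 2 3 by (simp add: algebra_simps)
  then show ?thesis unfolding 1 by (simp add: algebra_simps)
qed

lemma curv_metric:
  assumes "X \<in> \<Gamma>" "Y \<in> \<Gamma>" "Z \<in> \<Gamma>" "W \<in> \<Gamma>"
  shows "G (curv X Y Z) W + G Z (curv X Y W) = - \<omega> X Y * Lie_metric Z W"
  unfolding Lie_metric_def
  by (rule curv_pairing[of G, OF G_C_infty G_add_left G_add_right _ _ nab_metric assms])
    (simp_all add: G_fmult_left G_fmult_right)

lemma curv_omega:
  assumes "X \<in> \<Gamma>" "Y \<in> \<Gamma>" "Z \<in> \<Gamma>" "W \<in> \<Gamma>"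
  shows "\<omega> (curv X Y Z) W + \<omega> Z (curv X Y W) = 0"
proof -
  have "\<omega> (curv X Y Z) W + \<omega> Z (curv X Y W)
      = - \<omega> X Y * (app \<xi> (\<omega> Z W) - \<omega> (bracket \<xi> Z) W - \<omega> Z (bracket \<xi> W))"
    by (rule curv_pairing[of \<omega>, OF omega_C_infty omega_add_left omega_add_right _ _ nab_omega assms])
      (simp_all add: omega_fmult_left omega_fmult_right)
  then show ?thesis using omega_Reeb[OF assms(3,4)] by simp
qed

text \<open>The cyclic sum is regrouped so that each group starts with an outer derivative of
  \<nabla>_Y Z - \<nabla>_Z Y. As the torsion vanishes, a group equals the horizontal part of
  [X,[Y,Z]], its Reeb term accounting for the vertical part of [Y,Z]; what remains is the Jacobi
  identity.\<close>

lemma curv_Bianchi: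
  assumes X: "X \<in> \<Gamma>" and Y: "Y \<in> \<Gamma>" and Z: "Z \<in> \<Gamma>"
  shows "curv X Y Z + curv Y Z X + curv Z X Y = 0"
proof -
  have key: "nab X (nab Y Z) - nab X (nab Z Y) - nab (pr (bracket Y Z)) X + fmult (\<omega> Y Z) (bracket \<xi> X)
      = pr (bracket X (bracket Y Z))" if X: "X \<in> \<Gamma>" and Y: "Y \<in> \<Gamma>" and Z: "Z \<in> \<Gamma>" for X Y Z
  proof -
    note v = section_vf[OF X] section_vf[OF Y] section_vf[OF Z]
    note b = bracket_vector_field[OF v(2,3)]
    have om: "\<omega> Y Z \<in> C_infty A" by (rule omega_C_infty[OF Y Z])
    note fx = vector_field_fmult[OF om Reeb_vf]
    note bxi = bracket_vector_field[OF v(1) Reeb_vf]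
    have "pr (bracket Y Z) = bracket Y Z + fmult (\<omega> Y Z) \<xi>"
      using bracket_decomp[OF Y Z] by (simp add: eq_diff_eq)
    then have "bracket X (pr (bracket Y Z)) = bracket X (bracket Y Z)
        + (fmult (app X (\<omega> Y Z)) \<xi> + fmult (\<omega> Y Z) (bracket X \<xi>))"
      using bracket_add[OF v(1) b fx] bracket_fmult[OF v(1) Reeb_vf om] by simp
    then have "pr (bracket X (pr (bracket Y Z))) = pr (bracket X (bracket Y Z))
        + (fmult (app X (\<omega> Y Z)) (pr \<xi>) + fmult (\<omega> Y Z) (pr (bracket X \<xi>)))"
      using pr_add[OF bracket_vector_field[OF v(1) b] vector_field_add[OF vector_field_fmult[OF app_C_infty[OF v(1) om] Reeb_vf] vector_field_fmult[OF om bxi]]]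
        pr_add[OF vector_field_fmult[OF app_C_infty[OF v(1) om] Reeb_vf] vector_field_fmult[OF om bxi]]
        pr_fmult[OF Reeb_vf] pr_fmult[OF bxi] by simp
    moreover have "pr (bracket X \<xi>) = - bracket \<xi> X"
    proof -
      have "- bracket \<xi> X \<in> \<Gamma>" using section_diff[OF section_0 Reeb_bracket_section[OF X]] by simp
      then show ?thesis using pr_id bracket_swap[of X \<xi>] by metis
    qed
    moreover have "fmult f 0 = 0" "fmult f (- V) = - fmult f V" for f :: "'a \<Rightarrow> real" and V :: "'a vfield"
      by (simp_all add: fun_eq_iff fmult_apply scaleR_fun_apply)
    ultimately have "pr (bracket X (pr (bracket Y Z))) = pr (bracket X (bracket Y Z)) - fmult (\<omega> Y Z) (bracket \<xi> X)"
      by (simp add: pr_Reeb)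
    moreover have "pr (bracket X (pr (bracket Y Z))) = nab X (pr (bracket Y Z)) - nab (pr (bracket Y Z)) X"
      by (rule nab_torsion[OF X pr_bracket_section[OF Y Z], symmetric])
    moreover have "nab X (pr (bracket Y Z)) = nab X (nab Y Z) - nab X (nab Z Y)"
      unfolding nab_torsion[OF Y Z, symmetric] by (rule nab_diff_right[OF X nab_section[OF Y Z] nab_section[OF Z Y]])
    ultimately show ?thesis by (simp add: algebra_simps)
  qed
  note v = section_vf[OF X] section_vf[OF Y] section_vf[OF Z]
  note b = bracket_vector_field[OF v(2,3)] bracket_vector_field[OF v(3,1)] bracket_vector_field[OF v(1,2)]
  note bb = bracket_vector_field[OF v(1) b(1)] bracket_vector_field[OF v(2) b(2)] bracket_vector_field[OF v(3) b(3)]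
  have "pr 0 = 0" using pr_id[OF section_0] .
  then have "pr (bracket X (bracket Y Z)) + pr (bracket Y (bracket Z X)) + pr (bracket Z (bracket X Y)) = 0"
    using Jacobi[OF v] pr_add[OF bb(1,2)] pr_add[OF vector_field_add[OF bb(1,2)] bb(3)] by simp
  then show ?thesis
    unfolding key[OF X Y Z, symmetric] key[OF Y Z X, symmetric] key[OF Z X Y, symmetric] curv_def
    by (simp add: algebra_simps)
qed

text \<open>Both \<omega> and g are parallel and g is nondegenerate, so the endomorphism relating
  them is parallel too.\<close>

lemma nab_rep:
  assumes Z: "Z \<in> \<Gamma>" and X: "X \<in> \<Gamma>"
  shows "nab Z (act rep X) = act rep (nab Z X)"
proof
  fix p
  note s = nab_section[OF Z rep_section[OF X]] rep_section[OF nab_section[OF Z X]]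
  show "nab Z (act rep X) p = act rep (nab Z X) p"
  proof (rule g_eqI[OF section_dist[OF s(1)] section_dist[OF s(2)]])
    fix w assume w: "w \<in> \<D> p"
    obtain V where V: "V \<in> \<Gamma>" "V p = w" by (rule dist_extension[OF w]) (rule that)
    have "G (nab Z (act rep X)) V = app Z (G (act rep X) V) - G (act rep X) (nab Z V)"
      using nab_metric[OF Z rep_section[OF X] V(1)] by simp
    also have "\<dots> = \<omega> (nab Z X) V"
      using nab_omega[OF Z X V(1)] by (simp add: G_rep X V(1) nab_section Z)
    also have "\<dots> = G (act rep (nab Z X)) V" by (simp add: G_rep nab_section Z X V(1))
    finally have "G V (nab Z (act rep X)) = G V (act rep (nab Z X))"
      by (simp add: G_swap[OF V(1)] s)
    from fun_cong[OF this, of p] show "g p w (nab Z (act rep X) p) = g p w (act rep (nab Z X) p)"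
      unfolding ev2_def V(2) .
  qed
qed

end

section \<open>Functions that are constant along the distribution\<close>

context contact_sR
begin

text \<open>Choose sections with \<omega>(X,Y) nonzero at \<open>q\<close>. Their bracket
  annihilates \<open>f\<close> at \<open>q\<close>, and so does its horizontal part; hence so does
  \<xi>. The bracket involves second derivatives, so the hypothesis is required on an open set and
  not only at \<open>q\<close>.\<close>

lemma horizontally_constant:
  assumes dim: "2 \<le> DIM('e)" and f: "f \<in> C_infty A" and W: "open W"
    and z: "\<And>q Z. q \<in> W \<Longrightarrow> Z \<in> \<Gamma> \<Longrightarrow> Z q f = 0"
    and q: "q \<in> W" and v: "v \<in> tangent_space A q"
  shows "v f = 0"
proof -
  have hor: "u f = 0" if u: "u \<in> \<D> q" for u
  proof -
    obtain Z where "Z \<in> \<Gamma>" "Z q = u" by (rule dist_extension[OF u]) (rule that)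
    then show ?thesis using z[OF q] by metis
  qed
  obtain I :: "'e set" and F V where F: "frame I F V" "q \<in> V" "I \<subseteq> Basis" by (rule frame_at) (rule that)
  \<comment> \<open>A member of a nonempty frame is a section that does not vanish at
    \<open>q\<close>; nondegeneracy then supplies its partner.\<close>
  then have "I \<noteq> {}" using dim by (auto simp: frame_def)
  then obtain i where i: "i \<in> I" by blast
  have X: "F i \<in> \<Gamma>" "g q (F i q) (F i q) = 1" using F i by (simp_all add: frame_def)
  then have "F i q \<noteq> 0" using g_eq_0_iff[OF section_dist[OF X(1)], of q] by simp
  then obtain Y where Y: "Y \<in> \<Gamma>" "\<omega> (F i) Y q \<noteq> 0" by (rule omega_nondegenerate[OF X(1)]) (rule that)
  have app0: "U q (app Z f) = 0" if U: "U \<in> \<Gamma>" and Z: "Z \<in> \<Gamma>" for U Z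
  proof -
    note t = vector_field_tangent[OF section_vf[OF U], of q]
    have "U q (app Z f) = U q 0"
      by (rule tangent_local[OF t app_C_infty[OF section_vf[OF Z] f] C_infty_0 W q]) (simp add: app_def z Z)
    then show ?thesis using tangent_0[OF t] by simp
  qed
  have "bracket (F i) Y q f = 0"
    unfolding bracket_def using app0[OF X(1) Y(1)] app0[OF Y(1) X(1)] by simp
  moreover have "bracket (F i) Y q f = pr (bracket (F i) Y) q f - \<omega> (F i) Y q * \<xi> q f"
    by (subst bracket_decomp[OF X(1) Y(1)]) (simp add: fmult_apply scaleR_fun_apply)
  moreover have "pr (bracket (F i) Y) q f = 0"
    by (rule z[OF q pr_section[OF bracket_vector_field[OF section_vf[OF X(1)] section_vf[OF Y(1)]]]])
  ultimately have xi: "\<xi> q f = 0" using Y(2) by simp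
  obtain V where V: "V \<in> vector_fields A" "V q = v" using tangent_extension[OF v] by blast
  have "pr V q f = 0" by (rule z[OF q pr_section[OF V(1)]])
  then show ?thesis using V(2) xi by (simp add: pr_apply scaleR_fun_apply)
qed

lemma G_rep_rep: "X \<in> \<Gamma> \<Longrightarrow> Y \<in> \<Gamma> \<Longrightarrow> G (act rep (act rep X)) Y = - G (act rep X) (act rep Y)"
  using G_rep_swap[of "act rep X" Y] by (simp add: rep_section)

lemma rep_eq_0:
  assumes v: "v \<in> \<D> p" and z: "rep p v = 0"
  shows "v = 0"
proof (rule ccontr)
  assume "v \<noteq> 0"
  obtain X where X: "X \<in> \<Gamma>" "X p = v" by (rule dist_extension[OF v]) (rule that)
  with \<open>v \<noteq> 0\<close> have "X p \<noteq> 0" by simp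
  then obtain Y where Y: "Y \<in> \<Gamma>" "\<omega> X Y p \<noteq> 0" by (rule omega_nondegenerate[OF X(1)]) (rule that)
  show False using rep_facts(2)[OF v X(1) Y(1) X(2)] Y(2) z g_zero(2)[OF section_dist[OF Y(1)]] by simp
qed

end

section \<open>The algebra applied at a point with torsion\<close>

context contact_Schouten
begin

text \<open>An orthonormal frame identifies the distribution at \<open>p\<close> with the hyperplane
  \<open>S\<close> of the coordinate space. Through \<open>comb\<close> and its inverse
  \<open>co\<close>, the curvature identities for sections become the hypotheses of
  \<open>curvature_algebra\<close>.\<close>

lemma torsion_point:
  assumes dim: "6 \<le> DIM('e)" and XY: "X0 \<in> \<Gamma>" "Y0 \<in> \<Gamma>" "Lie_metric X0 Y0 p \<noteq> 0"
  obtains \<mu> where "\<mu> < 0" "\<And>v. v \<in> \<D> p \<Longrightarrow> rep p (rep p v) = \<mu> *\<^sub>R v"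
proof -
  obtain I :: "'e set" and F W where F: "frame I F W" "p \<in> W" "I \<subseteq> Basis" by (rule frame_at) (rule that)
  have FI: "F i \<in> \<Gamma>" if "i \<in> I" for i using F(1) that by (simp add: frame_def)
  have finI: "finite I" and cardI: "card I + 1 = DIM('e)" using F(1) by (simp_all add: frame_def)
  have on: "g p (F i p) (F j p) = (if i = j then 1 else 0)" if "i \<in> I" "j \<in> I" for i j
    using F(1,2) that by (simp add: frame_def)
  define S where "S = span I"
  \<comment> \<open>A section rather than a vector, because \<open>curv\<close> and
    \<open>Lie_metric\<close> act on sections. Components of \<open>x\<close> outside
    \<open>I\<close> are ignored, which extends the transported maps to all of
    \<open>'e\<close>.\<close>
  define comb where "comb x = (\<Sum>i\<in>I. fmult (\<lambda>_. x \<bullet> i) (F i))" for x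
  define co where "co v = (\<Sum>i\<in>I. g p v (F i p) *\<^sub>R i)" for v
  have comb_sec: "comb x \<in> \<Gamma>" for x unfolding comb_def by (intro section_sum section_fmult C_infty_const FI)
  have comb_D: "comb x p \<in> \<D> p" for x by (rule section_dist[OF comb_sec])
  have comb_apply: "comb x q = (\<Sum>i\<in>I. (x \<bullet> i) *\<^sub>R F i q)" for x q
    unfolding comb_def sum_fun_apply[of "\<lambda>i. fmult (\<lambda>_. x \<bullet> i) (F i)"] by (simp only: fmult_apply)
  have comb_add: "comb (x + y) = comb x + comb y" for x y
  proof
    fix q show "comb (x + y) q = (comb x + comb y) q"
      by (subst plus_fun_apply) (simp only: comb_apply inner_add_left scaleR_add_left sum.distrib)
  qed
  have comb_scaleR: "comb (c *\<^sub>R x) = fmult (\<lambda>_. c) (comb x)" for c x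
  proof
    fix q show "comb (c *\<^sub>R x) q = fmult (\<lambda>_. c) (comb x) q"
      by (simp only: comb_apply fmult_apply inner_scaleR_left scaleR_sum_right scaleR_scaleR)
  qed
  have co_S: "co v \<in> S" for v
    unfolding co_def S_def by (intro span_sum span_scale span_base)
  have co_inner: "co v \<bullet> i = g p v (F i p)" if "i \<in> I" for v i
  proof -
    have "co v \<bullet> i = (\<Sum>j\<in>I. if j = i then g p v (F j p) else 0)"
      unfolding co_def inner_sum_left
      by (rule sum.cong[OF refl]) (use F(3) that in \<open>auto simp: inner_Basis subset_iff\<close>)
    then show ?thesis using finI that by simp
  qed
  have comb_co: "comb (co v) p = v" if v: "v \<in> \<D> p" for v
  proof -
    have "comb (co v) p = (\<Sum>i\<in>I. g p v (F i p) *\<^sub>R F i p)"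
      unfolding comb_apply by (rule sum.cong[OF refl]) (simp add: co_inner)
    then show ?thesis using frame_expansion[OF F(1,2) v] by simp
  qed
  have co_dot: "co v \<bullet> w = g p v (comb w p)" if v: "v \<in> \<D> p" for v w
  proof -
    have "g p v (comb w p) = (\<Sum>i\<in>I. (w \<bullet> i) * g p v (F i p))"
      unfolding comb_apply
      using v FI section_dist by (subst g_sum) (auto simp: g_scaleR subspace_scale[OF subspace_dist])
    then show ?thesis
      unfolding co_def inner_sum_left by (simp add: inner_commute[of _ w] mult.commute)
  qed
  have co_add: "co (u + v) = co u + co v" if u: "u \<in> \<D> p" and v: "v \<in> \<D> p" for u v
  proof -
    have "g p (u + v) (F i p) = g p u (F i p) + g p v (F i p)" if "i \<in> I" for i
    proof -
      note f = section_dist[OF FI[OF that], of p]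
      show ?thesis
        using g_add[OF f u v] g_facts(2)[OF f u] g_facts(2)[OF f v]
          g_facts(2)[OF f subspace_add[OF subspace_dist u v]] by simp
    qed
    then have "co (u + v) = (\<Sum>i\<in>I. (g p u (F i p) + g p v (F i p)) *\<^sub>R i)"
      unfolding co_def by (intro sum.cong[OF refl]) (simp only:)
    then show ?thesis by (simp add: co_def scaleR_add_left sum.distrib)
  qed
  have co_scaleR: "co (c *\<^sub>R u) = c *\<^sub>R co u" if u: "u \<in> \<D> p" for c u
  proof -
    have "g p (c *\<^sub>R u) (F i p) = c * g p u (F i p)" if "i \<in> I" for i
    proof -
      note f = section_dist[OF FI[OF that], of p]
      show ?thesis
        using g_scaleR[OF f u, of c] g_facts(2)[OF f u] g_facts(2)[OF f subspace_scale[OF subspace_dist u, of c]] by simp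
    qed
    then have "co (c *\<^sub>R u) = (\<Sum>i\<in>I. (c * g p u (F i p)) *\<^sub>R i)"
      unfolding co_def by (intro sum.cong[OF refl]) (simp only:)
    then show ?thesis by (simp add: co_def scaleR_sum_right)
  qed
  have co_0: "co 0 = 0" using co_scaleR[OF subspace_0[OF subspace_dist], of 0] by simp
  define A' where "A' x = co (rep p (comb x p))" for x
  define R where "R x y z = co (curv (comb x) (comb y) (comb z) p)" for x y z
  define \<tau> where "\<tau> z w = (1 / 2) * Lie_metric (comb z) (comb w) p" for z w
  have rep_D: "rep p v \<in> \<D> p" if "v \<in> \<D> p" for v by (rule rep_facts(1)[OF that])
  have A'_dot: "A' x \<bullet> y = \<omega> (comb x) (comb y) p" for x y
    unfolding A'_def co_dot[OF rep_D[OF comb_D]] by (rule rep_facts(2)[OF comb_D comb_sec comb_sec refl])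
  have A'_swap: "A' x \<bullet> y = - (x \<bullet> A' y)" for x y
    using A'_dot[of x y] A'_dot[of y x] omega_swap[OF comb_sec comb_sec, of x y] by (simp add: inner_commute)
  have cs: "curv (comb x) (comb y) (comb z) \<in> \<Gamma>" for x y z by (intro curv_section comb_sec)
  have cD: "curv (comb x) (comb y) (comb z) p \<in> \<D> p" for x y z by (rule section_dist[OF cs])
  have R_dot: "R x y z \<bullet> w = G (curv (comb x) (comb y) (comb z)) (comb w) p" for x y z w
    unfolding R_def co_dot[OF cD] by (simp add: ev2_def)
  have A'_0: "x = 0" if x: "x \<in> S" and z: "A' x = 0" for x
  proof -
    have "rep p (comb x p) = comb (A' x) p" unfolding A'_def by (rule comb_co[OF rep_D[OF comb_D], symmetric])
    also have "\<dots> = 0" unfolding z comb_apply by simp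
    finally have c0: "comb x p = 0" by (rule rep_eq_0[OF comb_D])
    have "orthogonal x i" if i: "i \<in> I" for i
    proof -
      have "g p (F i p) (comb x p) = (\<Sum>j\<in>I. (x \<bullet> j) * g p (F i p) (F j p))"
        unfolding comb_apply
        using FI[OF i] FI section_dist by (subst g_sum) (auto simp: g_scaleR subspace_scale[OF subspace_dist])
      also have "\<dots> = (\<Sum>j\<in>I. if j = i then x \<bullet> j else 0)"
        by (rule sum.cong[OF refl]) (use on i in auto)
      also have "\<dots> = x \<bullet> i" using finI i by simp
      finally show ?thesis using c0 g_zero(1)[OF section_dist[OF FI[OF i]]] by (simp add: orthogonal_def)
    qed
    then have "orthogonal x x" using x unfolding S_def by (metis orthogonal_to_span)
    then show ?thesis by (simp add: orthogonal_def)
  qed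
  have "dim S = card I"
    unfolding S_def dim_span
    by (rule dim_eq_card_independent) (rule independent_mono[OF independent_Basis F(3)])
  \<comment> \<open>\<open>I\<close> has one element less than the basis, so 6 becomes 5.\<close>
  then have dimS: "5 \<le> dim S" using dim cardI by linarith
  have lin_A': "linear A'"
  proof (rule linearI)
    show "A' (x + y) = A' x + A' y" for x y
    proof -
      have "comb (x + y) p = comb x p + comb y p" unfolding comb_add by simp
      then show ?thesis unfolding A'_def by (simp only: rep_add comb_D co_add rep_D)
    qed
    show "A' (c *\<^sub>R x) = c *\<^sub>R A' x" for c x
      unfolding A'_def comb_scaleR fmult_apply by (simp only: rep_scaleR comb_D co_scaleR rep_D)
  qed
  have lin_R: "linear (R x y)" for x y
  proof (rule linearI)
    show "R x y (z + w) = R x y z + R x y w" for z w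
    proof -
      have "curv (comb x) (comb y) (comb (z + w)) p = curv (comb x) (comb y) (comb z) p + curv (comb x) (comb y) (comb w) p"
        unfolding comb_add curv_add[OF comb_sec comb_sec comb_sec comb_sec] by (rule plus_fun_apply)
      then show ?thesis unfolding R_def by (simp only: co_add cD)
    qed
    show "R x y (c *\<^sub>R z) = c *\<^sub>R R x y z" for c z
      unfolding R_def comb_scaleR curv_scaleR[OF comb_sec comb_sec comb_sec] fmult_apply by (simp only: co_scaleR cD)
  qed
  have R_anti: "R x y z = - R y x z" for x y z
  proof -
    have "curv (comb x) (comb y) (comb z) p = (- 1) *\<^sub>R curv (comb y) (comb x) (comb z) p"
      unfolding curv_swap[OF comb_sec comb_sec comb_sec, of y x z] by simp
    then show ?thesis unfolding R_def using co_scaleR[OF cD, of "- 1" y x z] by simp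
  qed
  have R_metric: "R x y z \<bullet> w + z \<bullet> R x y w = - 2 * (A' x \<bullet> y) * \<tau> z w" for x y z w
  proof -
    have "z \<bullet> R x y w = G (comb z) (curv (comb x) (comb y) (comb w)) p"
      using R_dot[of x y w z] by (simp add: inner_commute G_swap[OF comb_sec cs])
    then show ?thesis
      using fun_cong[OF curv_metric[OF comb_sec comb_sec comb_sec comb_sec, of x y z w], of p]
      by (simp add: R_dot A'_dot \<tau>_def)
  qed
  have R_symp: "A' (R x y z) \<bullet> w + A' z \<bullet> R x y w = 0" for x y z w
  proof -
    \<comment> \<open>The curvature section and the frame combination built from its coordinates
      agree only at \<open>p\<close>; tensoriality of \<omega> permits the exchange.\<close>
    have "A' (R x y z) \<bullet> w = \<omega> (curv (comb x) (comb y) (comb z)) (comb w) p"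
      unfolding A'_dot R_def by (rule omega_tensorial[OF comb_sec comb_sec cs comb_sec comb_co[OF cD] refl])
    moreover have "A' z \<bullet> R x y w = \<omega> (comb z) (curv (comb x) (comb y) (comb w)) p"
      unfolding A'_dot R_def by (rule omega_tensorial[OF comb_sec comb_sec comb_sec cs refl comb_co[OF cD]])
    ultimately show ?thesis
      using fun_cong[OF curv_omega[OF comb_sec comb_sec comb_sec comb_sec, of x y z w], of p] by simp
  qed
  have R_Bianchi: "R x y z + R y z x + R z x y = 0" for x y z
  proof -
    have "curv (comb x) (comb y) (comb z) p + curv (comb y) (comb z) (comb x) p + curv (comb z) (comb x) (comb y) p = 0"
      using fun_cong[OF curv_Bianchi[OF comb_sec comb_sec comb_sec, of x y z], of p] by (simp only: plus_fun_apply zero_fun_apply)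
    then have "co (curv (comb x) (comb y) (comb z) p + curv (comb y) (comb z) (comb x) p + curv (comb z) (comb x) (comb y) p) = 0"
      by (simp only: co_0)
    then show ?thesis
      unfolding R_def by (simp only: co_add cD subspace_add[OF subspace_dist])
  qed
  have \<tau>0: "\<tau> (co (X0 p)) (co (Y0 p)) \<noteq> 0"
    using XY(3) Lie_metric_tensorial[OF comb_sec comb_sec XY(1,2) comb_co[OF section_dist[OF XY(1)]] comb_co[OF section_dist[OF XY(2)]]]
    by (simp add: \<tau>_def)
  obtain \<mu> where \<mu>: "\<And>x. x \<in> S \<Longrightarrow> A' (A' x) = \<mu> *\<^sub>R x"
    by (rule curvature_algebra[of S A' R \<tau>, OF _ dimS lin_A' _ A'_swap A'_0 lin_R _ R_anti R_metric R_symp R_Bianchi co_S co_S \<tau>0])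
      (auto simp: S_def A'_def R_def co_S[unfolded S_def])
  have key: "rep p (rep p v) = \<mu> *\<^sub>R v" if v: "v \<in> \<D> p" for v
  proof -
    have "A' (A' (co v)) = co (rep p (rep p v))"
      unfolding A'_def by (simp only: comb_co rep_D v)
    then have "comb (co (rep p (rep p v))) p = comb (\<mu> *\<^sub>R co v) p" using \<mu>[OF co_S] by simp
    then show ?thesis by (simp only: comb_co rep_D v comb_scaleR fmult_apply)
  qed
  \<comment> \<open>The sign of \<mu> is read off from a unit vector v: \<mu> is the product of
    \<open>rep (rep v)\<close> with v, which is minus the squared length of \<open>rep v\<close>,
    with \<open>rep\<close> taken at \<open>p\<close>.\<close>
  have "I \<noteq> {}" using cardI dim by auto
  then obtain i where i: "i \<in> I" by blast
  let ?v = "F i p"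
  have v: "?v \<in> \<D> p" "g p ?v ?v = 1" using section_dist[OF FI[OF i]] on[OF i i] by auto
  then have "?v \<noteq> 0" using g_eq_0_iff[OF v(1)] by auto
  then have "rep p ?v \<noteq> 0" using rep_eq_0[OF v(1)] by blast
  then have "0 < g p (rep p ?v) (rep p ?v)" by (rule g_facts(3)[OF rep_D[OF v(1)]])
  moreover have "g p (rep p (rep p ?v)) ?v = - g p (rep p ?v) (rep p ?v)"
    using fun_cong[OF G_rep_rep[OF FI[OF i] FI[OF i]], of p] by (simp add: ev2_def act_def)
  moreover have "g p (\<mu> *\<^sub>R ?v) ?v = \<mu>"
    using g_scaleR[OF v(1,1), of \<mu>] g_facts(2)[OF v(1) subspace_scale[OF subspace_dist v(1), of \<mu>]] v(2) by simp
  ultimately have "\<mu> < 0" using key[OF v(1)] by simp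
  then show ?thesis using that key by blast
qed

section \<open>Global vanishing of the defect of the square from \<mu>\<close>

definition defect :: "real \<Rightarrow> 'a endo" where
  "defect \<mu> q v = rep q (rep q v) - \<mu> *\<^sub>R v"

lemma defect_dist: "v \<in> \<D> q \<Longrightarrow> defect \<mu> q v \<in> \<D> q"
  unfolding defect_def by (intro subspace_diff subspace_scale subspace_dist rep_facts(1))

lemma defect_lin:
  "u \<in> \<D> q \<Longrightarrow> v \<in> \<D> q \<Longrightarrow> defect \<mu> q (u + v) = defect \<mu> q u + defect \<mu> q v"
  "v \<in> \<D> q \<Longrightarrow> defect \<mu> q (c *\<^sub>R v) = c *\<^sub>R defect \<mu> q v"
  unfolding defect_def by (simp_all only: rep_add rep_scaleR rep_facts(1)) (simp_all add: algebra_simps)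

lemma defect_sum:
  "(\<And>i. i \<in> I \<Longrightarrow> v i \<in> \<D> q) \<Longrightarrow> defect \<mu> q (\<Sum>i\<in>I. v i) = (\<Sum>i\<in>I. defect \<mu> q (v i))"
proof (induction I rule: infinite_finite_induct)
  case (insert i I)
  have "(\<Sum>i\<in>I. v i) \<in> \<D> q" by (rule subspace_sum[OF subspace_dist]) (use insert in auto)
  with insert show ?case
    by (simp only: sum.insert defect_lin(1) insertI1 insert_iff simp_thms)
qed (use defect_lin(2)[OF subspace_0[OF subspace_dist], of \<mu> q 0] in auto)

lemma defect_eq: "act (defect \<mu>) X = act rep (act rep X) - fmult (\<lambda>_. \<mu>) X"
  by (simp add: fun_eq_iff act_def defect_def fmult_apply)

lemma defect_section: "X \<in> \<Gamma> \<Longrightarrow> act (defect \<mu>) X \<in> \<Gamma>"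
  unfolding defect_eq by (intro section_diff rep_section section_fmult C_infty_const)

lemma nab_fmult_const: "X \<in> \<Gamma> \<Longrightarrow> Y \<in> \<Gamma> \<Longrightarrow> nab X (fmult (\<lambda>_. c) Y) = fmult (\<lambda>_. c) (nab X Y)"
  using nab_fmult_right[OF _ _ C_infty_const, of X Y c] app_const[OF section_vf, of X c]
  by (simp add: fun_eq_iff fmult_apply scaleR_fun_apply)

lemma nab_defect: "Z \<in> \<Gamma> \<Longrightarrow> X \<in> \<Gamma> \<Longrightarrow> nab Z (act (defect \<mu>) X) = act (defect \<mu>) (nab Z X)"
  unfolding defect_eq
  by (simp add: nab_diff_right rep_section section_fmult C_infty_const nab_rep nab_fmult_const)

text \<open>Where \<open>F\<close> is orthonormal this is the squared Hilbert-Schmidt norm of the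
  defect. Defined through a frame, it is visibly a smooth function.\<close>

definition defect_norm :: "real \<Rightarrow> 'i set \<Rightarrow> ('i \<Rightarrow> 'a vfield) \<Rightarrow> 'a \<Rightarrow> real" where
  "defect_norm \<mu> I F = (\<Sum>i\<in>I. G (act (defect \<mu>) (F i)) (act (defect \<mu>) (F i)))"

text \<open>The connection coefficients \<gamma> are skew because the inner products of the frame
  fields are constant on \<open>W\<close>. The derivative is twice the contraction of \<gamma> with
  the symmetric matrix of inner products of the defect vectors, and such a contraction is 0.\<close>

lemma defect_norm_derivative:
  assumes F: "frame I F W" and q: "q \<in> W" and Z: "Z \<in> \<Gamma>"
  shows "Z q (defect_norm \<mu> I F) = 0"
proof -
  let ?E = "act (defect \<mu>)"
  have FI: "F i \<in> \<Gamma>" if "i \<in> I" for i using F that by (simp add: frame_def)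
  have W: "open W" using F by (simp add: frame_def)
  note t = vector_field_tangent[OF section_vf[OF Z], of q]
  define \<gamma> where "\<gamma> i j = g q (nab Z (F i) q) (F j q)" for i j
  define s where "s i j = g q (?E (F i) q) (?E (F j) q)" for i j
  have s: "s i j = s j i" if "i \<in> I" "j \<in> I" for i j
    unfolding s_def by (intro g_facts(2) section_dist defect_section FI that)
  have \<gamma>: "\<gamma> i j = - \<gamma> j i" if ij: "i \<in> I" "j \<in> I" for i j
  proof -
    have "Z q (G (F i) (F j)) = Z q (\<lambda>_. if i = j then 1 else 0)"
      by (rule tangent_local[OF t G_C_infty[OF FI[OF ij(1)] FI[OF ij(2)]] C_infty_const W q])
        (use F ij in \<open>simp add: frame_def ev2_def\<close>)
    then have "Z q (G (F i) (F j)) = 0" using tangent_const[OF t] by simp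
    then have "G (nab Z (F i)) (F j) q + G (F i) (nab Z (F j)) q = 0"
      using fun_cong[OF nab_metric[OF Z FI[OF ij(1)] FI[OF ij(2)]], of q] by (simp add: app_def)
    then show ?thesis
      using g_facts(2)[OF section_dist[OF FI[OF ij(1)]] section_dist[OF nab_section[OF Z FI[OF ij(2)]]], of q]
      by (simp add: \<gamma>_def ev2_def)
  qed
  have tm: "Z q (G (?E (F i)) (?E (F i))) = 2 * (\<Sum>j\<in>I. \<gamma> i j * s i j)" if i: "i \<in> I" for i
  proof -
    note E = defect_section[OF FI[OF i], of \<mu>]
    have n: "nab Z (F i) q = (\<Sum>j\<in>I. \<gamma> i j *\<^sub>R F j q)"
      unfolding \<gamma>_def by (rule frame_expansion[OF F q section_dist[OF nab_section[OF Z FI[OF i]]]])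
    have d: "\<gamma> i j *\<^sub>R F j q \<in> \<D> q" if "j \<in> I" for j
      by (intro subspace_scale subspace_dist section_dist FI that)
    have "nab Z (?E (F i)) q = defect \<mu> q (\<Sum>j\<in>I. \<gamma> i j *\<^sub>R F j q)"
      unfolding nab_defect[OF Z FI[OF i]] n[symmetric] by (simp add: act_def)
    also have "\<dots> = (\<Sum>j\<in>I. \<gamma> i j *\<^sub>R ?E (F j) q)"
      using d by (subst defect_sum) (auto simp: defect_lin(2) section_dist FI act_def)
    finally have "g q (?E (F i) q) (nab Z (?E (F i)) q) = g q (?E (F i) q) (\<Sum>j\<in>I. \<gamma> i j *\<^sub>R ?E (F j) q)"
      by (simp only:)
    also have "\<dots> = (\<Sum>j\<in>I. \<gamma> i j * s i j)"
      using FI i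
      by (subst g_sum) (auto simp: s_def g_scaleR section_dist defect_section subspace_scale[OF subspace_dist])
    finally have "g q (?E (F i) q) (nab Z (?E (F i)) q) = (\<Sum>j\<in>I. \<gamma> i j * s i j)" .
    moreover have "Z q (G (?E (F i)) (?E (F i))) = G (nab Z (?E (F i))) (?E (F i)) q + G (?E (F i)) (nab Z (?E (F i))) q"
      using fun_cong[OF nab_metric[OF Z E E], of q] by (simp add: app_def)
    ultimately show ?thesis
      using fun_cong[OF G_swap[OF nab_section[OF Z E] E], of q] by (simp add: ev2_def)
  qed
  have "Z q (defect_norm \<mu> I F) = (\<Sum>i\<in>I. Z q (G (?E (F i)) (?E (F i))))"
    unfolding defect_norm_def by (rule tangent_sum[OF t]) (intro G_C_infty defect_section FI)
  also have "\<dots> = 2 * (\<Sum>i\<in>I. \<Sum>j\<in>I. \<gamma> i j * s i j)"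
    by (simp add: tm sum_distrib_left)
  also have "(\<Sum>i\<in>I. \<Sum>j\<in>I. \<gamma> i j * s i j) = 0"
  proof -
    have "(\<Sum>i\<in>I. \<Sum>j\<in>I. \<gamma> i j * s i j) = (\<Sum>j\<in>I. \<Sum>i\<in>I. \<gamma> i j * s i j)" by (rule sum.swap)
    also have "\<dots> = (\<Sum>j\<in>I. \<Sum>i\<in>I. - (\<gamma> j i * s j i))"
    proof (intro sum.cong refl)
      fix j i assume "j \<in> I" "i \<in> I"
      then show "\<gamma> i j * s i j = - (\<gamma> j i * s j i)" using \<gamma>[of i j] s[of i j] by simp
    qed
    finally show ?thesis by (simp add: sum_negf)
  qed
  finally show ?thesis by simp
qed

lemma defect_norm_eq_0_iff:
  assumes F: "frame I F W" and q: "q \<in> W"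
  shows "defect_norm \<mu> I F q = 0 \<longleftrightarrow> (\<forall>v\<in>\<D> q. defect \<mu> q v = 0)"
proof -
  have FI: "F i \<in> \<Gamma>" if "i \<in> I" for i using F that by (simp add: frame_def)
  have fin: "finite I" using F by (simp add: frame_def)
  let ?e = "\<lambda>i. defect \<mu> q (F i q)"
  have e: "?e i \<in> \<D> q" if "i \<in> I" for i by (intro defect_dist section_dist FI that)
  have h: "defect_norm \<mu> I F q = (\<Sum>i\<in>I. g q (?e i) (?e i))"
    by (simp add: defect_norm_def sum_fun_apply ev2_def act_def)
  have pos: "0 \<le> g q (?e i) (?e i)" if "i \<in> I" for i
    using g_facts(3)[OF e[OF that]] g_eq_0_iff[OF e[OF that]] by force
  have "defect_norm \<mu> I F q = 0 \<longleftrightarrow> (\<forall>i\<in>I. g q (?e i) (?e i) = 0)"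
    unfolding h by (rule sum_nonneg_eq_0_iff[OF fin pos])
  also have "\<dots> \<longleftrightarrow> (\<forall>i\<in>I. ?e i = 0)" using g_eq_0_iff[OF e] by blast
  also have "\<dots> \<longleftrightarrow> (\<forall>v\<in>\<D> q. defect \<mu> q v = 0)"
  proof (intro iffI ballI)
    fix v assume z: "\<forall>i\<in>I. ?e i = 0" and v: "v \<in> \<D> q"
    have "defect \<mu> q v = defect \<mu> q (\<Sum>i\<in>I. g q v (F i q) *\<^sub>R F i q)"
      by (rule arg_cong[OF frame_expansion[OF F q v]])
    also have "\<dots> = (\<Sum>i\<in>I. g q v (F i q) *\<^sub>R ?e i)"
      by (subst defect_sum) (auto simp: defect_lin(2) section_dist FI subspace_scale[OF subspace_dist])
    finally show "defect \<mu> q v = 0" using z by simp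
  qed (use FI section_dist in auto)
  finally show ?thesis .
qed

text \<open>The norm is available only through local frames, so the argument runs over the set
  \<open>N\<close> where the defect vanishes, which refers to no frame. Near every point a locally
  constant function decides membership, hence \<open>N\<close> is open and closed, and it contains
  \<open>p\<close>.\<close>

lemma defect_global:
  assumes conn: "connected (UNIV :: 'a set)" and dim: "2 \<le> DIM('e)" and p: "\<And>v. v \<in> \<D> p \<Longrightarrow> defect \<mu> p v = 0"
    and v: "v \<in> \<D> q"
  shows "defect \<mu> q v = 0"
proof -
  define N where "N = {q. \<forall>v\<in>\<D> q. defect \<mu> q v = 0}"
  have loc: "\<exists>V. open V \<and> q \<in> V \<and> (\<forall>r\<in>V. r \<in> N \<longleftrightarrow> q \<in> N)" for q
  proof -
    obtain I :: "'e set" and F W where F: "frame I F W" "q \<in> W" "I \<subseteq> Basis" by (rule frame_at) (rule that)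
    have W: "open W" and FI: "\<And>i. i \<in> I \<Longrightarrow> F i \<in> \<Gamma>" using F(1) by (simp_all add: frame_def)
    have sm: "defect_norm \<mu> I F \<in> C_infty A"
      unfolding defect_norm_def by (intro C_infty_sum G_C_infty defect_section FI)
    have zero: "v (defect_norm \<mu> I F) = 0" if "r \<in> W" "v \<in> tangent_space A r" for r v
      using horizontally_constant[of "defect_norm \<mu> I F" W r v, OF dim sm W _ that] defect_norm_derivative[OF F(1)] by blast
    obtain V where V: "open V" "q \<in> V" "V \<subseteq> W" "\<And>r. r \<in> V \<Longrightarrow> defect_norm \<mu> I F r = defect_norm \<mu> I F q"
      by (rule locally_constant[of "defect_norm \<mu> I F" W q, OF sm W F(2)]) (rule zero, assumption+, rule that)
    have N: "r \<in> N \<longleftrightarrow> defect_norm \<mu> I F r = 0" if "r \<in> W" for r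
      unfolding N_def defect_norm_eq_0_iff[OF F(1) that] by simp
    have "r \<in> N \<longleftrightarrow> q \<in> N" if "r \<in> V" for r
      unfolding N[OF subsetD[OF V(3) that]] N[OF F(2)] V(4)[OF that] by simp
    then show ?thesis using V(1,2) by blast
  qed
  have opn: "open M" if M: "M = N \<or> M = - N" for M
    unfolding open_subopen[of M]
  proof
    fix q assume q: "q \<in> M"
    from loc[of q] obtain V where V: "open V" "q \<in> V" "\<forall>r\<in>V. r \<in> N \<longleftrightarrow> q \<in> N"
      by (elim exE conjE) (rule that)
    have "r \<in> M" if "r \<in> V" for r
      using M q V(3)[rule_format, OF that] by (elim disjE) (simp_all only: Compl_iff simp_thms)
    then have "V \<subseteq> M" by (rule subsetI)
    with V(1,2) show "\<exists>V. open V \<and> q \<in> V \<and> V \<subseteq> M" by blast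
  qed
  have "open N" "open (- N)" by (rule opn, simp)+
  from connectedD[OF conn this] have "N = {} \<or> - N = {}"
    by simp
  moreover have "p \<in> N" using p by (simp add: N_def)
  ultimately have "q \<in> N" by blast
  then show ?thesis using v by (simp add: N_def)
qed

end

section \<open>The complex structure\<close>

context contact_Schouten
begin

lemma rep_square_pseudo_Hermitian:
  assumes conn: "connected (UNIV :: 'a set)" and \<mu>: "\<mu> < 0"
    and sq: "\<And>p v. v \<in> \<D> p \<Longrightarrow> rep p (rep p v) = \<mu> *\<^sub>R v"
  shows "pseudo_Hermitian A \<theta> (\<lambda>p u v. sqrt (- \<mu>) * g p u v)"
proof -
  \<comment> \<open>For J = \<alpha> \<open>rep\<close> to square to -1 one needs \<alpha>^2 \<mu> =
    -1, so \<alpha> = 1/c. Then \<omega>(X,JY) = -\<alpha> \<mu> g(X,Y) = c g(X,Y), which makes the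
    same \<open>c\<close> the factor for the metric.\<close>
  define c where "c = sqrt (- \<mu>)"
  define \<alpha> where "\<alpha> = 1 / c"
  have c: "c > 0" "c * c = - \<mu>" using \<mu> by (simp_all add: c_def)
  have \<alpha>: "\<alpha> * c = 1" "\<alpha> * \<alpha> * \<mu> = - 1" "\<alpha> * \<mu> = - c"
    using c \<mu> by (simp_all add: \<alpha>_def field_simps)
  define J :: "'a endo" where "J = (\<lambda>p v. \<alpha> *\<^sub>R rep p v)"
  have J_act: "act J X = fmult (\<lambda>_. \<alpha>) (act rep X)" for X
    by (simp add: fun_eq_iff act_def J_def fmult_apply)
  have J_sec: "act J X \<in> \<Gamma>" if "X \<in> \<Gamma>" for X
    unfolding J_act by (intro section_fmult C_infty_const rep_section that)
  have J_lin: "J p (a *\<^sub>R u + b *\<^sub>R v) = a *\<^sub>R J p u + b *\<^sub>R J p v" if "u \<in> \<D> p" "v \<in> \<D> p" for p a b u v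
    unfolding J_def rep_lin[OF that] by (simp add: scaleR_add_right mult.commute)
  have J_endo: "J \<in> endo_fields A \<theta>"
    using J_sec J_lin subspace_scale[OF subspace_dist rep_facts(1)]
    by (auto simp: endo_fields_def linear_over_def J_def)
  have JJ: "J p (J p v) = - v" if v: "v \<in> \<D> p" for p v
  proof -
    have "J p (J p v) = (\<alpha> * \<alpha> * \<mu>) *\<^sub>R v"
      unfolding J_def by (simp only: rep_scaleR[OF rep_facts(1)[OF v]] sq[OF v] scaleR_scaleR mult.assoc)
    then show ?thesis using \<alpha>(2) by simp
  qed
  have act_JJ: "act J (act J X) = - X" if "X \<in> \<Gamma>" for X
  proof
    fix p show "act J (act J X) p = (- X) p"
      using JJ[OF section_dist[OF that], of p] by (simp add: act_def)
  qed
  have act_add: "act J (X + Y) = act J X + act J Y" if "X \<in> \<Gamma>" "Y \<in> \<Gamma>" for X Y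
  proof
    fix p show "act J (X + Y) p = (act J X + act J Y) p"
      using J_lin[OF section_dist[OF that(1)] section_dist[OF that(2)], of p 1 1] by (simp add: act_def)
  qed
  have act_diff: "act J (X - Y) = act J X - act J Y" if "X \<in> \<Gamma>" "Y \<in> \<Gamma>" for X Y
    using act_add[OF section_diff[OF that] that(2)] by (simp add: eq_diff_eq)
  have omega_J: "\<omega> X (act J Y) = (\<lambda>_. c) * G X Y" if X: "X \<in> \<Gamma>" and Y: "Y \<in> \<Gamma>" for X Y
  proof -
    have "act rep (act rep X) = fmult (\<lambda>_. \<mu>) X"
    proof
      fix p show "act rep (act rep X) p = fmult (\<lambda>_. \<mu>) X p"
        using sq[OF section_dist[OF X], of p] by (simp add: act_def fmult_apply)
    qed
    then have "G (act rep X) (act rep Y) = - ((\<lambda>_. \<mu>) * G X Y)"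
      using G_rep_rep[OF X Y] G_fmult_left[OF X Y C_infty_const, of \<mu>] by simp
    then have e: "\<omega> X (act J Y) = (\<lambda>_. \<alpha>) * - ((\<lambda>_. \<mu>) * G X Y)"
      unfolding J_act omega_fmult_right[OF X rep_section[OF Y] C_infty_const] G_rep[OF X rep_section[OF Y], symmetric] by simp
    show ?thesis
    proof
      fix p
      have "\<omega> X (act J Y) p = - (\<alpha> * \<mu>) * G X Y p" using fun_cong[OF e, of p] by simp
      then show "\<omega> X (act J Y) p = ((\<lambda>_. c) * G X Y) p" using \<alpha>(3) by simp
    qed
  qed
  have G_J: "(\<lambda>_. c) * G (act J X) Y = \<omega> X Y" if X: "X \<in> \<Gamma>" and Y: "Y \<in> \<Gamma>" for X Y
  proof -
    have "G (act J X) Y = (\<lambda>_. \<alpha>) * \<omega> X Y"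
      unfolding J_act by (simp add: G_fmult_left rep_section X Y C_infty_const G_rep)
    then show ?thesis using \<alpha>(1) by (simp add: fun_eq_iff mult.commute)
  qed
  let ?S = "\<lambda>X Y. bracket X (act J Y) + bracket (act J X) Y"
  have S_vf: "?S X Y \<in> vector_fields A" if "X \<in> \<Gamma>" "Y \<in> \<Gamma>" for X Y
    by (intro vector_field_add bracket_vector_field section_vf J_sec that)
  \<comment> \<open>Up to sign, the vertical part is \<omega>(X,JY) + \<omega>(JX,Y). It vanishes
    because \<omega>(X,JY) = c g(X,Y) is symmetric in \<open>X\<close> and \<open>Y\<close>.\<close>
  have S_sec: "?S X Y \<in> \<Gamma>" if X: "X \<in> \<Gamma>" and Y: "Y \<in> \<Gamma>" for X Y
  proof (rule sectionI[OF S_vf[OF X Y]])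
    fix p
    have "ev \<theta> (?S X Y) = ev \<theta> (bracket X (act J Y)) + ev \<theta> (bracket (act J X) Y)"
      by (intro ev_theta_add bracket_vector_field section_vf J_sec X Y)
    also have "\<dots> = - (\<omega> X (act J Y) + \<omega> (act J X) Y)"
      by (simp add: omega_eq X Y J_sec)
    also have "\<dots> = 0"
      using omega_swap[OF Y J_sec[OF X]] omega_J[OF X Y] omega_J[OF Y X] G_swap[OF X Y] by simp
    finally show "\<theta> p (?S X Y p) = 0" by (simp only: ev_def fun_eq_iff zero_fun_apply)
  qed
  have nab_J: "nab X (act J Y) = act J (nab X Y)" if "X \<in> \<Gamma>" "Y \<in> \<Gamma>" for X Y
    unfolding J_act by (simp add: nab_fmult_const rep_section nab_rep that)
  \<comment> \<open>As \<open>J\<close> preserves \<omega>, the vertical parts of the two brackets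
    coincide and only the horizontal parts are left. By vanishing torsion these are differences of
    covariant derivatives; \<open>J\<close> passes through \<nabla> and squares to -1, so all terms
    cancel.\<close>
  have N: "bracket X Y - bracket (act J X) (act J Y) + act J (?S X Y) = 0" if X: "X \<in> \<Gamma>" and Y: "Y \<in> \<Gamma>" for X Y
  proof -
    note JX = J_sec[OF X] and JY = J_sec[OF Y]
    note n = nab_section[OF X Y] nab_section[OF Y X] nab_section[OF JX Y] nab_section[OF JY X]
    have "\<omega> (act J X) (act J Y) = \<omega> X Y"
      using omega_J[OF JX Y] G_J[OF X Y] by simp
    then have b: "bracket X Y - bracket (act J X) (act J Y) = pr (bracket X Y) - pr (bracket (act J X) (act J Y))"
      by (subst bracket_decomp[OF X Y], subst bracket_decomp[OF JX JY]) simp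
    have "?S X Y = pr (?S X Y)" by (rule pr_id[OF S_sec[OF X Y], symmetric])
    also have "\<dots> = pr (bracket X (act J Y)) + pr (bracket (act J X) Y)"
      by (intro pr_add bracket_vector_field section_vf J_sec X Y)
    also have "\<dots> = (act J (nab X Y) - nab (act J Y) X) + (nab (act J X) Y - act J (nab Y X))"
      unfolding nab_torsion[OF X JY, symmetric] nab_torsion[OF JX Y, symmetric] nab_J[OF X Y] nab_J[OF Y X] ..
    finally have "act J (?S X Y) = - nab X Y - act J (nab (act J Y) X) + (act J (nab (act J X) Y) + nab Y X)"
      by (simp only: act_add act_diff section_diff J_sec n act_JJ diff_minus_eq_add)
    moreover have "pr (bracket X Y) = nab X Y - nab Y X"
      by (rule nab_torsion[OF X Y, symmetric])
    moreover have "pr (bracket (act J X) (act J Y)) = act J (nab (act J X) Y) - act J (nab (act J Y) X)"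
      unfolding nab_torsion[OF JX JY, symmetric] nab_J[OF JX Y] nab_J[OF JY X] ..
    ultimately show ?thesis unfolding b by (simp only:) simp
  qed
  have ev2_c: "ev2 (\<lambda>p u v. c * g p u v) X Y = (\<lambda>_. c) * G X Y" for X Y
    by (simp add: ev2_def fun_eq_iff)
  have "sub_metric A \<theta> (\<lambda>p u v. c * g p u v)"
    unfolding sub_metric_def ev2_c
  proof (intro conjI ballI allI impI)
    fix p u v assume u: "u \<in> \<D> p"
    show "linear_over (\<D> p) (\<lambda>v. c * g p u v)"
      unfolding linear_over_def by (simp add: g_lin u algebra_simps)
    show "c * g p u v = c * g p v u" if "v \<in> \<D> p" using g_facts(2)[OF u that] by simp
    show "0 < c * g p u u" if "u \<noteq> 0" using g_facts(3)[OF u that] c(1) by simp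
  qed (intro C_infty_mult C_infty_const G_C_infty)
  then have "contact_sub_Riemannian A \<theta> (\<lambda>p u v. c * g p u v)"
    using atlas conn contact by (simp add: contact_sub_Riemannian_def connected_smooth_manifold_def)
  then show ?thesis
    unfolding pseudo_Hermitian_def c_def[symmetric] ev2_c
    using J_endo JJ omega_J S_sec N by (intro conjI bexI[of _ J]) auto
qed

end

theorem theorem9p1:
  fixes A :: "('a::{t2_space, second_countable_topology}, 'e::euclidean_space) atlas"
    and \<theta> :: "'a form1" and g :: "'a form2"
    and \<xi> :: "'a vfield" and D :: "'a partial_conn" and m :: nat
  assumes "contact_sub_Riemannian A \<theta> g"
    and "DIM('e) = 2 * m + 1" and "2 * m + 1 \<ge> 7"
    and "Reeb_field A \<theta> \<xi>"
    and "Schouten_connection A \<theta> g \<xi> D"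
    and "\<exists>X\<in>sections A \<theta>. \<exists>Y\<in>sections A \<theta>. sub_torsion \<xi> g X Y \<noteq> 0"
    and "parallel2 A \<theta> D (ext_d \<theta>)"
  shows "\<exists>c>0. pseudo_Hermitian A \<theta> (\<lambda>p u v. c * g p u v)"
proof -
  interpret contact_Schouten A \<theta> g \<xi> D
    by unfold_locales
      (use assms in \<open>simp_all add: contact_sub_Riemannian_def connected_smooth_manifold_def\<close>)
  have conn: "connected (UNIV :: 'a set)"
    using assms(1) by (simp add: contact_sub_Riemannian_def connected_smooth_manifold_def)
  obtain X Y where XY: "X \<in> \<Gamma>" "Y \<in> \<Gamma>" "sub_torsion \<xi> g X Y \<noteq> 0" using assms(6) by blast
  then have "Lie_metric X Y \<noteq> 0" by (auto simp: sub_torsion_eq)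
  then obtain p where p: "Lie_metric X Y p \<noteq> 0" by (auto simp: fun_eq_iff)
  have dim: "6 \<le> DIM('e)" "2 \<le> DIM('e)" using assms(2,3) by simp_all
  obtain \<mu> where \<mu>: "\<mu> < 0" "\<And>v. v \<in> \<D> p \<Longrightarrow> rep p (rep p v) = \<mu> *\<^sub>R v"
    by (rule torsion_point[OF dim(1) XY(1,2) p]) (rule that)
  have "rep q (rep q v) = \<mu> *\<^sub>R v" if "v \<in> \<D> q" for q v
    using defect_global[OF conn dim(2) _ that, of p \<mu>] \<mu>(2) by (simp add: defect_def)
  from rep_square_pseudo_Hermitian[OF conn \<mu>(1) this] \<mu>(1) show ?thesis
    by (intro exI[of _ "sqrt (- \<mu>)"]) simp
qed

end
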